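(* Let $n\ge 1$, let $s>0$, and let $x=(x_1,\dots,x_n)$ with all $x_i>0$ real and $x_1+\cdots+x_n<s$. (a) The sets $\Delta_T(x)$, for $T\in\mathcal{T}_n$, form the maximal faces (chambers) of a polyhedral decomposition $\Gamma_n$ of $\Pi_n(x)$. (b) Let $k(T)=(k_1,\dots,k_n)$, where $T\in\mathcal{T}_n$. Then $\Delta_T(x)$ is integrally equivalent to the product $\sigma_{k_1}(x_1)\times\cdots\times\sigma_{k_n}(x_n)$, so in particular $$\mathrm{Vol}(\Delta_T(x))=\frac{x_1^{k_1}}{k_1!}\cdots\frac{x_n^{k_n}}{k_n!}.$$ (c) The interior face complex $\Gamma_n^\circ$ of $\Gamma_n$ is combinatorially equivalent to the dual associahedron, i.e., the set of interior faces of $\Gamma_n$, ordered by inclusion, is isomorphic to the face lattice of the dual associahedron.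
   Context: $\Pi_n(x)=\{y\in\mathbb{R}^n: y_i\ge 0,\ y_1+\cdots+y_i\le x_1+\cdots+x_i \text{ for all } 1\le i\le n\}$. Trees. A plane tree is a rooted tree in which the subtrees of each vertex are linearly ordered (left to right). A plane binary tree is a plane tree in which each vertex has zero subtrees (a leaf, or endpoint) or two subtrees, a left and a right one (an internal vertex). $\mathcal{T}_n$ is the set of plane binary trees with $n$ internal vertices. The binary search labeling labels the internal vertices of $T\in\mathcal T_n$ by $1,\dots,n$ so that each internal vertex has a label greater than those in its left subtree and smaller than those in its right subtree. The sequence $k(T)=(k_1,\dots,k_n)$ (using the binary search labeling): $k_i=0$ if the left child of vertex $i$ is an internal vertex; if the left child of vertex $i$ is an endpoint, $k_i$ is the largest integer $r$ for which there is a chain $i=j_1<j_2<\cdots<j_r$ of internal vertices such that $j_h$ is a left child of $j_{h+1}$ for $1\le h\le r-1$. Trees with edge lengths and $\Delta_T$. A plane tree with edge lengths is a pair consisting of a plane tree and a positive real length $\ell(e)$ for each edge $e$. Let $y=(y_1,\dots,y_n)$ with all $y_i>0$ and $y_1+\cdots+y_i\le x_1+\cdots+x_i$ for $1\le i\le n$. Associate with $(x,y)$ a plane tree with edge lengths $\varphi(x,y)$ as follows: start at the root and traverse the tree in depth-first order, first going up a distance $x_1$, then down a distance $y_1$, then up $x_2$, then down $y_2$, etc.; after going down $y_n$, complete the tree by going up a distance $x_{n+1}=s-x_1-\cdots-x_n$ and then down a distance $y_{n+1}=s-y_1-\cdots-y_n$. Generically this gives a planted plane binary tree with edge lengths, i.e.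 the root has exactly one child and every other internal vertex has two children. For a plane binary tree $T$, $\bar T$ denotes the planted plane binary tree such that removing from $\bar T$ its root and the unique edge at the root (the other vertex of that edge becoming the root) gives $T$. For $T\in\mathcal{T}_n$, $\Delta_T(x)$ is the set of all such $y=(y_1,\dots,y_n)$ for which $\varphi(x,y)=(\bar T,\ell)$ for some $\ell$. Other notions. For $t>0$, $\sigma_k(t)$ is the $k$-dimensional simplex of points $(t_1,\dots,t_k)$ with $0\le t_1\le\cdots\le t_k\le t$ ($\sigma_0(t)$ is a point, of volume 1). Two integer polytopes $\mathcal P\subset\mathbb R^k$ and $\mathcal Q\subset\mathbb R^m$ are called integrally equivalent if there is an affine transformation $\psi:\mathbb R^k\to\mathbb R^m$ whose restriction to $\mathcal P$ is a bijection $\mathcal P\to\mathcal Q$ and whose restriction to $\mathbb Z^k\cap\mathrm{aff}(\mathcal P)$ is a bijection onto $\mathbb Z^m\cap\mathrm{aff}(\mathcal Q)$, where $\mathrm{aff}$ denotes affine span. A polyhedral decomposition of a polytope is a finite collection of polytopes, closed under taking faces, any two of which meet in a common (possibly empty) face, with union the given polytope; an interior face is one that does not lie on the boundary of the given polytope. A polygonal decomposition of a convex $(n+2)$-gon $E_{n+2}$ is a set of diagonals of $E_{n+2}$ that do not cross in their interiors. Let $\mathrm{dec}(E_{n+2})$ be the poset of all polygonal decompositions of $E_{n+2}$, ordered by inclusion, with a top element $\hat 1$ adjoined. In the convention used here, the associahedron is the $(n-1)$-dimensional convex polytope whose face lattice is $\mathrm{dec}(E_{n+2})$, and the face lattice of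 the dual associahedron is the dual poset $\mathrm{dec}(E_{n+2})^*$.
   Formalization: Δ_T(x) is read as the closure of the given open set; in (b) integral equivalence is claimed for integer x, and for real x with the lattice condition on the linear part only; in (c) the interior faces get an extra bottom element and are ordered by reverse inclusion. *)

theory Defs
  imports "HOL-Analysis.Analysis" "HOL-Library.Tree"
begin

text \<open>
  Points of \<open>\<real>\<^sup>n\<close> are vectors of type \<open>real^'n\<close> over a finite linearly ordered index type;
  the order plays the role of \<open>1 < 2 < \<dots> < n\<close>, where \<open>n = CARD('n)\<close>.
\<close>

definition coords :: "real^'n::{finite,linorder} \<Rightarrow> real list" where
  "coords v = map (\<lambda>i. v $ i) (sorted_list_of_set UNIV)"

definition Pi_polytope :: "real^'n::{finite,linorder} \<Rightarrow> (real^'n::{finite,linorder}) set" where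
  "Pi_polytope x = {y. \<forall>i. 0 \<le> y $ i \<and> (\<Sum>j\<in>{..i}. y $ j) \<le> (\<Sum>j\<in>{..i}. x $ j)}"


section \<open>Plane binary trees and the sequence \<open>k(T)\<close>\<close>

text \<open>Plane binary trees: a \<^const>\<open>Leaf\<close> is an endpoint, a \<^const>\<open>Node\<close> an internal vertex.\<close>

definition plane_binary_trees :: "nat \<Rightarrow> unit tree set" where
  "plane_binary_trees n = {T. size T = n}"

fun label_from :: "nat \<Rightarrow> 'a tree \<Rightarrow> nat tree" where
  "label_from m Leaf = Leaf"
| "label_from m (Node l a r) =
     Node (label_from m l) (m + size l) (label_from (Suc (m + size l)) r)"

definition bs_label :: "'a tree \<Rightarrow> nat tree" where
  "bs_label T = label_from 1 T"

lemma set_label_from: "set_tree (label_from m T) = {m..<m + size T}"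
proof (induction T arbitrary: m)
  case (Node l a r)
  have "{m..<m + size l} \<union> {m + size l} \<union> {Suc (m + size l)..<Suc (m + size l) + size r}
      = {m..<m + (size l + size r + 1)}"
    by (rule set_eqI) (simp, linarith)
  with Node show ?case
    by simp
qed simp

lemma bst_label_from: "bst (label_from m T)"
  by (induction T arbitrary: m) (simp_all add: set_label_from)

lemma shape_label_from: "map_tree (\<lambda>_. ()) (label_from m T) = map_tree (\<lambda>_. ()) T"
  by (induction T arbitrary: m) simp_all

lemma bs_label_bst:
  "bst (bs_label T)" "set_tree (bs_label T) = {1..size T}"
  "map_tree (\<lambda>_. ()) (bs_label T) = map_tree (\<lambda>_. ()) T"
  unfolding bs_label_def
  by (simp_all add: bst_label_from set_label_from shape_label_from atLeastLessThanSuc_atLeastAtMost)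

text \<open>Both predicates take a labelled tree and refer to its vertices by their labels.\<close>

definition left_child_of :: "nat tree \<Rightarrow> nat \<Rightarrow> nat \<Rightarrow> bool" where
  "left_child_of L i j \<longleftrightarrow> (\<exists>l r r'. Node (Node l i r) j r' \<in> subtrees L)"

definition left_endpoint :: "nat tree \<Rightarrow> nat \<Rightarrow> bool" where
  "left_endpoint L i \<longleftrightarrow> (\<exists>r. Node Leaf i r \<in> subtrees L)"

definition k_entry :: "unit tree \<Rightarrow> nat \<Rightarrow> nat" where
  "k_entry T i =
     (if left_endpoint (bs_label T) i
      then (GREATEST r. \<exists>js. length js = r \<and> js \<noteq> [] \<and> hd js = i \<and> sorted_wrt (<) js \<and>
              set js \<subseteq> {1..size T} \<and>
              (\<forall>h. Suc h < r \<longrightarrow> left_child_of (bs_label T) (js ! h) (js ! Suc h)))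
      else 0)"

definition k_seq :: "unit tree \<Rightarrow> nat list" where
  "k_seq T = map (k_entry T) [1..<Suc (size T)]"


section \<open>Plane trees with edge lengths and the sets \<open>\<Delta>\<^sub>T(x)\<close>\<close>

text \<open>
  A vertex is given by the list, from left to right, of its subtrees, each paired with the
  decoration of the edge leading to it. Taking \<open>'e = unit\<close> gives plane trees, \<open>'e = real\<close>
  plane trees with edge lengths.
\<close>

datatype 'e plane_tree = Vertex "('e \<times> 'e plane_tree) list"

fun children :: "'e plane_tree \<Rightarrow> ('e \<times> 'e plane_tree) list" where
  "children (Vertex es) = es"

definition shape :: "'e plane_tree \<Rightarrow> unit plane_tree" where
  "shape = map_plane_tree (\<lambda>_. ())"

fun plane_of_binary :: "'a tree \<Rightarrow> unit plane_tree" where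
  "plane_of_binary Leaf = Vertex []"
| "plane_of_binary (Node l a r) = Vertex [((), plane_of_binary l), ((), plane_of_binary r)]"

definition planted :: "'a tree \<Rightarrow> unit plane_tree" where
  "planted T = Vertex [((), plane_of_binary T)]"

fun no_unary_below_root :: "'e plane_tree \<Rightarrow> bool" where
  "no_unary_below_root (Vertex es) \<longleftrightarrow>
     (\<forall>e\<in>set es. length (children (snd e)) \<noteq> 1 \<and> no_unary_below_root (snd e))"

datatype move = Up real | Down real

fun edge_moves :: "real plane_tree \<Rightarrow> move list" where
  "edge_moves (Vertex es) =
     concat (map (\<lambda>e. Up (fst e) # edge_moves (snd e) @ [Down (fst e)]) es)"

fun merge_moves :: "move list \<Rightarrow> move list" where
  "merge_moves (Up a # Up b # ms) = merge_moves (Up (a + b) # ms)"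
| "merge_moves (Down a # Down b # ms) = merge_moves (Down (a + b) # ms)"
| "merge_moves (m # ms) = m # merge_moves ms"
| "merge_moves [] = []"

definition contour :: "real list \<Rightarrow> real list \<Rightarrow> move list" where
  "contour xs ys = concat (map2 (\<lambda>a b. [Up a, Down b]) xs ys)"

text \<open>
  \<open>is_phi s x y \<tau>\<close> says that \<open>\<tau>\<close> is the tree \<open>\<phi>(x,y)\<close>: its depth-first traversal goes up
  \<open>x\<^sub>1\<close>, down \<open>y\<^sub>1\<close>, and so on. The traversal does not see vertices with a single child that
  subdivide an edge, so these are excluded (except for the root, which must be kept).
\<close>

definition is_phi ::
  "real \<Rightarrow> real^'n::{finite,linorder} \<Rightarrow> real^'n::{finite,linorder} \<Rightarrow> real plane_tree \<Rightarrow> bool" where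
  "is_phi s x y \<tau> \<longleftrightarrow>
     (\<forall>l\<in>set_plane_tree \<tau>. 0 < l) \<and> no_unary_below_root \<tau> \<and>
     merge_moves (edge_moves \<tau>) =
       contour (coords x @ [s - sum_list (coords x)]) (coords y @ [s - sum_list (coords y)])"

definition Delta_generic ::
  "real \<Rightarrow> real^'n::{finite,linorder} \<Rightarrow> unit tree \<Rightarrow> (real^'n::{finite,linorder}) set" where
  "Delta_generic s x T =
     {y. (\<forall>i. 0 < y $ i \<and> (\<Sum>j\<in>{..i}. y $ j) \<le> (\<Sum>j\<in>{..i}. x $ j)) \<and>
         (\<exists>\<tau>. is_phi s x y \<tau> \<and> shape \<tau> = planted T)}"

text \<open>
  Since edge lengths are positive, the set of \<open>y\<close> with \<open>\<phi>(x,y)\<close> of shape \<open>planted T\<close> is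
  open; the polytope \<open>\<Delta>\<^sub>T(x)\<close> is its closure.
\<close>

definition Delta ::
  "real \<Rightarrow> real^'n::{finite,linorder} \<Rightarrow> unit tree \<Rightarrow> (real^'n::{finite,linorder}) set" where
  "Delta s x T = closure (Delta_generic s x T)"


section \<open>Polyhedral decompositions\<close>

definition polyhedral_decomposition ::
  "'a::euclidean_space set set \<Rightarrow> 'a set \<Rightarrow> bool" where
  "polyhedral_decomposition \<Gamma> P \<longleftrightarrow>
     finite \<Gamma> \<and> (\<forall>F\<in>\<Gamma>. polytope F) \<and>
     (\<forall>F\<in>\<Gamma>. \<forall>G. G face_of F \<longrightarrow> G \<in> \<Gamma>) \<and>
     (\<forall>F\<in>\<Gamma>. \<forall>G\<in>\<Gamma>. F \<inter> G face_of F \<and> F \<inter> G face_of G) \<and>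
     \<Union>\<Gamma> = P"

definition maximal_faces :: "'a set set \<Rightarrow> 'a set set" where
  "maximal_faces \<Gamma> = {F\<in>\<Gamma>. \<forall>G\<in>\<Gamma>. F \<subseteq> G \<longrightarrow> F = G}"

definition interior_faces :: "'a::euclidean_space set set \<Rightarrow> 'a set \<Rightarrow> 'a set set" where
  "interior_faces \<Gamma> P = {F\<in>\<Gamma>. \<not> F \<subseteq> rel_frontier P}"

text \<open>A polyhedral decomposition consists of all faces of its maximal faces.\<close>

definition Gamma_decomp :: "real \<Rightarrow> real^'n::{finite,linorder} \<Rightarrow> (real^'n::{finite,linorder}) set set" where
  "Gamma_decomp s x =
     {F. \<exists>T\<in>plane_binary_trees CARD('n). F face_of Delta s x T}"


section \<open>Integral equivalence\<close>

definition int_points :: "(real^'n) set" where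
  "int_points = {v. \<forall>i. v $ i \<in> \<int>}"

definition integer_polytope :: "(real^'n) set \<Rightarrow> bool" where
  "integer_polytope P \<longleftrightarrow> polytope P \<and> (\<forall>v. v extreme_point_of P \<longrightarrow> v \<in> int_points)"

definition integrally_equivalent :: "(real^'k) set \<Rightarrow> (real^'m) set \<Rightarrow> bool" where
  "integrally_equivalent P Q \<longleftrightarrow>
     integer_polytope P \<and> integer_polytope Q \<and>
     (\<exists>f b. linear f \<and> bij_betw (\<lambda>v. f v + b) P Q \<and>
        bij_betw (\<lambda>v. f v + b) (int_points \<inter> affine hull P) (int_points \<inter> affine hull Q))"

text \<open>
  Integral equivalence makes sense for integer polytopes only: for instance, an affine map that
  preserves the integer points cannot carry \<open>{1/2..3/2}\<close> to \<open>{0..1}\<close>. For polytopes with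
  arbitrary real vertices, the lattice condition is imposed on the linear part of the map,
  acting on the directions of the affine spans. For integer polytopes the two notions agree.
\<close>

definition directions :: "'a::real_vector set \<Rightarrow> 'a set" where
  "directions P = {u - v | u v. u \<in> affine hull P \<and> v \<in> affine hull P}"

definition lattice_equivalent :: "(real^'k) set \<Rightarrow> (real^'m) set \<Rightarrow> bool" where
  "lattice_equivalent P Q \<longleftrightarrow>
     polytope P \<and> polytope Q \<and>
     (\<exists>f b. linear f \<and> bij_betw (\<lambda>v. f v + b) P Q \<and>
        bij_betw f (int_points \<inter> directions P) (int_points \<inter> directions Q))"

definition order_simplex :: "nat \<Rightarrow> real \<Rightarrow> real list set" where
  "order_simplex k t = {ts. length ts = k \<and> sorted (0 # ts @ [t])}"

text \<open>
  The product \<open>\<sigma>\<^bsub>k\<^sub>1\<^esub>(x\<^sub>1) \<times> \<dots> \<times> \<sigma>\<^bsub>k\<^sub>n\<^esub>(x\<^sub>n)\<close>, with the blocks of coordinates concatenated; it is a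
  subset of \<open>\<real>\<^sup>n\<close> because \<open>k\<^sub>1 + \<dots> + k\<^sub>n = n\<close>.
\<close>

definition simplex_product ::
  "nat list \<Rightarrow> real^'n::{finite,linorder} \<Rightarrow> (real^'n::{finite,linorder}) set" where
  "simplex_product ks x =
     {v. \<exists>tss. length tss = CARD('n) \<and>
           (\<forall>i<CARD('n). tss ! i \<in> order_simplex (ks ! i) (coords x ! i)) \<and>
           coords v = concat tss}"


section \<open>Polygonal decompositions and the associahedron\<close>

definition poset_iso ::
  "'a set \<Rightarrow> ('a \<Rightarrow> 'a \<Rightarrow> bool) \<Rightarrow> 'b set \<Rightarrow> ('b \<Rightarrow> 'b \<Rightarrow> bool) \<Rightarrow> bool" where
  "poset_iso A leA B leB \<longleftrightarrow>
     (\<exists>f. bij_betw f A B \<and> (\<forall>a\<in>A. \<forall>b\<in>A. leA a b \<longleftrightarrow> leB (f a) (f b)))"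

text \<open>
  The posets below are sets ordered by inclusion, with a top element \<^const>\<open>None\<close> adjoined.
\<close>

definition adjoin_top :: "'a set \<Rightarrow> 'a option set" where
  "adjoin_top A = insert None (Some ` A)"

fun incl_le :: "'a set option \<Rightarrow> 'a set option \<Rightarrow> bool" where
  "incl_le _ None \<longleftrightarrow> True"
| "incl_le None (Some B) \<longleftrightarrow> False"
| "incl_le (Some A) (Some B) \<longleftrightarrow> A \<subseteq> B"

definition dual_le :: "('a \<Rightarrow> 'a \<Rightarrow> bool) \<Rightarrow> 'a \<Rightarrow> 'a \<Rightarrow> bool" where
  "dual_le le a b = le b a"

definition orient :: "real^2 \<Rightarrow> real^2 \<Rightarrow> real^2 \<Rightarrow> real" where
  "orient a b c = (b $ 1 - a $ 1) * (c $ 2 - a $ 2) - (b $ 2 - a $ 2) * (c $ 1 - a $ 1)"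

text \<open>\<open>p 0, \<dots>, p (N - 1)\<close> are the vertices of a convex \<open>N\<close>-gon in counterclockwise order.\<close>

definition convex_polygon :: "nat \<Rightarrow> (nat \<Rightarrow> real^2) \<Rightarrow> bool" where
  "convex_polygon N p \<longleftrightarrow>
     3 \<le> N \<and> (\<forall>i j k. i < j \<and> j < k \<and> k < N \<longrightarrow> 0 < orient (p i) (p j) (p k))"

definition diagonals :: "nat \<Rightarrow> (nat \<Rightarrow> real^2) \<Rightarrow> (real^2) set set" where
  "diagonals N p =
     {closed_segment (p i) (p j) | i j. i < j \<and> j < N \<and> j \<noteq> Suc i \<and> \<not> (i = 0 \<and> j = N - 1)}"

definition polygonal_decompositions :: "nat \<Rightarrow> (nat \<Rightarrow> real^2) \<Rightarrow> (real^2) set set set" where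
  "polygonal_decompositions N p =
     {D. D \<subseteq> diagonals N p \<and>
         (\<forall>c\<in>D. \<forall>d\<in>D. c \<noteq> d \<longrightarrow> rel_interior c \<inter> rel_interior d = {})}"

text \<open>
  \<open>dec N p\<close> ordered by \<^const>\<open>incl_le\<close> has the empty decomposition at the bottom, the
  triangulations as coatoms, and is the face lattice of the associahedron in the convention in
  which triangulations are facets. The dual poset \<open>dual_le incl_le\<close>, where triangulations are
  the atoms, is the face lattice of the dual associahedron. Among the interior faces of
  \<^const>\<open>Gamma_decomp\<close>, the chambers correspond to the triangulations and are maximal under inclusion,
  so it is \<open>dual_le incl_le\<close>, reverse inclusion with an extra bottom, that matches it.
\<close>

definition dec :: "nat \<Rightarrow> (nat \<Rightarrow> real^2) \<Rightarrow> (real^2) set set option set" where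
  "dec N p = adjoin_top (polygonal_decompositions N p)"

end

theory Submission
  imports Defs
begin

text \<open>
  Replace \<open>y\<close> by the heights \<open>V k = (x\<^sub>1 - y\<^sub>1) + \<dots> + (x\<^sub>k - y\<^sub>k)\<close> of the valleys of the traversal.
  The lowest valley is the root of \<open>\<phi>(x, y)\<close> above the planted edge, and recursively
  \<open>\<phi>(x, y)\<close> has shape \<open>T\<close> iff \<open>V\<close> is strictly heap ordered along the binary search labelling
  of \<open>T\<close>. Hence \<open>\<Delta>\<^sub>T(x)\<close> consists of the points of \<open>\<Pi>\<^sub>n(x)\<close> with weakly heap ordered \<open>V\<close>.

  To \<open>V\<close> belongs the set of all pairs \<open>(i, j)\<close> such that \<open>V\<close> is larger strictly between \<open>i\<close> and \<open>j\<close>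
  than at \<open>i\<close> and \<open>j\<close> (a boundary index \<open>0\<close> or \<open>n + 1\<close> imposes nothing). Read as diagonals of an
  \<open>(n + 2)\<close>-gon these sets are exactly the non-crossing ones, a non-crossing set being recovered from
  its nesting depth. Being in a chamber means that this set is contained in the
  triangulation of the chamber, and a proper convex combination of two points of one chamber has at
  least the pairs of both points. So bounding the set of pairs cuts out faces, any two chambers
  meet in a common face, and the interior faces correspond to the non-crossing sets.

  Along the maximal chains of left edges of \<open>T\<close> the chamber is described by
  \<open>V i \<le> V j\<^sub>r \<le> \<dots> \<le> V j\<^sub>1 \<le> V i + x\<^sub>i\<^sub>+\<^sub>1\<close>, so the differences \<open>V j - V i\<close> map it to the
  product of simplices. They are sums of the \<open>x\<^sub>m - y\<^sub>m\<close> over \<open>i < m \<le> j\<close>, a unitriangular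
  system up to reordering. The volume of the product follows by symmetrizing each block of
  coordinates to a cube.
\<close>

section \<open>Heap-ordered trees and tubes\<close>

text \<open>A chamber is cut out by weak inequalities, whereas its tree is visible only at points
  without ties between comparable vertices. Each tree is therefore represented by some strictly heap
  ordered height function \<open>W\<close>, and its chamber becomes the part of the polytope whose
  heights respect the range minima of \<open>W\<close>. The cone of such heights makes sense for
  every \<open>W\<close>, ties included, and is equivalent to a condition on sets of pairs alone.
  This double description carries the proof: convexity and relative interiors are read off from the
  cone, inclusions and faces from the pairs.

  The bounds of the polytope do not interfere with the order pattern. As all \<open>x $ i\<close>
  are positive, every pattern of heights, scaled to fit between \<open>0\<close> and the smallest
  \<open>x $ i\<close>, occurs at an interior point. So every tree and every non-crossing set is
  realized there, and an interior face is identified by a point of its relative interior.\<close>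

fun iheap :: "nat \<Rightarrow> 'a tree \<Rightarrow> (nat \<Rightarrow> real) \<Rightarrow> bool" where
  "iheap m Leaf V \<longleftrightarrow> True"
| "iheap m (Node l a r) V \<longleftrightarrow> iheap m l V \<and> iheap (Suc (m + size l)) r V \<and>
     (\<forall>q\<in>{m..<m + size (Node l a r)}. V (m + size l) \<le> V q)"

text \<open>In inorder every subtree occupies an interval of labels, so the start \<open>m\<close>
  and the sizes determine all labels and no labelled tree is carried along. Strictness concerns
  comparable vertices only; incomparable ones may have equal heights.\<close>

fun strict_heap :: "nat \<Rightarrow> 'a tree \<Rightarrow> (nat \<Rightarrow> real) \<Rightarrow> bool" where
  "strict_heap m Leaf V \<longleftrightarrow> True"
| "strict_heap m (Node l a r) V \<longleftrightarrow> strict_heap m l V \<and> strict_heap (Suc (m + size l)) r V \<and>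
     (\<forall>q\<in>{m..<m + size (Node l a r)}. q \<noteq> m + size l \<longrightarrow> V (m + size l) < V q)"

text \<open>If \<open>W\<close> is strictly heap ordered on a tree, this says that \<open>a\<close>
  is \<open>b\<close> or an ancestor of it: otherwise their lowest common ancestor, which lies
  between them, would be lower than \<open>a\<close>. Phrased through \<open>W\<close> alone it also
  covers heights with ties.\<close>

definition range_min :: "(nat \<Rightarrow> real) \<Rightarrow> nat \<Rightarrow> nat \<Rightarrow> bool" where
  "range_min W a b \<longleftrightarrow> (\<forall>m\<in>{min a b..max a b}. W a \<le> W m)"

definition heap_cone :: "nat \<Rightarrow> (nat \<Rightarrow> real) \<Rightarrow> (nat \<Rightarrow> real) set" where
  "heap_cone n W = {U. \<forall>a\<in>{1..n}. \<forall>b\<in>{1..n}. range_min W a b \<longrightarrow> U a \<le> U b}"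

text \<open>
  The pairs indexing the diagonals of an \<open>(n + 2)\<close>-gon with vertices \<open>0, \<dots>, n + 1\<close>, and those
  among them over which \<open>W\<close> is larger than at the end points; \<open>W 0\<close> and \<open>W (n + 1)\<close> count as
  \<open>-\<infinity>\<close>.
\<close>

definition diag_pairs :: "nat \<Rightarrow> (nat \<times> nat) set" where
  "diag_pairs n = {(i, j). i + 2 \<le> j \<and> j \<le> Suc n \<and> \<not> (i = 0 \<and> j = Suc n)}"

definition tubes :: "nat \<Rightarrow> (nat \<Rightarrow> real) \<Rightarrow> (nat \<times> nat) set" where
  "tubes n W = {(i, j)\<in>diag_pairs n.
     \<forall>m\<in>{i<..<j}. (0 < i \<longrightarrow> W i < W m) \<and> (j \<le> n \<longrightarrow> W j < W m)}"

definition non_crossing :: "(nat \<times> nat) set \<Rightarrow> bool" where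
  "non_crossing D \<longleftrightarrow> (\<forall>(i, j)\<in>D. \<forall>(k, l)\<in>D. \<not> (i < k \<and> k < j \<and> j < l))"

lemma finite_diag_pairs: "finite (diag_pairs n)"
  by (rule finite_subset[of _ "{..Suc n} \<times> {..Suc n}"]) (auto simp: diag_pairs_def)

lemma strict_heap_imp_heap: "strict_heap m T V \<Longrightarrow> iheap m T V"
  by (induction T arbitrary: m) (auto simp: le_less)

lemma strict_heap_cong:
  "(\<And>q. q \<in> {m..<m + size T} \<Longrightarrow> V q = W q) \<Longrightarrow> strict_heap m T V = strict_heap m T W"
proof (induction T arbitrary: m)
  case (Node l a r)
  have "strict_heap m l V = strict_heap m l W" by (rule Node.IH(1)) (use Node.prems in auto)
  moreover have "strict_heap (Suc (m + size l)) r V = strict_heap (Suc (m + size l)) r W"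
    by (rule Node.IH(2)) (use Node.prems in auto)
  ultimately show ?case using Node.prems by auto
qed simp

lemma strict_heap_affine:
  assumes "c > 0" "strict_heap m T W"
  shows "strict_heap m T (\<lambda>q. c * W q + d)"
  using assms(2) by (induction T arbitrary: m) (use assms(1) in auto)

lemma ex_heap: "\<exists>T :: unit tree. size T = k \<and> iheap m T V"
proof (induction k arbitrary: m rule: less_induct)
  case (less k)
  show ?case
  proof (cases "k = 0")
    case True
    then show ?thesis by (intro exI[of _ Leaf]) auto
  next
    case False
    obtain p where p: "p \<in> {m..<m + k}" "\<forall>q\<in>{m..<m + k}. V p \<le> V q"
      using ex_min_if_finite[of "V ` {m..<m + k}"] False by fastforce
    have "p - m < k" "m + k - Suc p < k" using p by auto
    then obtain l r :: "unit tree" where l: "size l = p - m" "iheap m l V"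
      and r: "size r = m + k - Suc p" "iheap (Suc p) r V"
      using less[of "p - m" m] less[of "m + k - Suc p" "Suc p"] by blast
    show ?thesis
      by (rule exI[of _ "Node l () r"]) (use l r p in auto)
  qed
qed

text \<open>The root of a strict heap is the only minimum of its interval, so a weak heap for the
  same heights has its root at the same label.\<close>

lemma heap_unique:
  fixes T T' :: "unit tree"
  assumes "strict_heap m T V" "iheap m T' V" "size T = size T'"
  shows "T = T'"
  using assms
proof (induction T arbitrary: m T')
  case (Node l a r)
  then obtain l' a' r' where T': "T' = Node l' a' r'" by (cases T') auto
  let ?p = "m + size l" and ?p' = "m + size l'"
  have "V ?p' \<le> V ?p" using Node.prems T' by auto
  moreover have "?p' \<noteq> ?p \<Longrightarrow> V ?p < V ?p'" using Node.prems T' by auto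
  ultimately have "size l = size l'" by fastforce
  moreover from this have "size r = size r'" using Node.prems T' by auto
  ultimately show ?case using Node T' by auto
qed auto

lemma ex_strict_heap: "\<exists>W. strict_heap m T W"
proof (induction T arbitrary: m)
  case Leaf
  show ?case by (rule exI[of _ "\<lambda>_. 0"]) simp
next
  case (Node l a r)
  let ?p = "m + size l"
  obtain W1 where W1: "strict_heap m l W1" using Node by blast
  obtain W2 where W2: "strict_heap (Suc ?p) r W2" using Node by blast
  define B where "B = {m..<m + size (Node l a r)}"
  define W0 where "W0 q = (if q < ?p then W1 q else W2 q)" for q
  \<comment> \<open>The heights of the subtrees are kept; only the root is placed below all of
    them.\<close>
  define W where "W = W0(?p := Min (insert 0 (W0 ` B)) - 1)"
  have "strict_heap m l W = strict_heap m l W1"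
    by (rule strict_heap_cong) (auto simp: W_def W0_def)
  moreover have "strict_heap (Suc ?p) r W = strict_heap (Suc ?p) r W2"
    by (rule strict_heap_cong) (auto simp: W_def W0_def)
  moreover have "W ?p < W q" if "q \<in> B" "q \<noteq> ?p" for q
  proof -
    have "Min (insert 0 (W0 ` B)) \<le> W0 q" by (rule Min_le) (use that in \<open>auto simp: B_def\<close>)
    then show ?thesis using that by (auto simp: W_def)
  qed
  ultimately show ?case using W1 W2 unfolding B_def by auto
qed

section \<open>Cones of range minima and sets of tubes\<close>

lemma range_minI:
  "(\<And>q. q \<noteq> a \<Longrightarrow> min a b \<le> q \<Longrightarrow> q \<le> max a b \<Longrightarrow> W a \<le> W q) \<Longrightarrow> range_min W a b"
  unfolding range_min_def by (rule ballI, case_tac "m = a") auto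

lemma range_min_tube:
  assumes "(i, j) \<in> tubes n W" "m \<in> {i<..<j}"
  shows "0 < i \<Longrightarrow> range_min W i m" "j \<le> n \<Longrightarrow> range_min W j m"
  by (rule range_minI; use assms in \<open>auto simp: tubes_def min_def max_def less_imp_le split: if_splits\<close>)+

text \<open>Positions on different sides of the root are unrelated, since the strictly lower root
  lies between them. The relation thus splits into the root and the two subtrees, as
  \<open>iheap\<close> does.\<close>

lemma heap_iff_range_min:
  assumes "strict_heap m T W"
  shows "iheap m T U \<longleftrightarrow>
    (\<forall>a\<in>{m..<m + size T}. \<forall>b\<in>{m..<m + size T}. range_min W a b \<longrightarrow> U a \<le> U b)"
  using assms
proof (induction T arbitrary: m)
  case (Node l c r)
  let ?p = "m + size l"
  let ?I = "{m..<m + size (Node l c r)}"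
  have l: "iheap m l U \<longleftrightarrow> (\<forall>a\<in>{m..<?p}. \<forall>b\<in>{m..<?p}. range_min W a b \<longrightarrow> U a \<le> U b)"
    by (rule Node.IH(1)) (use Node in auto)
  have r: "iheap (Suc ?p) r U \<longleftrightarrow> (\<forall>a\<in>{Suc ?p..<Suc ?p + size r}.
      \<forall>b\<in>{Suc ?p..<Suc ?p + size r}. range_min W a b \<longrightarrow> U a \<le> U b)"
    by (rule Node.IH(2)) (use Node in auto)
  have p: "\<And>q. q \<in> ?I \<Longrightarrow> q \<noteq> ?p \<Longrightarrow> W ?p < W q" using Node.prems by auto
  show ?case
  proof
    assume H: "iheap m (Node l c r) U"
    show "\<forall>a\<in>?I. \<forall>b\<in>?I. range_min W a b \<longrightarrow> U a \<le> U b"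
    proof (intro ballI impI)
      fix a b assume ab: "a \<in> ?I" "b \<in> ?I" "range_min W a b"
      show "U a \<le> U b"
      proof (cases "a = ?p")
        case True
        then show ?thesis using H ab by simp
      next
        case False
        have "?p \<notin> {min a b..max a b}"
          using ab p[OF ab(1) False] by (force simp: range_min_def)
        then consider "a \<in> {m..<?p}" "b \<in> {m..<?p}"
          | "a \<in> {Suc ?p..<Suc ?p + size r}" "b \<in> {Suc ?p..<Suc ?p + size r}"
          using ab by (fastforce simp: min_def max_def split: if_splits)
        then show ?thesis using l r H ab(3) by cases auto
      qed
    qed
  next
    assume H: "\<forall>a\<in>?I. \<forall>b\<in>?I. range_min W a b \<longrightarrow> U a \<le> U b"
    have "U ?p \<le> U q" if "q \<in> ?I" for q
    proof -
      have "range_min W ?p q"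
        unfolding range_min_def
      proof
        fix k assume "k \<in> {min ?p q..max ?p q}"
        then have "k \<in> ?I" using that by (auto simp: min_def max_def split: if_splits)
        then show "W ?p \<le> W k" using p[of k] by (cases "k = ?p") auto
      qed
      then show ?thesis using H that by auto
    qed
    moreover have "iheap m l U" unfolding l using H by auto
    moreover have "iheap (Suc ?p) r U" unfolding r using H by auto
    ultimately show "iheap m (Node l c r) U" by auto
  qed
qed simp

lemma heap_iff_cone:
  assumes "strict_heap 1 T W"
  shows "iheap 1 T U \<longleftrightarrow> U \<in> heap_cone (size T) W"
  unfolding heap_iff_range_min[OF assms] heap_cone_def by (auto simp: atLeastLessThanSuc_atLeastAtMost)

text \<open>Left to right, a tube of \<open>U\<close> that is not one of \<open>W\<close> contains a
  minimum of \<open>W\<close> not above one of its ends, and the cone forbids the drop of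
  \<open>U\<close> at that end. Right to left, if \<open>U a > U b\<close>, the largest interval
  around \<open>a\<close> on which \<open>U\<close> is at least \<open>U a\<close> gives a tube of
  \<open>U\<close> with an end between \<open>a\<close> and \<open>b\<close>; as a tube of
  \<open>W\<close> it contradicts that \<open>a\<close> is a range minimum.\<close>

lemma cone_iff_tubes: "U \<in> heap_cone n W \<longleftrightarrow> tubes n U \<subseteq> tubes n W"
proof
  assume U: "U \<in> heap_cone n W"
  show "tubes n U \<subseteq> tubes n W"
  proof (rule subsetI, rule ccontr)
    fix d assume d: "d \<in> tubes n U" "d \<notin> tubes n W"
    obtain i j where ij: "d = (i, j)" by force
    have in_d: "{i<..<j} \<noteq> {}" "{i<..<j} \<subseteq> {1..n}" "j \<le> Suc n"
      using d ij by (auto simp: tubes_def diag_pairs_def)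
    obtain m where m: "m \<in> {i<..<j}" "\<forall>q\<in>{i<..<j}. W m \<le> W q"
      using ex_min_if_finite[of "W ` {i<..<j}"] in_d(1) by fastforce
    obtain q where q: "q \<in> {i<..<j}" "0 < i \<and> W q \<le> W i \<or> j \<le> n \<and> W q \<le> W j"
      using d ij by (force simp: tubes_def)
    then consider "0 < i" "W m \<le> W i" | "j \<le> n" "W m \<le> W j" using m by fastforce
    then show False
    proof cases
      case 1
      have "range_min W m i"
      proof (rule range_minI)
        fix q assume "q \<noteq> m" "min m i \<le> q" "q \<le> max m i"
        then have "q = i \<or> q \<in> {i<..<j}" using m by auto
        then show "W m \<le> W q" using 1 m by auto
      qed
      then have "U m \<le> U i" using U 1 m in_d by (auto simp: heap_cone_def)
      moreover have "U i < U m" using d(1) ij 1 m by (simp add: tubes_def)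
      ultimately show False by simp
    next
      case 2
      have "range_min W m j"
      proof (rule range_minI)
        fix q assume "q \<noteq> m" "min m j \<le> q" "q \<le> max m j"
        then have "q = j \<or> q \<in> {i<..<j}" using m by auto
        then show "W m \<le> W q" using 2 m by auto
      qed
      then have "U m \<le> U j" using U 2 m in_d by (auto simp: heap_cone_def)
      moreover have "U j < U m" using d(1) ij 2 m by (simp add: tubes_def)
      ultimately show False by simp
    qed
  qed
next
  assume sub: "tubes n U \<subseteq> tubes n W"
  show "U \<in> heap_cone n W"
    unfolding heap_cone_def mem_Collect_eq
  proof (intro ballI impI, rule ccontr)
    fix a b assume ab: "a \<in> {1..n}" "b \<in> {1..n}" "range_min W a b" "\<not> U a \<le> U b"
    \<comment> \<open>The nearest positions on either side of \<open>a\<close> at which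
      \<open>U\<close> is smaller; \<open>0\<close> and \<open>Suc n\<close> stand for the absence
      of such a position.\<close>
    define i where "i = Max (insert 0 {q\<in>{1..<a}. U q < U a})"
    define j where "j = Min (insert (Suc n) {q\<in>{a<..n}. U q < U a})"
    have "i \<in> insert 0 {q\<in>{1..<a}. U q < U a}" unfolding i_def by (rule Max_in) auto
    then have i: "i < a" "0 < i \<Longrightarrow> U i < U a" using ab(1) by auto
    have "j \<in> insert (Suc n) {q\<in>{a<..n}. U q < U a}" unfolding j_def by (rule Min_in) auto
    then have j: "a < j" "j \<le> Suc n" "j \<le> n \<Longrightarrow> U j < U a" using ab(1) by auto
    have inside: "U a \<le> U q" if q: "i < q" "q < j" for q
    proof (rule ccontr)
      assume c: "\<not> U a \<le> U q"
      have "q \<noteq> a" using c by auto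
      moreover have "\<not> q < a"
      proof
        assume "q < a"
        then have "q \<le> i" unfolding i_def by (intro Max_ge) (use q c in auto)
        then show False using q by simp
      qed
      moreover have "\<not> a < q"
      proof
        assume "a < q"
        then have "j \<le> q" unfolding j_def by (intro Min_le) (use q c j in auto)
        then show False using q by simp
      qed
      ultimately show False by simp
    qed
    have tube: "(i, j) \<in> tubes n U" if "\<not> (i = 0 \<and> j = Suc n)"
    proof -
      have "0 < i \<longrightarrow> U i < U m" "j \<le> n \<longrightarrow> U j < U m" if "i < m" "m < j" for m
        using inside[OF that] i(2) j(3) by (auto intro: less_le_trans)
      then show ?thesis using that i(1) j(1,2) unfolding tubes_def diag_pairs_def by simp
    qed
    have "a \<noteq> b" using ab by auto
    then consider "a < b" | "b < a" by linarith
    then show False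
    proof cases
      case 1
      \<comment> \<open>\<open>b\<close> is a candidate for \<open>j\<close>, so \<open>j\<close>
        lies between \<open>a\<close> and \<open>b\<close> and is not the right boundary.\<close>
      have "j \<le> b" unfolding j_def by (rule Min_le) (use 1 ab in auto)
      then have "(i, j) \<in> tubes n U" using tube ab by simp
      then have "W j < W a" using sub i j \<open>j \<le> b\<close> ab by (auto simp: tubes_def)
      moreover have "W a \<le> W j"
        using ab(3)[unfolded range_min_def, rule_format, of j] \<open>j \<le> b\<close> j 1 by simp
      ultimately show False by simp
    next
      case 2
      have "b \<le> i" unfolding i_def by (rule Max_ge) (use 2 ab in auto)
      then have "(i, j) \<in> tubes n U" using tube ab by simp
      then have "W i < W a" using sub i j \<open>b \<le> i\<close> ab by (auto simp: tubes_def)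
      moreover have "W a \<le> W i"
        using ab(3)[unfolded range_min_def, rule_format, of i] \<open>b \<le> i\<close> i 2 by simp
      ultimately show False by simp
    qed
  qed
qed

text \<open>A tube of \<open>U\<close> is one of \<open>W\<close>, so its ends are range minima of
  \<open>W\<close> and \<open>V\<close> satisfies the same inequalities at least weakly. A strict
  and a weak inequality, with positive weight on the strict one, add up to a strict one.\<close>

lemma tubes_convex_combination:
  assumes "tubes n U \<subseteq> tubes n W" "tubes n V \<subseteq> tubes n W" "0 < t" "t < 1"
  shows "tubes n U \<subseteq> tubes n (\<lambda>q. (1 - t) * U q + t * V q)"
proof (rule subsetI)
  fix d assume d: "d \<in> tubes n U"
  obtain i j where ij: "d = (i, j)" by force
  have D: "(i, j) \<in> diag_pairs n" using d ij by (auto simp: tubes_def)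
  have ijW: "(i, j) \<in> tubes n W" using d ij assms by auto
  have V: "V \<in> heap_cone n W" using assms cone_iff_tubes by blast
  have "(0 < i \<longrightarrow> (1 - t) * U i + t * V i < (1 - t) * U m + t * V m) \<and>
        (j \<le> n \<longrightarrow> (1 - t) * U j + t * V j < (1 - t) * U m + t * V m)" if m: "m \<in> {i<..<j}" for m
  proof (intro conjI impI)
    assume i: "0 < i"
    have "range_min W i m" using range_min_tube[OF ijW m] i by blast
    then have "V i \<le> V m" using V D m i by (auto simp: heap_cone_def diag_pairs_def)
    moreover have "U i < U m" using d ij m i by (auto simp: tubes_def)
    ultimately show "(1 - t) * U i + t * V i < (1 - t) * U m + t * V m"
      using assms by (intro add_less_le_mono) auto
  next
    assume j: "j \<le> n"
    have "range_min W j m" using range_min_tube[OF ijW m] j by blast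
    then have "V j \<le> V m" using V D m j by (auto simp: heap_cone_def diag_pairs_def)
    moreover have "U j < U m" using d ij m j by (auto simp: tubes_def)
    ultimately show "(1 - t) * U j + t * V j < (1 - t) * U m + t * V m"
      using assms by (intro add_less_le_mono) auto
  qed
  then show "d \<in> tubes n (\<lambda>q. (1 - t) * U q + t * V q)"
    using D ij by (auto simp: tubes_def)
qed

lemma tubes_affine: "c > 0 \<Longrightarrow> tubes n (\<lambda>q. c * W q + d) = tubes n W"
  by (auto simp: tubes_def)

lemma tubes_cong: "(\<And>q. q \<in> {1..n} \<Longrightarrow> V q = W q) \<Longrightarrow> tubes n V = tubes n W"
proof (rule set_eqI, clarify)
  fix i j
  assume eq: "\<And>q. q \<in> {1..n} \<Longrightarrow> V q = W q"
  have "V m = W m" if "i < m" "m < j" "j \<le> Suc n" for m using that by (intro eq) auto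
  moreover have "V i = W i" if "0 < i" "i + 2 \<le> j" "j \<le> Suc n" using that by (intro eq) auto
  moreover have "V j = W j" if "i + 2 \<le> j" "j \<le> n" using that by (intro eq) auto
  ultimately show "((i, j) \<in> tubes n V) = ((i, j) \<in> tubes n W)"
    unfolding tubes_def diag_pairs_def mem_Collect_eq prod.case
    by (intro conj_cong ball_cong refl) auto
qed

text \<open>In a crossing, \<open>k\<close> lies inside the first pair and \<open>j\<close> inside
  the second, which would put each of them below the other.\<close>

lemma non_crossing_tubes: "non_crossing (tubes n W)"
  unfolding non_crossing_def
proof clarify
  fix i j k l assume ij: "(i, j) \<in> tubes n W" and kl: "(k, l) \<in> tubes n W"
    and c: "i < k" "k < j" "j < l"
  have "j \<le> n" using kl c by (auto simp: tubes_def diag_pairs_def)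
  then have "W j < W k" using ij c by (auto simp: tubes_def)
  moreover have "W k < W j" using kl c by (auto simp: tubes_def)
  ultimately show False by simp
qed

definition nesting_depth :: "(nat \<times> nat) set \<Rightarrow> nat \<Rightarrow> real" where
  "nesting_depth D m = real (card {(i, j)\<in>D. i < m \<and> m < j})"

text \<open>A pair around an end of \<open>(i, j)\<close> does not cross \<open>(i, j)\<close> and
  so surrounds its whole inside, where \<open>(i, j)\<close> itself counts in addition: the depth is
  larger inside. Conversely, a larger depth next to \<open>i\<close> comes from a pair starting at
  \<open>i\<close>, and next to \<open>j\<close> from a pair ending at \<open>j\<close>. The longest
  such pairs reach across, and they cross unless one of them is \<open>(i, j)\<close>.\<close>

lemma tubes_nesting_depth:
  assumes D: "D \<subseteq> diag_pairs n" and nc: "non_crossing D"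
  shows "tubes n (nesting_depth D) = D"
proof -
  have fin: "finite {(i, j)\<in>D. i < m \<and> m < j}" for m
    by (rule finite_subset[of _ "diag_pairs n"]) (use D finite_diag_pairs in auto)
  have nc': "\<not> (i < k \<and> k < j \<and> j < l)" if "(i, j) \<in> D" "(k, l) \<in> D" for i j k l
    using nc that unfolding non_crossing_def by blast
  have less: "nesting_depth D a < nesting_depth D b"
    if "{(i, j)\<in>D. i < a \<and> a < j} \<subset> {(i, j)\<in>D. i < b \<and> b < j}" for a b
    unfolding nesting_depth_def using psubset_card_mono[OF fin that] by simp
  have le: "nesting_depth D a \<le> nesting_depth D b"
    if "{(i, j)\<in>D. i < a \<and> a < j} \<subseteq> {(i, j)\<in>D. i < b \<and> b < j}" for a b
    unfolding nesting_depth_def using card_mono[OF fin that] by simp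
  show ?thesis
  proof (rule set_eqI, rule iffI)
    fix d assume d: "d \<in> D"
    obtain i j where ij: "d = (i, j)" by force
    have "nesting_depth D i < nesting_depth D m \<and> nesting_depth D j < nesting_depth D m"
      if m: "m \<in> {i<..<j}" for m
    proof
      show "nesting_depth D i < nesting_depth D m"
      proof (rule less, rule psubsetI)
        show "{(k, l)\<in>D. k < i \<and> i < l} \<subseteq> {(k, l)\<in>D. k < m \<and> m < l}"
          using nc' d ij m by (auto simp: not_less) (metis le_less_trans less_le_trans not_less)
        show "{(k, l)\<in>D. k < i \<and> i < l} \<noteq> {(k, l)\<in>D. k < m \<and> m < l}" using d ij m by auto
      qed
      show "nesting_depth D j < nesting_depth D m"
      proof (rule less, rule psubsetI)
        show "{(k, l)\<in>D. k < j \<and> j < l} \<subseteq> {(k, l)\<in>D. k < m \<and> m < l}"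
          using nc' d ij m by (auto simp: not_less) (metis le_less_trans less_le_trans not_less)
        show "{(k, l)\<in>D. k < j \<and> j < l} \<noteq> {(k, l)\<in>D. k < m \<and> m < l}" using d ij m by auto
      qed
    qed
    then show "d \<in> tubes n (nesting_depth D)" using D d ij by (auto simp: tubes_def)
  next
    fix d assume d: "d \<in> tubes n (nesting_depth D)"
    obtain i j where ij: "d = (i, j)" by force
    have dp: "i + 2 \<le> j" "j \<le> Suc n" "\<not> (i = 0 \<and> j = Suc n)"
      using d ij by (auto simp: tubes_def diag_pairs_def)
    have lo: "nesting_depth D i < nesting_depth D m" if "0 < i" "m \<in> {i<..<j}" for m
      using d ij that by (auto simp: tubes_def)
    have hi: "nesting_depth D j < nesting_depth D m" if "j \<le> n" "m \<in> {i<..<j}" for m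
      using d ij that by (auto simp: tubes_def)
    have right: "\<exists>l\<ge>j. (i, l) \<in> D" if i: "0 < i"
    proof -
      have "\<not> {(k, l)\<in>D. k < Suc i \<and> Suc i < l} \<subseteq> {(k, l)\<in>D. k < i \<and> i < l}"
        using le[of "Suc i" i] lo[of "Suc i"] i dp by fastforce
      then obtain k l where kl: "(k, l) \<in> D" "k < Suc i" "Suc i < l" "\<not> k < i" by fastforce
      then have l0: "(i, l) \<in> D" by (metis less_antisym)
      have finl: "finite {l. (i, l) \<in> D}"
        by (rule finite_subset[of _ "{..Suc n}"]) (use D in \<open>auto simp: diag_pairs_def\<close>)
      define L where "L = Max {l. (i, l) \<in> D}"
      have L: "(i, L) \<in> D" using Max_in[OF finl] l0 unfolding L_def by blast
      have Lmax: "l' \<le> L" if "(i, l') \<in> D" for l'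
        unfolding L_def by (rule Max_ge[OF finl]) (use that in simp)
      have "j \<le> L"
      proof (rule ccontr)
        assume "\<not> j \<le> L"
        then have "L \<in> {i<..<j}" using L D by (auto simp: diag_pairs_def)
        \<comment> \<open>A pair around \<open>L\<close> starts before \<open>i\<close>: not at
          \<open>i\<close> because \<open>L\<close> is maximal, and not later because it would cross
          \<open>(i, L)\<close>. So the depth at \<open>L\<close> would be at most that at
          \<open>i\<close>.\<close>
        moreover have "{(k, l)\<in>D. k < L \<and> L < l} \<subseteq> {(k, l)\<in>D. k < i \<and> i < l}"
        proof clarify
          fix k l assume kl: "(k, l) \<in> D" "k < L" "L < l"
          have "k \<noteq> i" using Lmax kl by force
          moreover have "\<not> i < k" using nc'[OF L kl(1)] kl by auto
          ultimately show "k < i \<and> i < l" using kl \<open>L \<in> {i<..<j}\<close> by auto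
        qed
        ultimately show False using lo[OF i, of L] le[of L i] by simp
      qed
      then show ?thesis using L by blast
    qed
    have left: "\<exists>k\<le>i. (k, j) \<in> D" if j: "j \<le> n"
    proof -
      have "\<not> {(k, l)\<in>D. k < j - 1 \<and> j - 1 < l} \<subseteq> {(k, l)\<in>D. k < j \<and> j < l}"
        using le[of "j - 1" j] hi[of "j - 1"] j dp by fastforce
      then obtain k l where kl: "(k, l) \<in> D" "k < j - 1" "j - 1 < l" "\<not> j < l" by fastforce
      then have "l = j" by linarith
      then have l0: "(k, j) \<in> D" using kl by simp
      have finl: "finite {k. (k, j) \<in> D}"
        by (rule finite_subset[of _ "{..Suc n}"]) (use D in \<open>auto simp: diag_pairs_def\<close>)
      define K where "K = Min {k. (k, j) \<in> D}"
      have K: "(K, j) \<in> D" using Min_in[OF finl] l0 unfolding K_def by blast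
      have Kmin: "K \<le> k'" if "(k', j) \<in> D" for k'
        unfolding K_def by (rule Min_le[OF finl]) (use that in simp)
      have "K \<le> i"
      proof (rule ccontr)
        assume "\<not> K \<le> i"
        then have "K \<in> {i<..<j}" using K D by (auto simp: diag_pairs_def)
        moreover have "{(k, l)\<in>D. k < K \<and> K < l} \<subseteq> {(k, l)\<in>D. k < j \<and> j < l}"
        proof clarify
          fix k l assume kl: "(k, l) \<in> D" "k < K" "K < l"
          have "l \<noteq> j" using Kmin kl by force
          moreover have "\<not> l < j" using nc'[OF kl(1) K] kl by auto
          ultimately show "k < j \<and> j < l" using kl \<open>K \<in> {i<..<j}\<close> by auto
        qed
        ultimately show False using hi[OF j, of K] le[of K j] by simp
      qed
      then show ?thesis using K by blast
    qed
    show "d \<in> D"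
    proof (cases "0 < i")
      case True
      then obtain l where l: "l \<ge> j" "(i, l) \<in> D" using right by blast
      then have "l \<le> Suc n" using D by (auto simp: diag_pairs_def)
      show ?thesis
      proof (cases "j \<le> n")
        case True
        then obtain k where k: "k \<le> i" "(k, j) \<in> D" using left by blast
        then have "\<not> (k < i \<and> i < j \<and> j < l)" using nc'[OF k(2) l(2)] by blast
        then have "k = i \<or> l = j" using k l dp by linarith
        then show ?thesis using k l ij by auto
      next
        case False
        then have "l = j" using l \<open>l \<le> Suc n\<close> dp by linarith
        then show ?thesis using l ij by simp
      qed
    next
      case False
      then show ?thesis using left dp ij by auto
    qed
  qed
qed

section \<open>Contours of planted binary trees\<close>

text \<open>One step of merging, in front of a list that is merged already. It turns
  \<open>merge_moves\<close> into a right fold, which can be evaluated on the pieces of a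
  concatenated contour.\<close>

fun push_move :: "move \<Rightarrow> move list \<Rightarrow> move list" where
  "push_move (Up a) (Up b # ms) = Up (a + b) # ms"
| "push_move (Down a) (Down b # ms) = Down (a + b) # ms"
| "push_move m ms = m # ms"

lemma push_move_push_move:
  "push_move (Up a) (push_move (Up b) ms) = push_move (Up (a + b)) ms"
  "push_move (Down a) (push_move (Down b) ms) = push_move (Down (a + b)) ms"
  by (cases ms rule: list.exhaust; cases "hd ms"; simp add: add.assoc)+

lemma merge_moves_Cons: "merge_moves (m # ms) = push_move m (merge_moves ms)"
proof (induction ms arbitrary: m)
  case Nil
  show ?case by (cases m) auto
next
  case (Cons m' ms)
  show ?case
  proof (cases m; cases m')
    fix a b assume "m = Up a" "m' = Up b"
    then show ?thesis using Cons[of "Up (a + b)"] Cons[of m'] by (simp add: push_move_push_move)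
  next
    fix a b assume "m = Down a" "m' = Down b"
    then show ?thesis using Cons[of "Down (a + b)"] Cons[of m'] by (simp add: push_move_push_move)
  next
    fix a b assume m: "m = Up a" "m' = Down b"
    have "\<exists>c ns. push_move m' (merge_moves ms) = Down c # ns"
      using m by (cases "(m', merge_moves ms)" rule: push_move.cases) auto
    then show ?thesis using Cons[of m'] m by auto
  next
    fix a b assume m: "m = Down a" "m' = Up b"
    have "\<exists>c ns. push_move m' (merge_moves ms) = Up c # ns"
      using m by (cases "(m', merge_moves ms)" rule: push_move.cases) auto
    then show ?thesis using Cons[of m'] m by auto
  qed
qed

lemma merge_moves_foldr: "merge_moves ms = foldr push_move ms []"
  by (induction ms) (auto simp: merge_moves_Cons)

text \<open>What precedes a descent merges independently of what follows, and extra length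
  \<open>c\<close> of the descent is passed on additively. The quantifier order matters: the same
  \<open>ns\<close> and \<open>e\<close> serve for a contour on its own (\<open>c = 0\<close>) and
  inside a larger one.\<close>

lemma foldr_push_Down:
  "\<exists>ns e. \<forall>c w. foldr push_move u (Down (d + c) # w) = ns @ Down (e + c) # w"
proof (induction u)
  case Nil
  show ?case by (rule exI[of _ "[]"], rule exI[of _ d]) simp
next
  case (Cons m u)
  then obtain ns e where IH: "\<And>c w. foldr push_move u (Down (d + c) # w) = ns @ Down (e + c) # w"
    by blast
  show ?case
  proof (cases ns)
    case Nil
    show ?thesis
    proof (cases m)
      case (Up a)
      then show ?thesis using IH Nil by (intro exI[of _ "[Up a]"] exI[of _ e]) simp
    next
      case (Down a)
      then show ?thesis using IH Nil by (intro exI[of _ "[]"] exI[of _ "a + e"]) simp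
    qed
  next
    case (Cons z ns')
    show ?thesis
      by (cases m; cases z; use IH Cons in simp; blast?)
  qed
qed

text \<open>
  The moves from valley \<open>i\<close> to valley \<open>j\<close> when the valleys have heights \<open>W\<close> and the peak
  between valleys \<open>k\<close> and \<open>k + 1\<close> has height \<open>P k\<close>.
\<close>

definition path_moves :: "(nat \<Rightarrow> real) \<Rightarrow> (nat \<Rightarrow> real) \<Rightarrow> nat \<Rightarrow> nat \<Rightarrow> move list" where
  "path_moves W P i j = concat (map (\<lambda>k. [Up (P k - W k), Down (P k - W (Suc k))]) [i..<j])"

lemma path_moves_cong:
  "(\<And>k. i \<le> k \<Longrightarrow> k < j \<Longrightarrow> W k = W' k \<and> W (Suc k) = W' (Suc k) \<and> P k = P' k) \<Longrightarrow>
   path_moves W P i j = path_moves W' P' i j"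
  unfolding path_moves_def by (intro arg_cong[of _ _ concat] map_cong) auto

lemma path_moves_append:
  "i \<le> p \<Longrightarrow> p \<le> j \<Longrightarrow> path_moves W P i j = path_moves W P i p @ path_moves W P p j"
  using upt_add_eq_append[of i p "j - p"] by (simp add: path_moves_def)

lemma path_moves_lower_first:
  assumes "i < j"
  shows "push_move (Up c) (path_moves W P i j) = path_moves (W(i := W i - c)) P i j"
proof -
  have "path_moves W P (Suc i) j = path_moves (W(i := W i - c)) P (Suc i) j"
    by (rule path_moves_cong) auto
  then show ?thesis
    using assms by (simp add: path_moves_def upt_conv_Cons algebra_simps)
qed

lemma path_moves_last:
  assumes "i < j"
  obtains ms where "path_moves W P i j = ms @ [Down (P (j - 1) - W j)]"
    "\<And>c. path_moves (W(j := W j - c)) P i j = ms @ [Down (P (j - 1) - W j + c)]"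
proof -
  obtain k where j: "j = Suc k" "i \<le> k" using assms by (cases j) auto
  have "path_moves (W(j := W j - c)) P i k = path_moves W P i k" for c
    by (rule path_moves_cong) (use j in auto)
  then show ?thesis
    using j by (intro that[of "path_moves W P i k @ [Up (P k - W k)]"]) (auto simp: path_moves_def)
qed

lemma path_moves_eq_iff:
  "path_moves W P i j = path_moves W' P' i j \<longleftrightarrow>
    (\<forall>k\<in>{i..<j}. P k - W k = P' k - W' k \<and> P k - W (Suc k) = P' k - W' (Suc k))"
proof -
  have "path_moves W P i j = path_moves W' P' i j \<longleftrightarrow>
    map (\<lambda>k. [Up (P k - W k), Down (P k - W (Suc k))]) [i..<j] =
    map (\<lambda>k. [Up (P' k - W' k), Down (P' k - W' (Suc k))]) [i..<j]"
    unfolding path_moves_def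
    by (rule concat_eq_concat_iff) (auto simp: set_zip)
  then show ?thesis by (auto simp: map_eq_conv)
qed

text \<open>The contours of the two subtrees meet in valley \<open>p\<close>, a descent followed by
  an ascent, where nothing merges. The edge below merges its \<open>Up c\<close> with the first
  ascent and its \<open>Down c\<close> with the last descent, which amounts to lowering the two
  outer valleys by \<open>c\<close>.\<close>

lemma path_moves_merge:
  assumes i: "i < p" and j: "p < j"
    and t1: "merge_moves (ms1 @ [Down d1]) = path_moves W P i p"
    and t2: "merge_moves (ms2 @ [Down d2]) = path_moves W P p j"
  shows "merge_moves (Up c # (ms1 @ [Down d1]) @ (ms2 @ [Down d2]) @ [Down c]) =
    path_moves (W(i := W i - c, j := W j - c)) P i j"
proof -
  let ?W = "W(j := W j - c)"
  obtain ns where ns: "path_moves W P p j = ns @ [Down (P (j - 1) - W j)]"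
    "\<And>c. path_moves (W(j := W j - c)) P p j = ns @ [Down (P (j - 1) - W j + c)]"
    using path_moves_last[OF j] by metis
  obtain n1 e1 where 1: "\<And>c w. foldr push_move ms1 (Down (d1 + c) # w) = n1 @ Down (e1 + c) # w"
    using foldr_push_Down by metis
  obtain n2 e2 where 2: "\<And>c w. foldr push_move ms2 (Down (d2 + c) # w) = n2 @ Down (e2 + c) # w"
    using foldr_push_Down by metis
  have "n2 @ [Down e2] = ns @ [Down (P (j - 1) - W j)]"
    using t2 2[of 0 "[]"] ns(1) by (simp add: merge_moves_foldr)
  then have right: "foldr push_move (ms2 @ [Down d2] @ [Down c]) [] = path_moves ?W P p j"
    using 2[of c "[]"] ns(2)[of c] by simp
  have left: "foldr push_move (ms1 @ [Down d1]) [] = n1 @ [Down e1]"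
    using 1[of 0 "[]"] by simp
  obtain b w where "path_moves ?W P p j = Up b # w"
    using j by (simp add: path_moves_def upt_conv_Cons)
  then have "foldr push_move (ms1 @ [Down d1] @ ms2 @ [Down d2] @ [Down c]) [] =
      path_moves W P i p @ path_moves ?W P p j"
    using right 1[of 0] left t1 by (simp add: merge_moves_foldr)
  also have "path_moves W P i p = path_moves ?W P i p"
    by (rule path_moves_cong) (use j in auto)
  also have "\<dots> @ path_moves ?W P p j = path_moves ?W P i j"
    by (rule path_moves_append[symmetric]) (use i j in auto)
  finally show ?thesis
    using path_moves_lower_first[of i j c ?W P] i j
    by (simp add: merge_moves_Cons merge_moves_foldr fun_upd_twist)
qed

section \<open>Trees with edge lengths versus valley and peak heights\<close>

lemma size_shape_Leaf: "shape t = plane_of_binary Leaf \<longleftrightarrow> t = Vertex []"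
  by (cases t) (simp add: shape_def)

lemma shape_Node:
  "shape t = plane_of_binary (Node l a r) \<longleftrightarrow>
    (\<exists>c1 t1 c2 t2. t = Vertex [(c1, t1), (c2, t2)] \<and>
      shape t1 = plane_of_binary l \<and> shape t2 = plane_of_binary r)"
  by (cases t) (auto simp: shape_def map_eq_Cons_conv)

definition edge_contour :: "real \<Rightarrow> real plane_tree \<Rightarrow> move list" where
  "edge_contour c t = Up c # edge_moves t @ [Down c]"

text \<open>The data on \<open>W\<close> and \<open>P\<close> carried by the contour of an edge above which \<open>T\<close> sits.\<close>

definition path_data :: "(nat \<Rightarrow> real) \<Rightarrow> (nat \<Rightarrow> real) \<Rightarrow> nat \<Rightarrow> nat \<Rightarrow> bool" where
  "path_data W P i j \<longleftrightarrow> W i = W j \<and> (\<forall>q\<in>{i<..<j}. W i < W q) \<and>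
     (\<forall>k\<in>{i..<j}. W k < P k \<and> W (Suc k) < P k)"

text \<open>Moves determine heights only up to a common shift, so the base height \<open>b\<close>
  can be prescribed. The induction places both subtrees at the height \<open>b + c\<close> of the
  vertex carrying them; this is the height of the valley between them, and all other inner valleys
  are higher.\<close>

lemma path_of_edge:
  assumes "shape t = plane_of_binary T" "0 < c" "\<forall>l\<in>set_plane_tree t. 0 < l"
  shows "\<exists>W P. W i = b \<and> path_data W P i (Suc (i + size T)) \<and> strict_heap (Suc i) T W \<and>
    merge_moves (edge_contour c t) = path_moves W P i (Suc (i + size T))"
  using assms
proof (induction T arbitrary: t c i b)
  case Leaf
  then have "t = Vertex []" using size_shape_Leaf by blast
  then show ?case using Leaf
    by (intro exI[of _ "\<lambda>_. b"] exI[of _ "\<lambda>_. b + c"])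
      (auto simp: path_data_def edge_contour_def path_moves_def)
next
  case (Node l a r)
  let ?p = "Suc (i + size l)"
  let ?j = "Suc (?p + size r)"
  obtain c1 t1 c2 t2 where t: "t = Vertex [(c1, t1), (c2, t2)]"
    "shape t1 = plane_of_binary l" "shape t2 = plane_of_binary r"
    using Node.prems(1) unfolding shape_Node by blast
  have pos: "0 < c1" "0 < c2" "\<forall>l\<in>set_plane_tree t1. 0 < l" "\<forall>l\<in>set_plane_tree t2. 0 < l"
    using Node.prems(3) t(1) by auto
  obtain W1 P1 where 1: "W1 i = b + c" "path_data W1 P1 i ?p" "strict_heap (Suc i) l W1"
    "merge_moves (edge_contour c1 t1) = path_moves W1 P1 i ?p"
    using Node.IH(1)[OF t(2) pos(1,3)] by metis
  obtain W2 P2 where 2: "W2 ?p = b + c" "path_data W2 P2 ?p ?j" "strict_heap (Suc ?p) r W2"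
    "merge_moves (edge_contour c2 t2) = path_moves W2 P2 ?p ?j"
    using Node.IH(2)[OF t(3) pos(2,4)] by metis
  define W0 where "W0 q = (if q < ?p then W1 q else W2 q)" for q
  define P where "P q = (if q < ?p then P1 q else P2 q)" for q
  \<comment> \<open>The outer valleys lie at the foot of the edge, \<open>c\<close> below its upper
    vertex.\<close>
  define W where "W = W0(i := W0 i - c, ?j := W0 ?j - c)"
  have W1p: "W1 ?p = b + c" and W2j: "W2 ?j = b + c" using 1 2 by (auto simp: path_data_def)
  have path1: "path_moves W1 P1 i ?p = path_moves W0 P i ?p"
    by (rule path_moves_cong) (use 2(1) W1p in \<open>auto simp: W0_def P_def less_Suc_eq\<close>)
  have path2: "path_moves W2 P2 ?p ?j = path_moves W0 P ?p ?j"
    by (rule path_moves_cong) (auto simp: W0_def P_def)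
  have merge: "merge_moves (edge_contour c t) = path_moves W P i ?j"
    unfolding W_def
    using path_moves_merge[of i ?p ?j "Up c1 # edge_moves t1" c1 W0 P "Up c2 # edge_moves t2" c2 c]
      1(4) 2(4) t(1) unfolding path1 path2 by (simp add: edge_contour_def)
  have Wi: "W i = b" and Wj: "W ?j = b" using 1 W2j by (auto simp: W_def W0_def)
  have W_in: "W q = W0 q" if "i < q" "q < ?j" for q using that by (auto simp: W_def)
  have bounds: "\<forall>q\<in>{i<..<?j}. b + c \<le> W q \<and> (q \<noteq> ?p \<longrightarrow> b + c < W q)"
    using 1 2 by (auto simp: W_in W0_def path_data_def not_less le_less)
  have peaks: "W k < P k \<and> W (Suc k) < P k" if k: "k \<in> {i..<?j}" for k
  proof -
    have "W q \<le> W0 q" for q using Node.prems(2) by (auto simp: W_def)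
    moreover have "W0 k < P k \<and> W0 (Suc k) < P k"
    proof (cases "k < ?p")
      case True
      then have "W0 (Suc k) = W1 (Suc k)" using W1p 2(1) by (cases "Suc k = ?p") (auto simp: W0_def)
      then show ?thesis using 1(2) k True by (simp add: W0_def P_def path_data_def)
    next
      case False
      then show ?thesis using 2(2) k by (simp add: W0_def P_def path_data_def)
    qed
    ultimately show ?thesis by (meson le_less_trans)
  qed
  note bounds
  moreover have "strict_heap (Suc i) l W = strict_heap (Suc i) l W1"
    by (rule strict_heap_cong) (auto simp: W_def W0_def)
  moreover have "strict_heap (Suc ?p) r W = strict_heap (Suc ?p) r W2"
    by (rule strict_heap_cong) (auto simp: W_def W0_def)
  moreover have Wp: "W ?p = b + c" using W_in[of ?p] 2(1) by (simp add: W0_def)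
  ultimately have "strict_heap (Suc i) (Node l a r) W"
    using 1(3) 2(3) by (auto simp: add.assoc)
  moreover have "path_data W P i ?j"
    unfolding path_data_def using bounds peaks Wi Wj Node.prems(2) by fastforce
  ultimately show ?case using Wi merge by (intro exI[of _ W] exI[of _ P]) (simp add: add.assoc)
qed

text \<open>The edge length is recovered as the rise from the outer valleys to the lowest inner one.
  Once the outer valleys are raised by it, the path splits at that lowest valley into the paths of
  the two subtrees.\<close>

lemma edge_of_path:
  assumes "path_data W P i (Suc (i + size T))" "strict_heap (Suc i) T W"
  shows "\<exists>c t. shape t = plane_of_binary T \<and> 0 < c \<and> (\<forall>l\<in>set_plane_tree t. 0 < l) \<and>
    merge_moves (edge_contour c t) = path_moves W P i (Suc (i + size T))"
  using assms
proof (induction T arbitrary: i W)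
  case Leaf
  then show ?case
    by (intro exI[of _ "P i - W i"] exI[of _ "Vertex []"])
      (auto simp: path_data_def edge_contour_def path_moves_def shape_def)
next
  case (Node l a r)
  let ?p = "Suc (i + size l)"
  let ?j = "Suc (?p + size r)"
  define c where "c = W ?p - W i"
  define W' where "W' = W(i := W i + c, ?j := W ?j + c)"
  have vp: "path_data W P i ?j" using Node.prems(1) by (simp add: add.assoc)
  then have "\<forall>q\<in>{i<..<?j}. W i < W q" unfolding path_data_def by blast
  then have "W i < W ?p" by (rule bspec) simp
  then have c: "0 < c" by (simp add: c_def)
  have min: "W ?p < W q" if "q \<in> {i<..<?j}" "q \<noteq> ?p" for q
    using Node.prems(2) that by auto
  \<comment> \<open>The raised outer valleys must stay below their peaks. Each peak exceeds an
    adjacent inner valley, which is at least as high as valley \<open>?p\<close>.\<close>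
  have le_P: "W ?p < P k" if "k \<in> {i..<?j}" for k
  proof (cases "k = i")
    case True
    then show ?thesis using vp min[of "Suc i"] by (cases "Suc i = ?p") (force simp: path_data_def)+
  next
    case False
    then show ?thesis using vp min[of k] that by (cases "k = ?p") (force simp: path_data_def)+
  qed
  have v1: "path_data W' P i ?p" and v2: "path_data W' P ?p ?j"
    using vp min le_P by (auto simp: path_data_def W'_def c_def)
  have "strict_heap (Suc i) l W' = strict_heap (Suc i) l W"
    by (rule strict_heap_cong) (auto simp: W'_def)
  then obtain c1 t1 where 1: "shape t1 = plane_of_binary l" "0 < c1" "\<forall>l\<in>set_plane_tree t1. 0 < l"
    "merge_moves (edge_contour c1 t1) = path_moves W' P i ?p"
    using Node.IH(1)[OF v1] Node.prems(2) by auto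
  have "strict_heap (Suc ?p) r W' = strict_heap (Suc ?p) r W"
    by (rule strict_heap_cong) (auto simp: W'_def)
  then obtain c2 t2 where 2: "shape t2 = plane_of_binary r" "0 < c2" "\<forall>l\<in>set_plane_tree t2. 0 < l"
    "merge_moves (edge_contour c2 t2) = path_moves W' P ?p ?j"
    using Node.IH(2)[OF v2] Node.prems(2) by auto
  have "merge_moves (edge_contour c (Vertex [(c1, t1), (c2, t2)])) =
      path_moves (W'(i := W' i - c, ?j := W' ?j - c)) P i ?j"
    using path_moves_merge[of i ?p ?j "Up c1 # edge_moves t1" c1 W' P "Up c2 # edge_moves t2" c2 c]
      1(4) 2(4) by (simp add: edge_contour_def)
  also have "W'(i := W' i - c, ?j := W' ?j - c) = W"
    by (auto simp: W'_def)
  finally have "merge_moves (edge_contour c (Vertex [(c1, t1), (c2, t2)])) = path_moves W P i ?j" .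
  moreover have "shape (Vertex [(c1, t1), (c2, t2)]) = plane_of_binary (Node l a r)"
    using 1 2 by (simp add: shape_def)
  ultimately show ?case using c 1 2
    by (intro exI[of _ c] exI[of _ "Vertex [(c1, t1), (c2, t2)]"]) (auto simp: add.assoc)
qed

lemma no_unary_of_shape:
  "shape t = plane_of_binary T \<Longrightarrow> length (children t) \<noteq> 1 \<and> no_unary_below_root t"
proof (induction T arbitrary: t)
  case Leaf
  then have "t = Vertex []" using size_shape_Leaf by blast
  then show ?case by simp
next
  case (Node l a r)
  from Node.prems obtain c1 t1 c2 t2 where t: "t = Vertex [(c1, t1), (c2, t2)]"
    "shape t1 = plane_of_binary l" "shape t2 = plane_of_binary r"
    unfolding shape_Node by blast
  then show ?case using Node.IH(1)[OF t(2)] Node.IH(2)[OF t(3)] by simp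
qed

section \<open>Valley heights as coordinates\<close>

text \<open>Indices are zero based: \<open>idx k\<close> is coordinate number \<open>k + 1\<close>,
  so that valley \<open>k\<close> involves exactly the \<open>idx i\<close> with
  \<open>i < k\<close>.\<close>

definition idx :: "nat \<Rightarrow> 'n::{finite,linorder}" where
  "idx k = sorted_list_of_set UNIV ! k"

definition valley :: "real^'n::{finite,linorder} \<Rightarrow> real^'n::{finite,linorder} \<Rightarrow> nat \<Rightarrow> real" where
  "valley x y k = (\<Sum>i<k. x $ idx i - y $ idx i)"

lemma length_coords [simp]: "length (coords (v :: real^'n::{finite,linorder})) = CARD('n)"
  by (simp add: coords_def)

lemma coords_nth:
  "k < CARD('n) \<Longrightarrow> coords (v :: real^'n::{finite,linorder}) ! k = v $ idx k"
  by (simp add: coords_def idx_def)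

lemma bij_idx: "bij_betw (idx :: nat \<Rightarrow> 'n::{finite,linorder}) {..<CARD('n)} UNIV"
  unfolding idx_def[abs_def] by (rule bij_betw_nth) auto

lemma idx_less_iff:
  assumes "i < CARD('n)" "j < CARD('n)"
  shows "(idx i :: 'n::{finite,linorder}) < idx j \<longleftrightarrow> i < j"
proof -
  have "(idx i :: 'n) < idx j" if "i < j" "j < CARD('n)" for i j
    using sorted_wrt_nth_less[OF sorted_list_of_set.strict_sorted_key_list_of_set[of "UNIV :: 'n set"], of i j] that
    by (simp add: idx_def)
  then show ?thesis using assms by (metis linorder_neqE_nat order_less_asym order_less_irrefl)
qed

lemma all_idx: "(\<forall>i. Q (i :: 'n::{finite,linorder})) \<longleftrightarrow> (\<forall>k<CARD('n). Q (idx k))"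
  using bij_betw_imp_surj_on[OF bij_idx] by (metis UNIV_I imageE lessThan_iff)

lemma sum_idx: "(\<Sum>k<CARD('n). f (idx k)) = (\<Sum>i\<in>UNIV. f (i :: 'n::{finite,linorder}))"
  by (rule sum.reindex_bij_betw[OF bij_idx])

lemma sum_atMost_idx:
  assumes "k < CARD('n)"
  shows "(\<Sum>j\<in>{..idx k :: 'n::{finite,linorder}}. f j) = (\<Sum>i<Suc k. f (idx i))"
proof -
  have "bij_betw idx {..<Suc k} {..idx k :: 'n}"
  proof (rule bij_betw_imageI)
    show "inj_on (idx :: nat \<Rightarrow> 'n) {..<Suc k}"
      by (rule inj_on_subset[OF bij_betw_imp_inj_on[OF bij_idx]]) (use assms in auto)
    have le: "(idx i :: 'n) \<le> idx k \<longleftrightarrow> i \<le> k" if "i < CARD('n)" for i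
      using idx_less_iff[of k i, where 'n = 'n] that assms by (simp add: not_less flip: not_le)
    show "idx ` {..<Suc k} = {..idx k :: 'n}"
    proof
      show "idx ` {..<Suc k} \<subseteq> {..idx k :: 'n}" using le assms by auto
      show "{..idx k :: 'n} \<subseteq> idx ` {..<Suc k}"
      proof
        fix j assume j: "j \<in> {..idx k :: 'n}"
        obtain i where "i < CARD('n)" "j = idx i"
          using bij_betw_imp_surj_on[OF bij_idx] by (metis UNIV_I imageE lessThan_iff)
        then show "j \<in> idx ` {..<Suc k}" using le j by auto
      qed
    qed
  qed
  then show ?thesis by (rule sum.reindex_bij_betw[symmetric])
qed

lemma valley_0 [simp]: "valley x y 0 = 0"
  by (simp add: valley_def)

lemma valley_Suc: "valley x y (Suc k) = valley x y k + x $ idx k - y $ idx k"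
  by (simp add: valley_def)

lemma valley_affine: "u + v = 1 \<Longrightarrow> valley x (u *\<^sub>R y + v *\<^sub>R z) k = u * valley x y k + v * valley x z k"
proof (induction k)
  case (Suc k)
  have "x $ idx k = u * x $ idx k + v * x $ idx k" using Suc.prems by (metis distrib_right mult_1)
  then show ?case using Suc by (simp add: valley_Suc algebra_simps)
qed simp

lemma partial_sum_le_iff:
  fixes x y :: "real^'n::{finite,linorder}"
  assumes "k < CARD('n)"
  shows "(\<Sum>j\<in>{..idx k}. y $ j) \<le> (\<Sum>j\<in>{..idx k}. x $ j) \<longleftrightarrow> 0 \<le> valley x y (Suc k)"
  unfolding sum_atMost_idx[OF assms] valley_def by (simp add: sum_subtractf del: sum.lessThan_Suc)

lemma Pi_polytope_iff:
  fixes x :: "real^'n::{finite,linorder}"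
  shows "y \<in> Pi_polytope x \<longleftrightarrow> (\<forall>k<CARD('n). 0 \<le> y $ idx k \<and> 0 \<le> valley x y (Suc k))"
  unfolding Pi_polytope_def mem_Collect_eq by (subst all_idx) (simp add: partial_sum_le_iff)

lemma contour_conv_nth:
  "length xs = length ys \<Longrightarrow>
    contour xs ys = concat (map (\<lambda>k. [Up (xs ! k), Down (ys ! k)]) [0..<length xs])"
  unfolding contour_def by (intro arg_cong[of _ _ concat] nth_equalityI) auto

text \<open>The root of \<open>\<phi>(x, y)\<close> is at height \<open>0\<close>, where the traversal starts and ends.\<close>

definition closed_valley :: "real^'n::{finite,linorder} \<Rightarrow> real^'n::{finite,linorder} \<Rightarrow> nat \<Rightarrow> real" where
  "closed_valley x y k = (if k \<le> CARD('n) then valley x y k else 0)"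

text \<open>The last peak, \<open>k = CARD('n)\<close>, is reached by the completing ascent; its
  height is \<open>s\<close> minus the sum of the coordinates of \<open>y\<close>.\<close>

definition peak :: "real \<Rightarrow> real^'n::{finite,linorder} \<Rightarrow> real^'n::{finite,linorder} \<Rightarrow> nat \<Rightarrow> real" where
  "peak s x y k = (if k < CARD('n) then valley x y k + x $ idx k else valley x y k + s - sum_list (coords x))"

lemma sum_list_coords: "sum_list (coords (v :: real^'n::{finite,linorder})) = (\<Sum>k<CARD('n). v $ idx k)"
  by (simp add: sum_list_sum_nth coords_nth atLeast0LessThan)

lemma contour_eq_path_moves:
  fixes x y :: "real^'n::{finite,linorder}"
  shows "contour (coords x @ [s - sum_list (coords x)]) (coords y @ [s - sum_list (coords y)]) =
    path_moves (closed_valley x y) (peak s x y) 0 (Suc CARD('n))"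
proof -
  have last: "valley x y CARD('n) = sum_list (coords x) - sum_list (coords y)"
    unfolding sum_list_coords valley_def by (simp add: sum_subtractf)
  have "[Up ((coords x @ [s - sum_list (coords x)]) ! k), Down ((coords y @ [s - sum_list (coords y)]) ! k)] =
    [Up (peak s x y k - closed_valley x y k), Down (peak s x y k - closed_valley x y (Suc k))]"
    if "k < Suc CARD('n)" for k
  proof (cases "k < CARD('n)")
    case True
    then show ?thesis by (simp add: nth_append coords_nth peak_def closed_valley_def valley_Suc)
  next
    case False
    then have "k = CARD('n)" using that by simp
    then show ?thesis using last by (simp add: nth_append peak_def closed_valley_def)
  qed
  then show ?thesis
    by (subst contour_conv_nth, simp, unfold path_moves_def, intro arg_cong[of _ _ concat] map_cong)
       auto
qed

text \<open>The inequalities in \<open>Delta_generic\<close> allow valleys at height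
  \<open>0\<close>, but the root of a planted tree has a single child: the traversal returns to it
  only at the very end, so all valleys are strictly positive.\<close>

lemma Delta_generic_iff:
  fixes x y :: "real^'n::{finite,linorder}"
  assumes x: "\<And>i. 0 < x $ i" and s: "(\<Sum>i\<in>UNIV. x $ i) < s" and T: "size T = CARD('n)"
  shows "y \<in> Delta_generic s x T \<longleftrightarrow>
    (\<forall>k<CARD('n). 0 < y $ idx k \<and> 0 < valley x y (Suc k)) \<and> strict_heap 1 T (valley x y)"
proof -
  let ?n = "CARD('n)"
  let ?W = "closed_valley x y" and ?P = "peak s x y"
  let ?path = "path_moves ?W ?P 0 (Suc ?n)"
  have s': "sum_list (coords x) < s" using s by (simp add: sum_list_coords sum_idx)
  have heap: "strict_heap 1 T ?W = strict_heap 1 T (valley x y)"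
    by (rule strict_heap_cong) (use T in \<open>auto simp: closed_valley_def\<close>)
  have pos: "(\<forall>q\<in>{0<..<Suc ?n}. 0 < ?W q) \<longleftrightarrow> (\<forall>k<?n. 0 < valley x y (Suc k))"
    by (auto simp: closed_valley_def less_Suc_eq_le Suc_le_eq gr0_conv_Suc)
  show ?thesis
  proof
    assume y: "y \<in> Delta_generic s x T"
    then obtain \<tau> where \<tau>: "is_phi s x y \<tau>" "shape \<tau> = planted T" and ypos: "\<forall>i. 0 < y $ i"
      unfolding Delta_generic_def by blast
    obtain c t where t: "\<tau> = Vertex [(c, t)]" "shape t = plane_of_binary T"
      using \<tau>(2) by (cases \<tau>) (auto simp: shape_def planted_def)
    have "0 < c" "\<forall>l\<in>set_plane_tree t. 0 < l" using \<tau>(1) t by (auto simp: is_phi_def)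
    then obtain W P where W: "W 0 = 0" "path_data W P 0 (Suc ?n)" "strict_heap 1 T W"
      "merge_moves (edge_contour c t) = path_moves W P 0 (Suc ?n)"
      using path_of_edge[OF t(2), of c 0 0] T by auto
    have "path_moves W P 0 (Suc ?n) = ?path"
      using \<tau>(1) t(1) W(4) unfolding is_phi_def contour_eq_path_moves by (simp add: edge_contour_def)
    then have eq: "P k - W k = ?P k - ?W k" "P k - W (Suc k) = ?P k - ?W (Suc k)" if "k < Suc ?n" for k
      using that unfolding path_moves_eq_iff by auto
    \<comment> \<open>Both paths start at height \<open>0\<close> and have the same moves, so their
      heights agree valley by valley.\<close>
    have WW: "W k = ?W k" if "k \<le> Suc ?n" for k using that
    proof (induction k)
      case 0
      show ?case using W by (simp add: closed_valley_def)
    next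
      case (Suc k)
      then show ?case using eq[of k] by auto
    qed
    have "strict_heap 1 T ?W"
      using W(3) strict_heap_cong[of 1 T W ?W] WW T by auto
    moreover have "\<forall>q\<in>{0<..<Suc ?n}. 0 < ?W q"
      using W(1,2) WW by (auto simp: path_data_def)
    ultimately show "(\<forall>k<?n. 0 < y $ idx k \<and> 0 < valley x y (Suc k)) \<and> strict_heap 1 T (valley x y)"
      using heap pos ypos by auto
  next
    assume y: "(\<forall>k<?n. 0 < y $ idx k \<and> 0 < valley x y (Suc k)) \<and> strict_heap 1 T (valley x y)"
    then have ypos: "\<forall>i. 0 < y $ i" by (subst all_idx) auto
    have "path_data ?W ?P 0 (Suc ?n)"
    proof -
      have "?W k < ?P k \<and> ?W (Suc k) < ?P k" if "k < Suc ?n" for k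
      proof (cases "k < ?n")
        case True
        then show ?thesis using x[of "idx k"] y by (auto simp: closed_valley_def peak_def valley_Suc)
      next
        case False
        then have "k = ?n" using that by simp
        \<comment> \<open>Positivity of the last valley, available for indices of the form
          \<open>Suc m\<close>, puts the last peak above the final height \<open>0\<close>.\<close>
        moreover obtain m where "?n = Suc m" by (metis gr0_conv_Suc zero_less_card_finite)
        ultimately show ?thesis using s' y by (auto simp: closed_valley_def peak_def)
      qed
      then show ?thesis using pos y unfolding path_data_def by (auto simp: closed_valley_def)
    qed
    then obtain c t where t: "shape t = plane_of_binary T" "0 < c" "\<forall>l\<in>set_plane_tree t. 0 < l"
      "merge_moves (edge_contour c t) = ?path"
      using edge_of_path[of ?W ?P 0 T] heap y T by auto
    have "is_phi s x y (Vertex [(c, t)])"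
      unfolding is_phi_def contour_eq_path_moves
      using t no_unary_of_shape[OF t(1)] by (auto simp: edge_contour_def)
    moreover have "shape (Vertex [(c, t)]) = planted T"
      using t(1) by (simp add: shape_def planted_def)
    moreover have "(\<Sum>j\<in>{..i}. y $ j) \<le> (\<Sum>j\<in>{..i}. x $ j)" for i
    proof -
      have "\<forall>i. (\<Sum>j\<in>{..i}. y $ j) \<le> (\<Sum>j\<in>{..i}. x $ j)"
        using y by (subst all_idx) (auto simp: partial_sum_le_iff less_imp_le)
      then show ?thesis by blast
    qed
    ultimately show "y \<in> Delta_generic s x T"
      unfolding Delta_generic_def using ypos by blast
  qed
qed

section \<open>The chambers\<close>

definition chamber :: "real^'n::{finite,linorder} \<Rightarrow> 'a tree \<Rightarrow> (real^'n::{finite,linorder}) set" where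
  "chamber x T = {y\<in>Pi_polytope x. iheap 1 T (valley x y)}"

definition strict_point :: "real^'n::{finite,linorder} \<Rightarrow> real^'n::{finite,linorder} \<Rightarrow> bool" where
  "strict_point x y \<longleftrightarrow> (\<forall>k<CARD('n). 0 < y $ idx k \<and> 0 < valley x y (Suc k))"

definition tube_set :: "real^'n::{finite,linorder} \<Rightarrow> (nat \<times> nat) set \<Rightarrow> (real^'n::{finite,linorder}) set" where
  "tube_set x D = {y\<in>Pi_polytope x. tubes CARD('n) (valley x y) \<subseteq> D}"

lemma ex_vec: "\<exists>v. \<forall>k<CARD('n). (v :: real^'n::{finite,linorder}) $ idx k = f k"
  by (rule exI[of _ "\<chi> i. f (the_inv_into {..<CARD('n)} idx i)"])
     (simp add: the_inv_into_f_f[OF bij_betw_imp_inj_on[OF bij_idx]])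

lemma ex_vec_of_valley:
  fixes x :: "real^'n::{finite,linorder}"
  assumes "U 0 = 0"
  shows "\<exists>y. \<forall>k\<le>CARD('n). valley x y k = U k"
proof -
  obtain y :: "real^'n::{finite,linorder}" where y: "\<forall>k<CARD('n). y $ idx k = U k + x $ idx k - U (Suc k)"
    using ex_vec[of "\<lambda>k. U k + x $ idx k - U (Suc k)"] by blast
  have "valley x y k = U k" if "k \<le> CARD('n)" for k
    using that by (induction k) (use assms y in \<open>auto simp: valley_Suc\<close>)
  then show ?thesis by blast
qed

lemma strict_point_imp_Pi: "strict_point x y \<Longrightarrow> y \<in> Pi_polytope x"
  by (auto simp: strict_point_def Pi_polytope_iff less_imp_le)

text \<open>A positive scaling and a shift fit any pattern of heights between \<open>0\<close> and
  the smallest \<open>x $ i\<close>. Each ascent alone is then longer than the next valley is high,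
  so every descent is positive.\<close>

lemma ex_strict_point:
  fixes x :: "real^'n::{finite,linorder}"
  assumes x: "\<And>i. 0 < x $ i"
  shows "\<exists>y c d. strict_point x y \<and> 0 < c \<and> (\<forall>q\<in>{1..CARD('n)}. valley x y q = c * W q + d)"
proof -
  define m where "m = Min (range (($) x))"
  have m: "m \<le> x $ i" for i unfolding m_def by (rule Min_le) auto
  have "m \<in> range (($) x)" unfolding m_def by (rule Min_in) auto
  then have m0: "0 < m" using x by auto
  define B where "B = 1 + Max ((\<lambda>q. \<bar>W q\<bar>) ` {..CARD('n)})"
  have B: "\<bar>W q\<bar> < B" if "q \<le> CARD('n)" for q
  proof -
    have "\<bar>W q\<bar> \<le> Max ((\<lambda>q. \<bar>W q\<bar>) ` {..CARD('n)})" by (rule Max_ge) (use that in auto)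
    then show ?thesis by (simp add: B_def)
  qed
  then have B0: "0 < B" using abs_ge_zero[of "W 0"] by (meson le0 le_less_trans)
  \<comment> \<open>As \<open>B\<close> exceeds the absolute values of \<open>W\<close>, this puts
    \<open>c * W q + m / 2\<close> strictly between \<open>0\<close> and \<open>m\<close>.\<close>
  define c where "c = m / (2 * B)"
  have c: "0 < c" using m0 B0 by (simp add: c_def)
  define U where "U q = (if q = 0 then 0 else c * W q + m / 2)" for q
  have U: "0 < U q" "U q < m" if q: "0 < q" "q \<le> CARD('n)" for q
  proof -
    have "\<bar>c * W q\<bar> < c * B" using B[OF q(2)] c by (simp add: abs_mult)
    also have "c * B = m / 2" using B0 by (simp add: c_def)
    finally show "0 < U q" "U q < m" using q by (auto simp: U_def)
  qed
  obtain y where y: "\<forall>k\<le>CARD('n). valley x y k = U k"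
    using ex_vec_of_valley[of U x] by (auto simp: U_def)
  have "0 < y $ idx k" if k: "k < CARD('n)" for k
  proof -
    have "y $ idx k = U k + x $ idx k - U (Suc k)"
      using valley_Suc[of x y k] y k by auto
    moreover have "0 \<le> U k" using U[of k] k by (cases k) (auto simp: U_def)
    ultimately show ?thesis using U(2)[of "Suc k"] m[of "idx k"] k by auto
  qed
  then have "strict_point x y" using y U(1) by (auto simp: strict_point_def)
  moreover have "\<forall>q\<in>{1..CARD('n)}. valley x y q = c * W q + m / 2" using y by (auto simp: U_def)
  ultimately show ?thesis using c by blast
qed

lemma ex_strict_heap_point:
  fixes x :: "real^'n::{finite,linorder}"
  assumes x: "\<And>i. 0 < x $ i" and T: "size T = CARD('n)"
  shows "\<exists>y. strict_point x y \<and> strict_heap 1 T (valley x y)"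
proof -
  obtain W where W: "strict_heap 1 T W" using ex_strict_heap by blast
  obtain y c d where y: "strict_point x y" "0 < c" "\<forall>q\<in>{1..CARD('n)}. valley x y q = c * W q + d"
    using ex_strict_point[OF x, where W = W] by blast
  have "strict_heap 1 T (valley x y) = strict_heap 1 T (\<lambda>q. c * W q + d)"
    by (rule strict_heap_cong) (use y T in auto)
  then show ?thesis using strict_heap_affine[OF y(2) W] y(1) by blast
qed

lemma ex_strict_tube_point:
  fixes x :: "real^'n::{finite,linorder}"
  assumes x: "\<And>i. 0 < x $ i" and D: "D \<subseteq> diag_pairs CARD('n)" "non_crossing D"
  shows "\<exists>y. strict_point x y \<and> tubes CARD('n) (valley x y) = D"
proof -
  obtain y c d where y: "strict_point x y" "0 < c"
    "\<forall>q\<in>{1..CARD('n)}. valley x y q = c * nesting_depth D q + d"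
    using ex_strict_point[OF x, where W = "nesting_depth D"] by blast
  have "tubes CARD('n) (valley x y) = tubes CARD('n) (\<lambda>q. c * nesting_depth D q + d)"
    by (rule tubes_cong) (use y in auto)
  then show ?thesis using y(1,2) tubes_affine tubes_nesting_depth[OF D] by metis
qed

lemma strict_heap_convex_combination:
  assumes "iheap m T U" "strict_heap m T V" "0 \<le> u" "0 < v"
  shows "strict_heap m T (\<lambda>q. u * U q + v * V q)"
  using assms(1,2)
proof (induction T arbitrary: m)
  case (Node l a r)
  have "u * U (m + size l) + v * V (m + size l) < u * U q + v * V q"
    if "q \<in> {m..<m + size (Node l a r)}" "q \<noteq> m + size l" for q
    using Node.prems that assms(3,4) by (intro add_le_less_mono mult_left_mono) auto
  then show ?case using Node by auto
qed simp

lemma strict_point_convex_combination: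
  assumes "y \<in> Pi_polytope x" "strict_point x z" "0 \<le> u" "0 < v" "u + v = 1"
  shows "strict_point x (u *\<^sub>R y + v *\<^sub>R z)"
  unfolding strict_point_def valley_affine[OF assms(5)]
  using assms by (auto simp: strict_point_def Pi_polytope_iff intro!: add_nonneg_pos)

text \<open>Prolonging the segment from \<open>y0\<close> past \<open>w\<close> within the polytope
  exhibits \<open>w\<close> as a mixture of a point of the polytope and the strict point
  \<open>y0\<close>, with the positive weight \<open>1 - 1 / e\<close> on the latter.\<close>

lemma strict_point_if_extendable:
  assumes "y0 \<in> Pi_polytope x" "strict_point x y0" "1 < e" "(1 - e) *\<^sub>R y0 + e *\<^sub>R w \<in> Pi_polytope x"
  shows "strict_point x w"
proof -
  have "strict_point x ((1 / e) *\<^sub>R ((1 - e) *\<^sub>R y0 + e *\<^sub>R w) + (1 - 1 / e) *\<^sub>R y0)"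
    by (rule strict_point_convex_combination) (use assms in auto)
  also have "(1 / e) *\<^sub>R ((1 - e) *\<^sub>R y0 + e *\<^sub>R w) + (1 - 1 / e) *\<^sub>R y0 = w"
  proof -
    have "(1 / e) * (1 - e) + (1 - 1 / e) = 0" using assms(3) by (simp add: field_simps)
    then have "((1 / e) * (1 - e)) *\<^sub>R y0 + (1 - 1 / e) *\<^sub>R y0 = 0"
      by (metis scaleR_add_left scaleR_zero_left)
    then show ?thesis using assms(3) by (simp add: scaleR_add_right algebra_simps)
  qed
  finally show ?thesis .
qed

section \<open>Chambers as polytopes and as closures\<close>

lemma linear_sum_idx: "linear (\<lambda>y :: real^'n::{finite,linorder}. \<Sum>i<k. y $ idx i)"
  by (intro linear_compose_sum) (auto intro: bounded_linear.linear bounded_linear_vec_nth)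

lemma polyhedron_linear_le:
  fixes f :: "'a::euclidean_space \<Rightarrow> real"
  assumes "linear f"
  shows "polyhedron {y. f y \<le> c}"
proof -
  have "f y = adjoint f 1 \<bullet> y" for y
    using adjoint_works[OF assms, of y 1] by (simp add: inner_commute)
  then show ?thesis using polyhedron_halfspace_le[of "adjoint f 1" c] by simp
qed

lemma polyhedron_ball:
  assumes "finite A" "\<And>q. q \<in> A \<Longrightarrow> polyhedron {y. Q q y}"
  shows "polyhedron {y. \<forall>q\<in>A. Q q y}"
proof -
  have "{y. \<forall>q\<in>A. Q q y} = \<Inter>((\<lambda>q. {y. Q q y}) ` A)" by auto
  then show ?thesis using assms by (auto intro!: polyhedron_Inter)
qed

lemma polyhedron_valley_le: "polyhedron {y. valley x y a \<le> valley x y b}"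
proof -
  have "{y. valley x y a \<le> valley x y b} =
      {y. (\<Sum>i<b. y $ idx i) - (\<Sum>i<a. y $ idx i) \<le> (\<Sum>i<b. x $ idx i) - (\<Sum>i<a. x $ idx i)}"
    by (auto simp: valley_def sum_subtractf)
  then show ?thesis
    by (simp add: polyhedron_linear_le linear_compose_sub linear_sum_idx)
qed

lemma polyhedron_iheap: "polyhedron {y. iheap m T (valley x y)}"
proof (induction T arbitrary: m)
  case (Node l a r)
  let ?I = "{m..<m + size (Node l a r)}"
  have "{y. iheap m (Node l a r) (valley x y)} = {y. iheap m l (valley x y)} \<inter>
      ({y. iheap (Suc (m + size l)) r (valley x y)} \<inter>
       {y. \<forall>q\<in>?I. valley x y (m + size l) \<le> valley x y q})"
    by auto
  moreover have "polyhedron {y. \<forall>q\<in>?I. valley x y (m + size l) \<le> valley x y q}"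
    by (rule polyhedron_ball) (auto intro: polyhedron_valley_le)
  ultimately show ?case using Node by (simp only: polyhedron_Int)
qed simp

lemma polyhedron_Pi:
  fixes x :: "real^'n::{finite,linorder}"
  shows "polyhedron (Pi_polytope x)"
proof -
  have "Pi_polytope x = {y. \<forall>k\<in>{..<CARD('n)}. - y $ idx k \<le> 0} \<inter>
      {y. \<forall>k\<in>{..<CARD('n)}. valley x y 0 \<le> valley x y (Suc k)}"
    by (auto simp: Pi_polytope_iff)
  moreover have "polyhedron {y :: real^'n::{finite,linorder}. \<forall>k\<in>{..<CARD('n)}. - y $ idx k \<le> 0}"
    by (rule polyhedron_ball, simp)
       (intro polyhedron_linear_le linear_compose_neg bounded_linear.linear bounded_linear_vec_nth)
  moreover have "polyhedron {y. \<forall>k\<in>{..<CARD('n)}. valley x y 0 \<le> valley x y (Suc k)}"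
    by (rule polyhedron_ball) (auto simp only: finite_lessThan intro: polyhedron_valley_le)
  ultimately show ?thesis by (simp only: polyhedron_Int)
qed

lemma bounded_Pi: "bounded (Pi_polytope (x :: real^'n::{finite,linorder}))"
proof (rule bounded_subset[OF bounded_cbox])
  have "y $ i \<le> (\<Sum>j\<in>UNIV. \<bar>x $ j\<bar>)" if y: "y \<in> Pi_polytope x" for y i
  proof -
    have "y $ i \<le> (\<Sum>j\<in>{..i}. y $ j)"
      by (rule member_le_sum) (use y in \<open>auto simp: Pi_polytope_def\<close>)
    also have "\<dots> \<le> (\<Sum>j\<in>{..i}. x $ j)" using y by (auto simp: Pi_polytope_def)
    also have "\<dots> \<le> (\<Sum>j\<in>{..i}. \<bar>x $ j\<bar>)" by (rule sum_mono) auto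
    also have "\<dots> \<le> (\<Sum>j\<in>UNIV. \<bar>x $ j\<bar>)" by (rule sum_mono2) auto
    finally show ?thesis .
  qed
  then show "Pi_polytope x \<subseteq> cbox 0 (\<chi> i. \<Sum>j\<in>UNIV. \<bar>x $ j\<bar>)"
    by (auto simp: mem_box_cart Pi_polytope_def)
qed

lemma polytope_Pi: "polytope (Pi_polytope x)"
  by (simp add: polytope_eq_bounded_polyhedron polyhedron_Pi bounded_Pi)

lemma chamber_subset_Pi: "chamber x T \<subseteq> Pi_polytope x"
  by (auto simp: chamber_def)

lemma polytope_chamber: "polytope (chamber x T)"
proof -
  have "chamber x T = Pi_polytope x \<inter> {y. iheap 1 T (valley x y)}" by (auto simp: chamber_def)
  then have "polyhedron (chamber x T)" by (simp only: polyhedron_Int polyhedron_Pi polyhedron_iheap)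
  then show ?thesis
    using bounded_subset[OF bounded_Pi chamber_subset_Pi] polytope_eq_bounded_polyhedron by blast
qed

text \<open>The chamber is closed and contains the generic points. Conversely, moving from any of
  its points towards a strict, strictly heap ordered point makes all inequalities strict at
  once.\<close>

lemma Delta_eq_chamber:
  fixes x :: "real^'n::{finite,linorder}"
  assumes x: "\<And>i. 0 < x $ i" and s: "(\<Sum>i\<in>UNIV. x $ i) < s" and T: "size T = CARD('n)"
  shows "Delta s x T = chamber x T"
proof
  have gen: "Delta_generic s x T = {y. strict_point x y \<and> strict_heap 1 T (valley x y)}"
    using Delta_generic_iff[OF x s T] by (auto simp: strict_point_def)
  show "Delta s x T \<subseteq> chamber x T"
    unfolding Delta_def
  proof (rule closure_minimal)
    show "Delta_generic s x T \<subseteq> chamber x T"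
      unfolding gen by (auto simp: chamber_def strict_heap_imp_heap strict_point_imp_Pi)
    show "closed (chamber x T)" using polytope_chamber polytope_imp_closed by blast
  qed
  show "chamber x T \<subseteq> Delta s x T"
  proof
    fix y assume y: "y \<in> chamber x T"
    obtain z where z: "strict_point x z" "strict_heap 1 T (valley x z)"
      using ex_strict_heap_point[OF x T] by blast
    have "open_segment y z \<subseteq> Delta_generic s x T"
    proof
      fix w assume "w \<in> open_segment y z"
      then obtain u where u: "0 < u" "u < 1" "w = (1 - u) *\<^sub>R y + u *\<^sub>R z" by (auto simp: in_segment)
      have "strict_heap 1 T (\<lambda>q. (1 - u) * valley x y q + u * valley x z q)"
        by (rule strict_heap_convex_combination) (use y z u in \<open>auto simp: chamber_def\<close>)
      moreover have "valley x w = (\<lambda>q. (1 - u) * valley x y q + u * valley x z q)"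
        using valley_affine[of "1 - u" u x y z] u by (simp add: fun_eq_iff)
      ultimately have "strict_heap 1 T (valley x w)" by simp
      moreover have "strict_point x w" unfolding u(3)
        by (rule strict_point_convex_combination) (use y z u in \<open>auto simp: chamber_def\<close>)
      ultimately show "w \<in> Delta_generic s x T" unfolding gen by simp
    qed
    then have "closure (open_segment y z) \<subseteq> Delta s x T" unfolding Delta_def by (rule closure_mono)
    moreover have "z \<in> Delta_generic s x T" unfolding gen using z by simp
    then have "z \<in> Delta s x T" unfolding Delta_def using closure_subset by blast
    \<comment> \<open>If \<open>y = z\<close> the open segment is empty; otherwise its closure
      contains the end \<open>y\<close>.\<close>
    ultimately show "y \<in> Delta s x T" by (cases "y = z") auto
  qed
qed

section \<open>The polyhedral decomposition\<close>

lemma chamber_eq_tube_set: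
  fixes x :: "real^'n::{finite,linorder}"
  assumes "strict_heap 1 T W" "size T = CARD('n)"
  shows "chamber x T = tube_set x (tubes CARD('n) W)"
  using heap_iff_cone[OF assms(1)] cone_iff_tubes assms(2) by (auto simp: chamber_def tube_set_def)

lemma convex_tube_set:
  fixes x :: "real^'n::{finite,linorder}"
  shows "convex (tube_set x (tubes CARD('n) W))"
  unfolding convex_alt
proof (intro ballI allI impI)
  fix y z and u :: real
  assume y: "y \<in> tube_set x (tubes CARD('n) W)" and z: "z \<in> tube_set x (tubes CARD('n) W)"
    and u: "0 \<le> u \<and> u \<le> 1"
  have "(1 - u) *\<^sub>R y + u *\<^sub>R z \<in> Pi_polytope x"
    using polytope_imp_convex[OF polytope_Pi[of x]] y z u unfolding convex_alt by (auto simp: tube_set_def)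
  moreover have "valley x y \<in> heap_cone CARD('n) W" "valley x z \<in> heap_cone CARD('n) W"
    using y z unfolding cone_iff_tubes by (auto simp: tube_set_def)
  then have "valley x ((1 - u) *\<^sub>R y + u *\<^sub>R z) \<in> heap_cone CARD('n) W"
    using u by (auto simp: heap_cone_def valley_affine intro!: add_mono mult_left_mono)
  ultimately show "(1 - u) *\<^sub>R y + u *\<^sub>R z \<in> tube_set x (tubes CARD('n) W)"
    unfolding cone_iff_tubes by (auto simp: tube_set_def)
qed

text \<open>\<open>W\<close> is arbitrary here. A strict heap of another tree yields the
  intersection with the other chamber; the valley heights of a point of the chamber yield the face
  cut out by the tubes of that point.\<close>

lemma chamber_Int_tube_set_face:
  fixes x :: "real^'n::{finite,linorder}"
  assumes T: "size T = CARD('n)"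
  shows "chamber x T \<inter> tube_set x (tubes CARD('n) W) face_of chamber x T"
proof -
  obtain W' where W': "strict_heap 1 T W'" using ex_strict_heap by blast
  note ch = chamber_eq_tube_set[OF W' T, of x]
  show ?thesis
    unfolding face_of_def
  proof (intro conjI ballI impI)
    show "convex (chamber x T \<inter> tube_set x (tubes CARD('n) W))"
      unfolding ch by (intro convex_Int convex_tube_set)
    fix a b w
    assume a: "a \<in> chamber x T" and b: "b \<in> chamber x T"
      and w: "w \<in> chamber x T \<inter> tube_set x (tubes CARD('n) W)" "w \<in> open_segment a b"
    have sub: "a \<in> tube_set x (tubes CARD('n) W)"
      if ab: "a \<in> chamber x T" "b \<in> chamber x T" "w \<in> open_segment a b" for a b
    proof -
      obtain u where u: "0 < u" "u < 1" "w = (1 - u) *\<^sub>R a + u *\<^sub>R b"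
        using ab by (auto simp: in_segment)
      have "tubes CARD('n) (valley x a) \<subseteq>
          tubes CARD('n) (\<lambda>q. (1 - u) * valley x a q + u * valley x b q)"
        by (rule tubes_convex_combination[of _ _ W']) (use ab u in \<open>auto simp: ch tube_set_def\<close>)
      also have "(\<lambda>q. (1 - u) * valley x a q + u * valley x b q) = valley x w"
        using u(3) valley_affine[of "1 - u" u x a b] by (simp add: fun_eq_iff)
      finally show ?thesis using w(1) ab by (auto simp: tube_set_def chamber_def)
    qed
    show "a \<in> chamber x T \<inter> tube_set x (tubes CARD('n) W)" using sub[OF a b w(2)] a by blast
    show "b \<in> chamber x T \<inter> tube_set x (tubes CARD('n) W)"
      using sub[OF b a] w(2) b by (simp add: open_segment_commute)
  qed blast
qed

lemma chamber_Int_chamber_face: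
  fixes x :: "real^'n::{finite,linorder}"
  assumes "size T = CARD('n)" "size T' = CARD('n)"
  shows "chamber x T \<inter> chamber x T' face_of chamber x T"
  using ex_strict_heap[of 1 T'] chamber_Int_tube_set_face[OF assms(1)] chamber_eq_tube_set[OF _ assms(2)]
  by metis

lemma tube_set_face:
  fixes x :: "real^'n::{finite,linorder}"
  assumes T: "size T = CARD('n)" and w: "w \<in> chamber x T"
  shows "tube_set x (tubes CARD('n) (valley x w)) face_of chamber x T"
proof -
  obtain W' where W': "strict_heap 1 T W'" using ex_strict_heap by blast
  have "tube_set x (tubes CARD('n) (valley x w)) \<subseteq> chamber x T"
    using w unfolding chamber_eq_tube_set[OF W' T] tube_set_def by blast
  then show ?thesis using chamber_Int_tube_set_face[OF T, of x "valley x w"] by (simp add: Int_absorb1)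
qed

text \<open>Faces of different chambers are compared inside the common face \<open>?C\<close> of the
  chambers: \<open>F\<close> and \<open>G\<close> each cut it in a face of \<open>?C\<close>, hence
  so does \<open>F \<inter> G\<close>, and faces of \<open>?C\<close> are faces of either
  chamber.\<close>

lemma chamber_faces_Int:
  fixes x :: "real^'n::{finite,linorder}"
  assumes T: "size T = CARD('n)" "size T' = CARD('n)"
    and F: "F face_of chamber x T" and G: "G face_of chamber x T'"
  shows "F \<inter> G face_of F"
proof -
  let ?C = "chamber x T \<inter> chamber x T'"
  have C: "?C face_of chamber x T" "?C face_of chamber x T'"
    using chamber_Int_chamber_face[OF T] chamber_Int_chamber_face[OF T(2,1)] by (auto simp: Int_commute)
  have sub: "F \<subseteq> chamber x T" "G \<subseteq> chamber x T'" using F G face_of_imp_subset by blast+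
  have "F \<inter> ?C face_of ?C"
    by (rule face_of_subset[OF face_of_Int[OF F C(1)]]) auto
  moreover have "G \<inter> ?C face_of ?C"
    by (rule face_of_subset[OF face_of_Int[OF G C(2)]]) auto
  ultimately have "(F \<inter> ?C) \<inter> (G \<inter> ?C) face_of ?C" by (rule face_of_Int)
  moreover have "(F \<inter> ?C) \<inter> (G \<inter> ?C) = F \<inter> G" using sub by blast
  ultimately have "F \<inter> G face_of chamber x T" using face_of_trans[OF _ C(1)] by simp
  then show ?thesis by (rule face_of_subset) (use sub in auto)
qed

definition chamber_faces :: "real^'n::{finite,linorder} \<Rightarrow> (real^'n::{finite,linorder}) set set" where
  "chamber_faces x = {F. \<exists>T\<in>plane_binary_trees CARD('n). F face_of chamber x T}"

lemma finite_plane_binary_trees: "finite (plane_binary_trees n)"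
proof (induction n rule: less_induct)
  case (less n)
  have "plane_binary_trees n \<subseteq> insert Leaf
     ((\<lambda>(l, r). Node l () r) ` ((\<Union>k<n. plane_binary_trees k) \<times> (\<Union>k<n. plane_binary_trees k)))"
  proof
    fix T assume T: "T \<in> plane_binary_trees n"
    show "T \<in> insert Leaf
     ((\<lambda>(l, r). Node l () r) ` ((\<Union>k<n. plane_binary_trees k) \<times> (\<Union>k<n. plane_binary_trees k)))"
      using T by (cases T) (auto simp: plane_binary_trees_def image_iff)
  qed
  then show ?case by (rule finite_subset) (use less in auto)
qed

lemma chamber_cover:
  fixes x :: "real^'n::{finite,linorder}"
  assumes "y \<in> Pi_polytope x"
  shows "\<exists>T\<in>plane_binary_trees CARD('n). y \<in> chamber x T"
  using ex_heap[of "CARD('n)" 1 "valley x y"] assms by (auto simp: plane_binary_trees_def chamber_def)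

lemma polyhedral_decomposition_chamber_faces:
  fixes x :: "real^'n::{finite,linorder}"
  shows "polyhedral_decomposition (chamber_faces x) (Pi_polytope x)"
  unfolding polyhedral_decomposition_def
proof (intro conjI ballI allI impI)
  have "chamber_faces x = (\<Union>T\<in>plane_binary_trees CARD('n). {F. F face_of chamber x T})"
    by (auto simp: chamber_faces_def)
  then show "finite (chamber_faces x)"
    using finite_plane_binary_trees finite_polytope_faces[OF polytope_chamber] by auto
next
  fix F assume "F \<in> chamber_faces x"
  then show "polytope F"
    using face_of_polytope_polytope[OF polytope_chamber] by (auto simp: chamber_faces_def)
next
  fix F G assume "F \<in> chamber_faces x" "G face_of F"
  then show "G \<in> chamber_faces x" by (auto simp: chamber_faces_def intro: face_of_trans)
next
  fix F G assume "F \<in> chamber_faces x" "G \<in> chamber_faces x"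
  then obtain T T' :: "unit tree" where "size T = CARD('n)" "size T' = CARD('n)"
    "F face_of chamber x T" "G face_of chamber x T'"
    unfolding chamber_faces_def plane_binary_trees_def by blast
  then show "F \<inter> G face_of F" "F \<inter> G face_of G"
    using chamber_faces_Int[of T T' F x G] chamber_faces_Int[of T' T G x F] by (auto simp: Int_commute)
next
  show "\<Union> (chamber_faces x) = Pi_polytope x"
  proof
    show "\<Union> (chamber_faces x) \<subseteq> Pi_polytope x"
      using chamber_subset_Pi by (auto simp: chamber_faces_def dest!: face_of_imp_subset)
    show "Pi_polytope x \<subseteq> \<Union> (chamber_faces x)"
    proof
      fix y assume "y \<in> Pi_polytope x"
      then obtain T where "T \<in> plane_binary_trees CARD('n)" "y \<in> chamber x T" using chamber_cover by blast
      moreover from this have "chamber x T \<in> chamber_faces x"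
        using face_of_refl[OF polytope_imp_convex[OF polytope_chamber]] by (auto simp: chamber_faces_def)
      ultimately show "y \<in> \<Union> (chamber_faces x)" by blast
    qed
  qed
qed

text \<open>A strictly heap ordered point of the first chamber lies in the second one too, and it
  determines its tree.\<close>

lemma chamber_subset_imp_eq:
  fixes x :: "real^'n::{finite,linorder}" and T T' :: "unit tree"
  assumes x: "\<And>i. 0 < x $ i" and T: "size T = CARD('n)" "size T' = CARD('n)"
    and sub: "chamber x T \<subseteq> chamber x T'"
  shows "T = T'"
proof -
  obtain y where y: "strict_point x y" "strict_heap 1 T (valley x y)"
    using ex_strict_heap_point[OF x T(1)] by blast
  then have "y \<in> chamber x T" by (auto simp: chamber_def strict_heap_imp_heap strict_point_imp_Pi)
  then have "y \<in> chamber x T'" using sub by blast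
  then show ?thesis using heap_unique[OF y(2)] T by (auto simp: chamber_def)
qed

lemma bij_betw_chamber:
  fixes x :: "real^'n::{finite,linorder}"
  assumes x: "\<And>i. 0 < x $ i"
  shows "bij_betw (chamber x) (plane_binary_trees CARD('n)) (maximal_faces (chamber_faces x))"
proof (rule bij_betw_imageI)
  show "inj_on (chamber x) (plane_binary_trees CARD('n))"
    by (rule inj_onI) (use chamber_subset_imp_eq[OF x] in \<open>auto simp: plane_binary_trees_def\<close>)
  have mem: "chamber x T \<in> chamber_faces x" if "T \<in> plane_binary_trees CARD('n)" for T
    using that face_of_refl[OF polytope_imp_convex[OF polytope_chamber]] by (auto simp: chamber_faces_def)
  show "chamber x ` plane_binary_trees CARD('n) = maximal_faces (chamber_faces x)"
  proof
    show "chamber x ` plane_binary_trees CARD('n) \<subseteq> maximal_faces (chamber_faces x)"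
    proof clarify
      fix T :: "unit tree" assume T: "T \<in> plane_binary_trees CARD('n)"
      have "chamber x T = F" if F: "F \<in> chamber_faces x" "chamber x T \<subseteq> F" for F
      proof -
        obtain T' where T': "T' \<in> plane_binary_trees CARD('n)" "F face_of chamber x T'"
          using F by (auto simp: chamber_faces_def)
        then have "F \<subseteq> chamber x T'" using face_of_imp_subset by blast
        moreover from this have "T = T'"
          using chamber_subset_imp_eq[OF x, of T T'] T T' F(2) by (auto simp: plane_binary_trees_def)
        ultimately show ?thesis using F(2) by blast
      qed
      then show "chamber x T \<in> maximal_faces (chamber_faces x)"
        using mem[OF T] by (auto simp: maximal_faces_def)
    qed
    show "maximal_faces (chamber_faces x) \<subseteq> chamber x ` plane_binary_trees CARD('n)"
    proof
      fix F assume F: "F \<in> maximal_faces (chamber_faces x)"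
      then obtain T where T: "T \<in> plane_binary_trees CARD('n)" "F face_of chamber x T"
        by (auto simp: maximal_faces_def chamber_faces_def)
      then have "F = chamber x T"
        using F mem[OF T(1)] face_of_imp_subset unfolding maximal_faces_def by blast
      then show "F \<in> chamber x ` plane_binary_trees CARD('n)" using T by blast
    qed
  qed
qed

section \<open>Interior faces\<close>

lemma open_strict_points: "open {y. strict_point (x :: real^'n::{finite,linorder}) y}"
proof -
  have "{y. strict_point x y} = (\<Inter>k\<in>{..<CARD('n)}. {y. 0 < y $ idx k} \<inter> {y. 0 < valley x y (Suc k)})"
    by (auto simp: strict_point_def)
  also have "open \<dots>"
    unfolding valley_def
    by (intro open_INT ballI open_Int open_Collect_less continuous_intros) auto
  finally show ?thesis .
qed

lemma strict_point_iff_rel_interior: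
  fixes x :: "real^'n::{finite,linorder}"
  assumes x: "\<And>i. 0 < x $ i"
  shows "strict_point x y \<longleftrightarrow> y \<in> rel_interior (Pi_polytope x)"
proof
  assume "strict_point x y"
  then have "y \<in> interior (Pi_polytope x)"
    by (intro interiorI[OF open_strict_points, of _ x]) (auto simp: strict_point_imp_Pi)
  then show "y \<in> rel_interior (Pi_polytope x)" using interior_subset_rel_interior by blast
next
  assume y: "y \<in> rel_interior (Pi_polytope x)"
  obtain z where z: "strict_point x z" using ex_strict_point[OF x] by blast
  have conv: "convex (Pi_polytope x)" using polytope_Pi polytope_imp_convex by blast
  have ne: "Pi_polytope x \<noteq> {}" using strict_point_imp_Pi[OF z] by blast
  then obtain e where "1 < e" "(1 - e) *\<^sub>R z + e *\<^sub>R y \<in> Pi_polytope x"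
    using y strict_point_imp_Pi[OF z] unfolding convex_rel_interior_iff[OF conv ne] by blast
  then show "strict_point x y" using strict_point_if_extendable strict_point_imp_Pi z by blast
qed

lemma eventually_extend_pos:
  assumes "0 < (b :: real)"
  shows "eventually (\<lambda>e. 0 < (1 - e) * a + e * b) (at_right 1)"
proof -
  have "((\<lambda>e. (1 - e) * a + e * b) \<longlongrightarrow> (1 - 1) * a + 1 * b) (at_right 1)"
    by (intro tendsto_intros)
  then show ?thesis by (rule order_tendstoD) (use assms in simp)
qed

text \<open>By the prolongation criterion, every segment of the set ending in \<open>w\<close> has
  to extend a little beyond it. Inequalities strict at \<open>w\<close> survive a short
  prolongation. An order relation that is an equality at \<open>w\<close> is one on the whole set,
  because range minimality then holds in both directions, and equalities persist along the
  line.\<close>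

lemma rel_interior_tube_set:
  fixes x :: "real^'n::{finite,linorder}"
  assumes w: "strict_point x w"
  shows "w \<in> rel_interior (tube_set x (tubes CARD('n) (valley x w)))"
proof -
  let ?G = "tube_set x (tubes CARD('n) (valley x w))"
  have wG: "w \<in> ?G" using strict_point_imp_Pi[OF w] by (simp add: tube_set_def)
  then have ne: "?G \<noteq> {}" by blast
  have "\<exists>e>1. (1 - e) *\<^sub>R y + e *\<^sub>R w \<in> ?G" if y: "y \<in> ?G" for y
  proof -
    let ?p = "\<lambda>e. (1 - e) *\<^sub>R y + e *\<^sub>R w"
    have vp: "valley x (?p e) k = (1 - e) * valley x y k + e * valley x w k" for e k
      by (simp add: valley_affine)
    have cone: "valley x y \<in> heap_cone CARD('n) (valley x w)"
      using y unfolding cone_iff_tubes by (simp add: tube_set_def)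
    have "eventually (\<lambda>e. \<forall>k\<in>{..<CARD('n)}. 0 < ?p e $ idx k) (at_right 1)"
      using w by (intro eventually_ball_finite ballI)
        (auto simp: strict_point_def intro!: eventually_extend_pos)
    moreover have "eventually (\<lambda>e. \<forall>k\<in>{..<CARD('n)}. 0 < valley x (?p e) (Suc k)) (at_right 1)"
      using w unfolding vp by (intro eventually_ball_finite ballI)
        (auto simp: strict_point_def intro!: eventually_extend_pos)
    moreover have "eventually (\<lambda>e. \<forall>(a, b)\<in>{(a, b)\<in>{1..CARD('n)} \<times> {1..CARD('n)}.
        range_min (valley x w) a b}. valley x (?p e) a \<le> valley x (?p e) b) (at_right 1)"
    proof (intro eventually_ball_finite ballI, goal_cases)
      case 1
      show ?case by (rule finite_subset[of _ "{1..CARD('n)} \<times> {1..CARD('n)}"]) auto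
    next
      case (2 ab)
      obtain a b where ab: "ab = (a, b)" "a \<in> {1..CARD('n)}" "b \<in> {1..CARD('n)}"
        "range_min (valley x w) a b" using 2 by auto
      have le: "valley x w a \<le> valley x w b" using ab(4) by (auto simp: range_min_def)
      show ?case
      proof (cases "valley x w a = valley x w b")
        case True
        then have "range_min (valley x w) b a"
          using ab(4) unfolding range_min_def by (metis max.commute min.commute)
        then have "valley x y a = valley x y b"
          using cone ab by (auto simp: heap_cone_def intro: antisym)
        then show ?thesis using True by (simp add: ab vp)
      next
        case False
        then have "eventually (\<lambda>e. 0 < (1 - e) * (valley x y b - valley x y a) +
            e * (valley x w b - valley x w a)) (at_right 1)"
          by (intro eventually_extend_pos) (use le in simp)
        then show ?thesis by (rule eventually_mono) (unfold ab prod.case vp, simp add: algebra_simps)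
      qed
    qed
    moreover have "eventually (\<lambda>e :: real. 1 < e) (at_right 1)"
      by (simp add: eventually_at_right_less)
    ultimately have "eventually (\<lambda>e. 1 < e \<and> strict_point x (?p e) \<and>
        valley x (?p e) \<in> heap_cone CARD('n) (valley x w)) (at_right 1)"
      by eventually_elim (auto simp: strict_point_def heap_cone_def)
    then obtain e where e: "1 < e" "strict_point x (?p e)" "valley x (?p e) \<in> heap_cone CARD('n) (valley x w)"
      by (rule eventually_happens'[rotated, elim_format]) auto
    then have "?p e \<in> ?G"
      unfolding cone_iff_tubes by (auto simp: tube_set_def strict_point_imp_Pi)
    then show ?thesis using e(1) by blast
  qed
  then show ?thesis unfolding convex_rel_interior_iff[OF convex_tube_set ne] by blast
qed

definition noncrossing_sets :: "nat \<Rightarrow> (nat \<times> nat) set set" where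
  "noncrossing_sets n = {D. D \<subseteq> diag_pairs n \<and> non_crossing D}"

lemma tubes_noncrossing: "tubes n W \<in> noncrossing_sets n"
  using non_crossing_tubes by (auto simp: noncrossing_sets_def tubes_def)

lemma rel_frontier_Pi: "F \<subseteq> Pi_polytope x \<Longrightarrow>
  F \<subseteq> rel_frontier (Pi_polytope x) \<longleftrightarrow> F \<inter> rel_interior (Pi_polytope x) = {}"
  using polytope_imp_closed[OF polytope_Pi, of x] by (auto simp: rel_frontier_def)

lemma tube_set_interior_face:
  fixes x :: "real^'n::{finite,linorder}"
  assumes x: "\<And>i. 0 < x $ i" and D: "D \<in> noncrossing_sets CARD('n)"
  shows "tube_set x D \<in> interior_faces (chamber_faces x) (Pi_polytope x)"
proof -
  obtain y where y: "strict_point x y" "tubes CARD('n) (valley x y) = D"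
    using ex_strict_tube_point[OF x] D by (auto simp: noncrossing_sets_def)
  obtain T where T: "T \<in> plane_binary_trees CARD('n)" "y \<in> chamber x T"
    using chamber_cover[OF strict_point_imp_Pi[OF y(1)]] by blast
  then have "tube_set x D face_of chamber x T"
    using tube_set_face y(2) by (auto simp: plane_binary_trees_def)
  moreover have "\<not> tube_set x D \<subseteq> rel_frontier (Pi_polytope x)"
    using y strict_point_imp_Pi[OF y(1)] strict_point_iff_rel_interior[OF x]
    by (subst rel_frontier_Pi) (auto simp: tube_set_def)
  ultimately show ?thesis using T(1) by (auto simp: interior_faces_def chamber_faces_def)
qed

text \<open>A strict point of \<open>F\<close> forces a relative interior point \<open>w\<close> of
  \<open>F\<close> to be strict, so \<open>w\<close> is also in the relative interior of the tube
  set given by its own tubes. Two faces of a chamber with a common relative interior point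
  coincide.\<close>

lemma interior_face_eq_tube_set:
  fixes x :: "real^'n::{finite,linorder}"
  assumes x: "\<And>i. 0 < x $ i" and F: "F \<in> interior_faces (chamber_faces x) (Pi_polytope x)"
  shows "\<exists>D\<in>noncrossing_sets CARD('n). F = tube_set x D"
proof -
  obtain T where T: "T \<in> plane_binary_trees CARD('n)" "F face_of chamber x T"
    and nF: "\<not> F \<subseteq> rel_frontier (Pi_polytope x)"
    using F by (auto simp: interior_faces_def chamber_faces_def)
  have FT: "F \<subseteq> chamber x T" using T(2) face_of_imp_subset by blast
  then have FPi: "F \<subseteq> Pi_polytope x" using chamber_subset_Pi by blast
  have convF: "convex F" using T(2) face_of_imp_convex polytope_imp_convex polytope_chamber by blast
  obtain y where y: "y \<in> F" "strict_point x y"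
    using nF rel_frontier_Pi[OF FPi] strict_point_iff_rel_interior[OF x] by blast
  then have neF: "F \<noteq> {}" by blast
  then obtain w where w: "w \<in> rel_interior F" using rel_interior_eq_empty[OF convF] by blast
  obtain e where e: "1 < e" "(1 - e) *\<^sub>R y + e *\<^sub>R w \<in> F"
    using w y(1) unfolding convex_rel_interior_iff[OF convF neF] by blast
  have strict: "strict_point x w"
    by (rule strict_point_if_extendable[OF _ y(2) e(1)]) (use e y FPi in auto)
  have "w \<in> chamber x T" using w rel_interior_subset FT by blast
  then have "tube_set x (tubes CARD('n) (valley x w)) face_of chamber x T"
    using tube_set_face T(1) by (auto simp: plane_binary_trees_def)
  then have "F = tube_set x (tubes CARD('n) (valley x w))"
    using face_of_eq[OF T(2)] w rel_interior_tube_set[OF strict] by blast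
  then show ?thesis using tubes_noncrossing by blast
qed

text \<open>Some point has exactly the tubes in \<open>D\<close>; its membership in the other set
  already forces the inclusion.\<close>

lemma tube_set_subset_iff:
  fixes x :: "real^'n::{finite,linorder}"
  assumes x: "\<And>i. 0 < x $ i" and D: "D \<in> noncrossing_sets CARD('n)"
  shows "tube_set x D \<subseteq> tube_set x D' \<longleftrightarrow> D \<subseteq> D'"
proof
  assume sub: "tube_set x D \<subseteq> tube_set x D'"
  obtain y where y: "strict_point x y" "tubes CARD('n) (valley x y) = D"
    using ex_strict_tube_point[OF x] D by (auto simp: noncrossing_sets_def)
  then have "y \<in> tube_set x D" using strict_point_imp_Pi by (auto simp: tube_set_def)
  then show "D \<subseteq> D'" using sub y(2) by (auto simp: tube_set_def)
qed (auto simp: tube_set_def)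

section \<open>Diagonals of a convex polygon\<close>

lemma orient_rotate: "orient b c a = orient a b c"
  by (simp add: orient_def algebra_simps)

lemma orient_swap: "orient b a c = - orient a b c"
  by (simp add: orient_def algebra_simps)

lemma orient_self [simp]: "orient a a b = 0" "orient a b a = 0" "orient a b b = 0"
  by (auto simp: orient_def)

lemma orient_affine:
  "orient a b ((1 - t) *\<^sub>R c + t *\<^sub>R d) = (1 - t) * orient a b c + t * orient a b d"
  by (simp add: orient_def algebra_simps)

text \<open>\<open>orient\<close> is twice the signed area of a triangle. The signs say that
  \<open>c\<close> and \<open>d\<close> are on opposite sides of the line through \<open>a\<close>
  and \<open>b\<close>, and \<open>a\<close> and \<open>b\<close> on opposite sides of the line
  through \<open>c\<close> and \<open>d\<close>.\<close>

lemma open_segments_meet: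
  assumes "orient a c b > 0" "orient a b d > 0" "orient a c d > 0" "orient c b d > 0"
  shows "open_segment a b \<inter> open_segment c d \<noteq> {}"
proof -
  define fa where "fa = orient a c d"
  define fb where "fb = orient c b d"
  define gc where "gc = orient a c b"
  define gd where "gd = orient a b d"
  have pos: "0 < fa" "0 < fb" "0 < gc" "0 < gd" using assms by (auto simp: fa_def fb_def gc_def gd_def)
  \<comment> \<open>Both sums are twice the area of the quadrilateral with vertices
    \<open>a\<close>, \<open>c\<close>, \<open>b\<close>, \<open>d\<close>, split along one or the
    other diagonal.\<close>
  have sum: "fa + fb = gc + gd"
    by (simp add: fa_def fb_def gc_def gd_def orient_def algebra_simps)
  define S where "S = fa + fb"
  have S: "0 < S" using pos by (simp add: S_def)
  \<comment> \<open>The affine function \<open>orient c d\<close> is \<open>fa\<close> at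
    \<open>a\<close> and \<open>- fb\<close> at \<open>b\<close>, so it vanishes at parameter
    \<open>t\<close>; likewise \<open>orient a b\<close> vanishes at \<open>u\<close>.\<close>
  define t where "t = fa / S"
  define u where "u = gc / S"
  have tu: "0 < t" "t < 1" "0 < u" "u < 1"
    using pos S sum by (auto simp: t_def u_def S_def)
  have key: "fb * a $ i + fa * b $ i = gd * c $ i + gc * d $ i" if "i = 1 \<or> i = 2" for i
    using that by (auto simp: fa_def fb_def gc_def gd_def orient_def algebra_simps)
  have S1: "S * (1 - t) = fb" "S * t = fa" using S by (auto simp: t_def S_def field_simps)
  have S2: "S * (1 - u) = gd" "S * u = gc" using S sum by (auto simp: u_def S_def field_simps)
  have "(1 - t) *\<^sub>R a + t *\<^sub>R b = (1 - u) *\<^sub>R c + u *\<^sub>R d"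
  proof (rule vec_eq_iff[THEN iffD2], rule allI)
    fix i :: 2
    have i: "i = 1 \<or> i = 2" using exhaust_2 by blast
    have "S * ((1 - t) * a $ i + t * b $ i) = S * ((1 - u) * c $ i + u * d $ i)"
      using key[OF i] S1 S2 by (simp add: distrib_left flip: mult.assoc)
    then show "((1 - t) *\<^sub>R a + t *\<^sub>R b) $ i = ((1 - u) *\<^sub>R c + u *\<^sub>R d) $ i"
      using S by simp
  qed
  moreover have "a \<noteq> b" "c \<noteq> d" using assms by (auto simp: orient_def)
  ultimately have "(1 - t) *\<^sub>R a + t *\<^sub>R b \<in> open_segment a b"
    "(1 - t) *\<^sub>R a + t *\<^sub>R b \<in> open_segment c d"
    using tu by (auto simp: in_segment)
  then show ?thesis by blast
qed

definition diag :: "(nat \<Rightarrow> real^2) \<Rightarrow> nat \<times> nat \<Rightarrow> (real^2) set" where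
  "diag p = (\<lambda>(i, j). closed_segment (p i) (p j))"

text \<open>Two equal vertices and any third one would form a triangle of area
  \<open>0\<close>.\<close>

lemma convex_polygon_inj:
  assumes p: "convex_polygon N p" and ij: "i < j" "j < N"
  shows "p i \<noteq> p j"
proof
  assume eq: "p i = p j"
  obtain k where k: "k < N" "k \<noteq> i" "k \<noteq> j"
  proof -
    have "3 \<le> N" using p by (simp add: convex_polygon_def)
    then have "\<not> {..<N} \<subseteq> {i, j}" using card_mono[of "{i, j}" "{..<N}"] ij by auto
    then show ?thesis using that by auto
  qed
  have pos: "0 < orient (p a) (p b) (p c)" if "a < b" "b < c" "c < N" for a b c
    using p that by (auto simp: convex_polygon_def)
  consider "k < i" | "i < k" "k < j" | "j < k" using k by linarith
  then show False
    using pos[of k i j] pos[of i k j] pos[of i j k] eq ij k by cases auto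
qed

lemma orient_polygon:
  assumes p: "convex_polygon N p" and ij: "i < j" "j < N" and m: "m < N"
  shows "i < m \<Longrightarrow> m < j \<Longrightarrow> orient (p i) (p j) (p m) < 0"
    "m < i \<or> j < m \<Longrightarrow> 0 < orient (p i) (p j) (p m)"
proof -
  have pos: "0 < orient (p a) (p b) (p c)" if "a < b" "b < c" "c < N" for a b c
    using p that by (auto simp: convex_polygon_def)
  show "i < m \<Longrightarrow> m < j \<Longrightarrow> orient (p i) (p j) (p m) < 0"
    using pos[of i m j] ij by (metis neg_less_0_iff_less orient_rotate orient_swap)
  show "m < i \<or> j < m \<Longrightarrow> 0 < orient (p i) (p j) (p m)"
    using pos[of m i j] pos[of i j m] ij m by (metis orient_rotate)
qed

text \<open>Diagonals with interleaved ends meet by convex position. Otherwise both ends of one lie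
  on the same closed side of the line through the other, not both on the line, so its open segment
  avoids that line.\<close>

lemma diag_disjoint_iff:
  assumes p: "convex_polygon (n + 2) p"
    and ij: "(i, j) \<in> diag_pairs n" and kl: "(k, l) \<in> diag_pairs n" and ne: "(i, j) \<noteq> (k, l)"
  shows "rel_interior (diag p (i, j)) \<inter> rel_interior (diag p (k, l)) = {} \<longleftrightarrow>
    \<not> (i < k \<and> k < j \<and> j < l) \<and> \<not> (k < i \<and> i < l \<and> l < j)"
proof -
  have b: "i < j" "j < n + 2" "k < l" "l < n + 2" using ij kl by (auto simp: diag_pairs_def)
  have ri: "rel_interior (diag p (i, j)) = open_segment (p i) (p j)"
    "rel_interior (diag p (k, l)) = open_segment (p k) (p l)"
    using convex_polygon_inj[OF p] b by (auto simp: diag_def rel_interior_closed_segment)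
  have pos: "0 < orient (p a) (p b) (p c)" if "a < b" "b < c" "c < n + 2" for a b c
    using p that by (auto simp: convex_polygon_def)
  have meet: "open_segment (p i) (p j) \<inter> open_segment (p k) (p l) \<noteq> {}"
    if "i < k" "k < j" "j < l" "l < n + 2" for i j k l
    by (rule open_segments_meet) (use that in \<open>auto intro!: pos\<close>)
  show ?thesis
    unfolding ri
  proof
    assume "open_segment (p i) (p j) \<inter> open_segment (p k) (p l) = {}"
    then show "\<not> (i < k \<and> k < j \<and> j < l) \<and> \<not> (k < i \<and> i < l \<and> l < j)"
      using meet[of i k j l] meet[of k i l j] b by (auto simp: Int_commute)
  next
    assume nc: "\<not> (i < k \<and> k < j \<and> j < l) \<and> \<not> (k < i \<and> i < l \<and> l < j)"
    let ?f = "orient (p i) (p j)"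
    note f = orient_polygon[OF p b(1,2)]
    have zero: "?f (p m) = 0" if "m = i \<or> m = j" for m using that by auto
    have sgn: "?f (p k) \<le> 0 \<and> ?f (p l) \<le> 0 \<and> (?f (p k) < 0 \<or> ?f (p l) < 0) \<or>
      0 \<le> ?f (p k) \<and> 0 \<le> ?f (p l) \<and> (0 < ?f (p k) \<or> 0 < ?f (p l))"
    proof (cases "i < k \<and> k < j \<or> i < l \<and> l < j")
      case True
      then have "i \<le> k \<and> k \<le> j \<and> i \<le> l \<and> l \<le> j" using nc b by linarith
      moreover have "?f (p m) \<le> 0" if "m < n + 2" "i \<le> m" "m \<le> j" for m
        using f(1)[of m] zero[of m] that by (metis le_less order_refl)
      ultimately have "?f (p k) \<le> 0" "?f (p l) \<le> 0" using b by auto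
      moreover have "k < n + 2" using b by simp
      then have "?f (p k) < 0 \<or> ?f (p l) < 0" using True f(1)[of k] f(1)[of l] b(4) by blast
      ultimately show ?thesis by blast
    next
      case False
      have ge: "0 \<le> ?f (p m)" if "m < n + 2" "\<not> (i < m \<and> m < j)" for m
        using f(2)[of m] zero that by (metis le_less linorder_neqE_nat order_refl)
      have "\<not> ((k = i \<or> k = j) \<and> (l = i \<or> l = j))" using ne b by auto
      then have "0 < ?f (p k) \<or> 0 < ?f (p l)"
        using False f(2)[of k] f(2)[of l] b by (cases "k = i \<or> k = j"; cases "l = i \<or> l = j") auto
      then show ?thesis using ge[of k] ge[of l] False b by auto
    qed
    have "?f w \<noteq> 0" if w: "w \<in> open_segment (p k) (p l)" for w
    proof -
      obtain u where u: "0 < u" "u < 1" "w = (1 - u) *\<^sub>R p k + u *\<^sub>R p l"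
        using w by (auto simp: in_segment)
      have fw: "?f w = (1 - u) * ?f (p k) + u * ?f (p l)" unfolding u(3) orient_affine ..
      from sgn show ?thesis
      proof (elim disjE conjE)
        assume "?f (p k) < 0" "?f (p l) \<le> 0"
        then have "(1 - u) * ?f (p k) < 0" "u * ?f (p l) \<le> 0"
          using u by (auto simp: mult_less_0_iff mult_le_0_iff)
        then show ?thesis using fw by linarith
      next
        assume "?f (p k) \<le> 0" "?f (p l) < 0"
        then have "(1 - u) * ?f (p k) \<le> 0" "u * ?f (p l) < 0"
          using u by (auto simp: mult_less_0_iff mult_le_0_iff)
        then show ?thesis using fw by linarith
      next
        assume "0 < ?f (p k)" "0 \<le> ?f (p l)"
        then have "0 < (1 - u) * ?f (p k)" "0 \<le> u * ?f (p l)" using u by auto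
        then show ?thesis using fw by linarith
      next
        assume "0 \<le> ?f (p k)" "0 < ?f (p l)"
        then have "0 \<le> (1 - u) * ?f (p k)" "0 < u * ?f (p l)" using u by auto
        then show ?thesis using fw by linarith
      qed
    qed
    moreover have "?f w = 0" if w: "w \<in> open_segment (p i) (p j)" for w
      using w by (auto simp: in_segment orient_affine)
    ultimately show "open_segment (p i) (p j) \<inter> open_segment (p k) (p l) = {}" by blast
  qed
qed

lemma inj_on_diag:
  assumes p: "convex_polygon (n + 2) p"
  shows "inj_on (diag p) (diag_pairs n)"
proof (rule inj_onI, clarify)
  fix i j k l
  assume ij: "(i, j) \<in> diag_pairs n" and kl: "(k, l) \<in> diag_pairs n" and eq: "diag p (i, j) = diag p (k, l)"
  have b: "i < j" "j < n + 2" "k < l" "l < n + 2" using ij kl by (auto simp: diag_pairs_def)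
  have inj: "p a = p b \<Longrightarrow> a < n + 2 \<Longrightarrow> b < n + 2 \<Longrightarrow> a = b" for a b
    using convex_polygon_inj[OF p, of a b] convex_polygon_inj[OF p, of b a] by (metis linorder_neqE_nat)
  have "{p i, p j} = {p k, p l}" using eq by (simp add: diag_def closed_segment_eq)
  then show "i = k \<and> j = l" using b inj[of i k] inj[of i l] inj[of j k] inj[of j l] by (auto simp: doubleton_eq_iff)
qed

lemma diagonals_eq: "diagonals (n + 2) p = diag p ` diag_pairs n"
proof -
  have "diag_pairs n = {(i, j). i < j \<and> j < n + 2 \<and> j \<noteq> Suc i \<and> \<not> (i = 0 \<and> j = n + 2 - 1)}"
    by (auto simp: diag_pairs_def)
  then show ?thesis unfolding diagonals_def diag_def by (auto simp only:)
qed

lemma polygonal_decompositions_eq: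
  assumes p: "convex_polygon (n + 2) p"
  shows "polygonal_decompositions (n + 2) p = (image (diag p)) ` noncrossing_sets n"
proof -
  have iff: "(\<forall>c\<in>diag p ` D. \<forall>d\<in>diag p ` D. c \<noteq> d \<longrightarrow> rel_interior c \<inter> rel_interior d = {}) \<longleftrightarrow>
      non_crossing D" if D: "D \<subseteq> diag_pairs n" for D
  proof -
    have ne: "diag p d \<noteq> diag p d' \<longleftrightarrow> d \<noteq> d'" if "d \<in> D" "d' \<in> D" for d d'
      using inj_on_eq_iff[OF inj_on_diag[OF p], of d d'] D that by blast
    let ?cr = "\<lambda>d d'. fst d < fst d' \<and> fst d' < snd d \<and> snd d < snd d'"
    have "(diag p d \<noteq> diag p d' \<longrightarrow> rel_interior (diag p d) \<inter> rel_interior (diag p d') = {}) \<longleftrightarrow>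
        \<not> ?cr d d' \<and> \<not> ?cr d' d" if d: "d \<in> D" "d' \<in> D" for d d'
    proof (cases "d = d'")
      case False
      have "(fst d, snd d) \<in> diag_pairs n" "(fst d', snd d') \<in> diag_pairs n" using d D by auto
      from diag_disjoint_iff[OF p this] False show ?thesis
        unfolding prod.collapse using ne[OF d] by (simp add: conj_commute conj_left_commute)
    qed simp
    then have "(\<forall>c\<in>diag p ` D. \<forall>d\<in>diag p ` D. c \<noteq> d \<longrightarrow> rel_interior c \<inter> rel_interior d = {}) \<longleftrightarrow>
      (\<forall>d\<in>D. \<forall>d'\<in>D. \<not> ?cr d d' \<and> \<not> ?cr d' d)"
      unfolding ball_simps by (intro ball_cong refl)
    also have "\<dots> \<longleftrightarrow> (\<forall>d\<in>D. \<forall>d'\<in>D. \<not> ?cr d d')" by blast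
    also have "\<dots> \<longleftrightarrow> non_crossing D"
      unfolding non_crossing_def by (simp add: case_prod_beta)
    finally show ?thesis .
  qed
  show ?thesis
  proof
    show "polygonal_decompositions (n + 2) p \<subseteq> (image (diag p)) ` noncrossing_sets n"
    proof
      fix E assume E: "E \<in> polygonal_decompositions (n + 2) p"
      then obtain D where "D \<subseteq> diag_pairs n" "E = diag p ` D"
        unfolding polygonal_decompositions_def diagonals_eq by (auto simp: subset_image_iff)
      then show "E \<in> (image (diag p)) ` noncrossing_sets n"
        using E iff[of D] by (auto simp: polygonal_decompositions_def noncrossing_sets_def)
    qed
    show "(image (diag p)) ` noncrossing_sets n \<subseteq> polygonal_decompositions (n + 2) p"
    proof clarify
      fix D assume "D \<in> noncrossing_sets n"
      then have D: "D \<subseteq> diag_pairs n" "non_crossing D" by (simp_all add: noncrossing_sets_def)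
      show "diag p ` D \<in> polygonal_decompositions (n + 2) p"
        unfolding polygonal_decompositions_def diagonals_eq mem_Collect_eq
        by (rule conjI[OF image_mono[OF D(1)] iff[OF D(1), THEN iffD2, OF D(2)]])
    qed
  qed
qed

text \<open>Both posets are order isomorphic images of the same index set \<open>I\<close>, so one
  parametrization is composed with the inverse of the other; \<open>map_option\<close> fixes the
  adjoined element.\<close>

lemma poset_iso_adjoin_top:
  assumes A: "A = h ` I" "\<And>D E. D \<in> I \<Longrightarrow> E \<in> I \<Longrightarrow> h D \<subseteq> h E \<longleftrightarrow> D \<subseteq> E"
    and B: "B = k ` I" "\<And>D E. D \<in> I \<Longrightarrow> E \<in> I \<Longrightarrow> k D \<subseteq> k E \<longleftrightarrow> D \<subseteq> E"
  shows "poset_iso (adjoin_top A) (dual_le incl_le) (adjoin_top B) (dual_le incl_le)"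
proof -
  define g where "g F = k (the_inv_into I h F)" for F
  have injh: "inj_on h I" by (rule inj_onI) (metis A(2) subset_antisym subset_refl)
  have injk: "inj_on k I" by (rule inj_onI) (metis B(2) subset_antisym subset_refl)
  have g: "g (h D) = k D" if "D \<in> I" for D by (simp add: g_def the_inv_into_f_f[OF injh that])
  have bij: "bij_betw (map_option g) (adjoin_top A) (adjoin_top B)"
  proof (rule bij_betw_imageI)
    have injg: "F = G" if FG: "F \<in> A" "G \<in> A" "g F = g G" for F G
    proof -
      obtain D E where "D \<in> I" "F = h D" "E \<in> I" "G = h E" using FG(1,2) A(1) by blast
      then show ?thesis using FG(3) g inj_onD[OF injk, of D E] by simp
    qed
    show "inj_on (map_option g) (adjoin_top A)"
    proof (rule inj_onI)
      fix a b assume "a \<in> adjoin_top A" "b \<in> adjoin_top A" "map_option g a = map_option g b"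
      then show "a = b" using injg by (cases a; cases b) (auto simp: adjoin_top_def)
    qed
    have "g ` A = B" unfolding A(1) B(1) image_image by (rule image_cong) (auto simp: g)
    then show "map_option g ` adjoin_top A = adjoin_top B"
      by (simp add: adjoin_top_def image_image flip: \<open>g ` A = B\<close>)
  qed
  moreover have "dual_le incl_le a b \<longleftrightarrow> dual_le incl_le (map_option g a) (map_option g b)"
    if ab: "a \<in> adjoin_top A" "b \<in> adjoin_top A" for a b
  proof -
    have "F \<subseteq> G \<longleftrightarrow> g F \<subseteq> g G" if FG: "F \<in> A" "G \<in> A" for F G
    proof -
      obtain D E where "D \<in> I" "F = h D" "E \<in> I" "G = h E" using FG A(1) by blast
      then show ?thesis using g A(2) B(2) by simp
    qed
    then show ?thesis using ab by (cases a; cases b) (auto simp: adjoin_top_def dual_le_def)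
  qed
  ultimately show ?thesis unfolding poset_iso_def by blast
qed

lemma poset_iso_interior_faces:
  fixes x :: "real^'n::{finite,linorder}"
  assumes x: "\<And>i. 0 < x $ i" and p: "convex_polygon (CARD('n) + 2) p"
  shows "poset_iso (adjoin_top (interior_faces (chamber_faces x) (Pi_polytope x))) (dual_le incl_le)
    (dec (CARD('n) + 2) p) (dual_le incl_le)"
  unfolding dec_def
proof (rule poset_iso_adjoin_top)
  show "interior_faces (chamber_faces x) (Pi_polytope x) = tube_set x ` noncrossing_sets CARD('n)"
    using tube_set_interior_face[OF x] interior_face_eq_tube_set[OF x] by blast
  show "tube_set x D \<subseteq> tube_set x E \<longleftrightarrow> D \<subseteq> E" if "D \<in> noncrossing_sets CARD('n)" for D E
    by (rule tube_set_subset_iff[OF x that])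
  show "polygonal_decompositions (CARD('n) + 2) p = image (diag p) ` noncrossing_sets CARD('n)"
    by (rule polygonal_decompositions_eq[OF p])
  show "diag p ` D \<subseteq> diag p ` E \<longleftrightarrow> D \<subseteq> E"
    if "D \<in> noncrossing_sets CARD('n)" "E \<in> noncrossing_sets CARD('n)" for D E
    using inj_on_image_subset_iff[OF inj_on_diag[OF p]] that by (auto simp: noncrossing_sets_def)
qed

section \<open>Left chains and the sequence \<open>k(T)\<close>\<close>

text \<open>
  The vertices of \<open>T\<close> are labelled \<open>m + 1, \<dots>, m + size T\<close>. The \<open>k\<close>-th list is the chain of
  left edges that ends, read downwards, in the \<open>k\<close>-th leaf from the left, where \<open>k\<close> starts
  at \<open>0\<close>; it is empty if that leaf is a right child.
\<close>

fun left_chains :: "nat \<Rightarrow> 'a tree \<Rightarrow> nat list list" where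
  "left_chains m Leaf = [[]]"
| "left_chains m (Node l a r) =
     (Suc (m + size l) # hd (left_chains m l)) # tl (left_chains m l) @ left_chains (Suc (m + size l)) r"

lemma length_chains [simp]: "length (left_chains m T) = Suc (size T)"
  by (induction T arbitrary: m) auto

lemma chains_not_Nil [simp]: "left_chains m T \<noteq> []"
  using length_chains[of m T] by fastforce

text \<open>The rightmost leaf is a right child. So only the first \<open>size T\<close> of the
  \<open>size T + 1\<close> chains can be nonempty, which matches the number of entries of
  \<open>k_seq T\<close>.\<close>

lemma last_chains: "T \<noteq> Leaf \<Longrightarrow> last (left_chains m T) = []"
proof (induction T arbitrary: m)
  case (Node l a r)
  then show ?case by (cases "r = Leaf") auto
qed simp

lemma concat_hd_tl: "xs \<noteq> [] \<Longrightarrow> hd xs @ concat (tl xs) = concat xs"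
  by (cases xs) auto

lemma concat_chains_Node:
  "concat (left_chains m (Node l a r)) =
    Suc (m + size l) # concat (left_chains m l) @ concat (left_chains (Suc (m + size l)) r)"
  by (simp flip: concat_hd_tl[of "left_chains m l"])

lemma set_concat_chains: "set (concat (left_chains m T)) = {Suc m..m + size T}"
proof (induction T arbitrary: m)
  case (Node l a r)
  show ?case
    unfolding concat_chains_Node set_append list.set(2) Node by auto
qed simp

lemma distinct_concat_chains: "distinct (concat (left_chains m T))"
proof (induction T arbitrary: m)
  case (Node l a r)
  then show ?case
    unfolding concat_chains_Node distinct.simps distinct_append set_append set_concat_chains by auto
qed simp

lemma chain_greater: "k \<le> size T \<Longrightarrow> q \<in> set (left_chains m T ! k) \<Longrightarrow> m + k < q"
proof (induction T arbitrary: m k)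
  case (Node l a r)
  show ?case
  proof (cases k)
    case 0
    then show ?thesis using Node.IH(1)[of 0 m] Node.prems by (auto simp: hd_conv_nth)
  next
    case (Suc k')
    show ?thesis
    proof (cases "k \<le> size l")
      case True
      then show ?thesis using Node.IH(1)[of k m] Node.prems Suc by (auto simp: nth_append nth_tl)
    next
      case False
      then show ?thesis
        using Node.IH(2)[of "k - Suc (size l)" "Suc (m + size l)"] Node.prems Suc
        by (auto simp: nth_append)
    qed
  qed
qed simp

lemma hd_chains_eq_Nil: "hd (left_chains m T) = [] \<longleftrightarrow> T = Leaf"
  by (cases T) auto

text \<open>If leaf \<open>k\<close> is a left child, its parent is its inorder successor and the
  lowest vertex of the chain.\<close>

lemma last_chain: "k \<le> size T \<Longrightarrow> left_chains m T ! k \<noteq> [] \<Longrightarrow> last (left_chains m T ! k) = Suc (m + k)"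
proof (induction T arbitrary: m k)
  case (Node l a r)
  show ?case
  proof (cases k)
    case 0
    then show ?thesis
      using Node.IH(1)[of 0 m] Node.prems hd_chains_eq_Nil[of m l] by (auto simp: hd_conv_nth)
  next
    case (Suc k')
    show ?thesis
    proof (cases "k \<le> size l")
      case True
      then show ?thesis using Node.IH(1)[of k m] Node.prems Suc by (auto simp: nth_append nth_tl)
    next
      case False
      then show ?thesis
        using Node.IH(2)[of "k - Suc (size l)" "Suc (m + size l)"] Node.prems Suc
        by (auto simp: nth_append)
    qed
  qed
qed simp

lemma chain_decreasing: "c \<in> set (left_chains m T) \<Longrightarrow> sorted_wrt (>) c"
proof (induction T arbitrary: m c)
  case (Node l a r)
  have hd: "hd (left_chains m l) \<in> set (left_chains m l)" by simp
  have "q < Suc (m + size l)" if "q \<in> set (hd (left_chains m l))" for q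
  proof -
    have "q \<in> set (concat (left_chains m l))" using that hd by auto
    then show ?thesis unfolding set_concat_chains by simp
  qed
  moreover have "set (tl (left_chains m l)) \<subseteq> set (left_chains m l)"
    by (cases "left_chains m l") auto
  ultimately show ?case using Node Node.IH(1)[OF hd] by auto
qed simp

text \<open>Chains are read downwards, so \<open>v\<close> is the parent and \<open>u\<close> its
  left child.\<close>

definition adjacent :: "nat list \<Rightarrow> nat \<Rightarrow> nat \<Rightarrow> bool" where
  "adjacent c u v \<longleftrightarrow> (\<exists>us ws. c = us @ v # u # ws)"

lemma adjacent_Nil [simp]: "\<not> adjacent [] u v"
  by (simp add: adjacent_def)

lemma adjacent_Cons: "adjacent (p # c) u v \<longleftrightarrow> (v = p \<and> c \<noteq> [] \<and> u = hd c) \<or> adjacent c u v"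
proof
  assume "adjacent (p # c) u v"
  then obtain us ws where "p # c = us @ v # u # ws" by (auto simp: adjacent_def)
  then show "(v = p \<and> c \<noteq> [] \<and> u = hd c) \<or> adjacent c u v"
    by (cases us) (auto simp: adjacent_def)
next
  assume "(v = p \<and> c \<noteq> [] \<and> u = hd c) \<or> adjacent c u v"
  then show "adjacent (p # c) u v"
  proof
    assume "v = p \<and> c \<noteq> [] \<and> u = hd c"
    then show ?thesis unfolding adjacent_def by (intro exI[of _ "[]"] exI[of _ "tl c"]) simp
  next
    assume "adjacent c u v"
    then show ?thesis unfolding adjacent_def by (metis append_Cons)
  qed
qed

lemma left_child_of_Node:
  "left_child_of (Node l p r) u v \<longleftrightarrow>
    (v = p \<and> (\<exists>a b. l = Node a u b)) \<or> left_child_of l u v \<or> left_child_of r u v"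
  unfolding left_child_of_def by auto

lemma left_endpoint_Node:
  "left_endpoint (Node l p r) i \<longleftrightarrow> (i = p \<and> l = Leaf) \<or> left_endpoint l i \<or> left_endpoint r i"
  unfolding left_endpoint_def by auto

lemma set_chains_Node: "set (left_chains m (Node l a r)) =
    insert (Suc (m + size l) # hd (left_chains m l)) (set (tl (left_chains m l)) \<union> set (left_chains (Suc (m + size l)) r))"
  by simp

lemma set_chains_hd_tl: "set (left_chains m l) = insert (hd (left_chains m l)) (set (tl (left_chains m l)))"
  by (metis chains_not_Nil list.collapse list.set(2))

lemma left_child_of_iff_adjacent:
  "left_child_of (label_from (Suc m) T) u v \<longleftrightarrow> (\<exists>c\<in>set (left_chains m T). adjacent c u v)"
proof (induction T arbitrary: m)
  case Leaf
  show ?case by (simp add: left_child_of_def)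
next
  case (Node l a r)
  have "(\<exists>a b. label_from (Suc m) l = Node a u b) \<longleftrightarrow> hd (left_chains m l) \<noteq> [] \<and> u = hd (hd (left_chains m l))"
    by (cases l) auto
  then show ?case
    using Node[of m] Node.IH(2)[of "Suc (m + size l)"]
    unfolding set_chains_Node set_chains_hd_tl[of m l]
    by (auto simp: left_child_of_Node adjacent_Cons)
qed

lemma left_endpoint_iff_chain:
  "left_endpoint (label_from (Suc m) T) i \<longleftrightarrow> (\<exists>c\<in>set (left_chains m T). c \<noteq> [] \<and> last c = i)"
proof (induction T arbitrary: m)
  case Leaf
  show ?case by (simp add: left_endpoint_def)
next
  case (Node l a r)
  have "label_from (Suc m) l = Leaf \<longleftrightarrow> hd (left_chains m l) = []"
    by (cases l) auto
  then show ?case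
    using Node[of m] Node.IH(2)[of "Suc (m + size l)"]
    unfolding set_chains_Node set_chains_hd_tl[of m l]
    by (auto simp: left_endpoint_Node)
qed

lemma distinct_concat_unique:
  assumes "distinct (concat cs)" "c \<in> set cs" "c' \<in> set cs" "u \<in> set c" "u \<in> set c'"
  shows "c = c'"
  using assms by (induction cs) auto

text \<open>Each label occurs only once in all chains together, so the only possible left parent of
  a vertex is its predecessor in its own chain, and the head of a chain has none.\<close>

lemma left_parent_in_chain:
  assumes c: "c \<in> set (left_chains m T)" and j: "j < length c"
    and lc: "left_child_of (label_from (Suc m) T) (c ! j) v"
  shows "0 < j \<and> v = c ! (j - 1)"
proof -
  define u where "u = c ! j"
  have u: "u \<in> set c" using j by (simp add: u_def)
  obtain c' us ws where c': "c' \<in> set (left_chains m T)" "c' = us @ v # u # ws"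
    using lc unfolding left_child_of_iff_adjacent adjacent_def u_def[symmetric] by blast
  have "c = c'"
    by (rule distinct_concat_unique[OF distinct_concat_chains c c'(1) u]) (simp add: c')
  have "distinct c" using distinct_concat_chains[of m T] c by (auto simp: distinct_concat_iff)
  moreover have "c ! Suc (length us) = u" "Suc (length us) < length c" "c ! length us = v"
    using c'(2) \<open>c = c'\<close> by (auto simp: nth_append)
  ultimately have "j = Suc (length us)" using j nth_eq_iff_index_eq unfolding u_def by metis
  then show ?thesis using \<open>c ! length us = v\<close> by simp
qed

text \<open>The chain read upwards is an admissible list. Every admissible list climbs this chain
  from its lowest vertex, because left parents are unique, and so is not longer. Labels start at
  \<open>1\<close> and chains at \<open>0\<close>, hence the shift.\<close>

lemma k_entry_eq_length:
  fixes T :: "unit tree"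
  assumes i: "i < size T"
  shows "k_entry T (Suc i) = length (left_chains 0 T ! i)"
proof -
  define c where "c = left_chains 0 T ! i"
  have c: "c \<in> set (left_chains 0 T)" using i by (simp add: c_def)
  let ?L = "bs_label T"
  have L: "?L = label_from (Suc 0) T" by (simp add: bs_label_def)
  show ?thesis
  proof (cases "c = []")
    case True
    have "\<not> left_endpoint ?L (Suc i)"
    proof
      assume "left_endpoint ?L (Suc i)"
      then obtain c' where c': "c' \<in> set (left_chains 0 T)" "c' \<noteq> []" "last c' = Suc i"
        unfolding L left_endpoint_iff_chain by blast
      then obtain k where k: "k \<le> size T" "c' = left_chains 0 T ! k"
        by (auto simp: in_set_conv_nth less_Suc_eq_le)
      then have "k = i" using last_chain[of k T 0] c' by simp
      then show False using k c' True by (simp add: c_def)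
    qed
    then show ?thesis using True by (simp add: k_entry_def c_def)
  next
    case False
    have last: "last c = Suc i" using last_chain[of i T 0] i False by (simp add: c_def)
    then have "left_endpoint ?L (Suc i)"
      unfolding L left_endpoint_iff_chain using c False by blast
    moreover have "(GREATEST r. \<exists>js. length js = r \<and> js \<noteq> [] \<and> hd js = Suc i \<and> sorted_wrt (<) js \<and>
              set js \<subseteq> {1..size T} \<and> (\<forall>h. Suc h < r \<longrightarrow> left_child_of ?L (js ! h) (js ! Suc h))) =
        length c"
    proof (rule Greatest_equality)
      have "set c \<subseteq> {1..size T}" using c set_concat_chains[of 0 T] by auto
      moreover have "left_child_of ?L (rev c ! h) (rev c ! Suc h)" if h: "Suc h < length c" for h
        unfolding L left_child_of_iff_adjacent
      proof (rule bexI[OF _ c])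
        define q where "q = length c - Suc (Suc h)"
        have "c = take q c @ c ! q # c ! Suc q # drop (Suc (Suc q)) c"
          using h by (simp add: q_def Cons_nth_drop_Suc)
        then have "adjacent c (c ! Suc q) (c ! q)" unfolding adjacent_def by blast
        moreover have "rev c ! h = c ! Suc q" "rev c ! Suc h = c ! q"
          using h by (auto simp: rev_nth q_def Suc_diff_Suc)
        ultimately show "adjacent c (rev c ! h) (rev c ! Suc h)" by simp
      qed
      moreover have "sorted_wrt (<) (rev c)" using chain_decreasing[OF c] by (simp add: sorted_wrt_rev)
      ultimately show "\<exists>js. length js = length c \<and> js \<noteq> [] \<and> hd js = Suc i \<and> sorted_wrt (<) js \<and>
          set js \<subseteq> {1..size T} \<and>
          (\<forall>h. Suc h < length c \<longrightarrow> left_child_of ?L (js ! h) (js ! Suc h))"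
        using False last by (intro exI[of _ "rev c"]) (auto simp: hd_rev)
    next
      fix r
      assume "\<exists>js. length js = r \<and> js \<noteq> [] \<and> hd js = Suc i \<and> sorted_wrt (<) js \<and>
          set js \<subseteq> {1..size T} \<and> (\<forall>h. Suc h < r \<longrightarrow> left_child_of ?L (js ! h) (js ! Suc h))"
      then obtain js where js: "length js = r" "js \<noteq> []" "hd js = Suc i"
        "\<And>h. Suc h < r \<Longrightarrow> left_child_of ?L (js ! h) (js ! Suc h)" by blast
      have "h < length c \<and> js ! h = c ! (length c - Suc h)" if "h < r" for h
        using that
      proof (induction h)
        case 0
        then show ?case using js False last by (simp add: hd_conv_nth last_conv_nth)
      next
        case (Suc h)
        then have "left_child_of (label_from (Suc 0) T) (c ! (length c - Suc h)) (js ! Suc h)"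
          using js(4)[of h] by (simp add: L)
        from left_parent_in_chain[OF c _ this] Suc show ?case by auto
      qed
      then show "r \<le> length c" using not_less_iff_gr_or_eq by (meson not_less order_less_irrefl)
    qed
    ultimately show ?thesis by (simp add: k_entry_def c_def)
  qed
qed

lemma k_seq_nth: "i < size T \<Longrightarrow> k_seq T ! i = length (left_chains 0 T ! i)"
  by (simp add: k_seq_def k_entry_eq_length del: upt_Suc)

lemma length_k_seq [simp]: "length (k_seq T) = size T"
  by (simp add: k_seq_def del: upt_Suc)

section \<open>Chambers as chains of inequalities\<close>

definition chains_sorted :: "(nat \<Rightarrow> real) \<Rightarrow> (nat \<Rightarrow> real) \<Rightarrow> nat \<Rightarrow> nat list list \<Rightarrow> bool" where
  "chains_sorted V X m cs \<longleftrightarrow>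
     (\<forall>k<length cs. sorted (V (m + k) # map V (cs ! k) @ [V (m + k) + X (m + k)]))"

lemma all_less_add: "(\<forall>k<a + b. Q k) \<longleftrightarrow> (\<forall>k<a. Q k) \<and> (\<forall>k<(b :: nat). Q (a + k))"
  (is "?L \<longleftrightarrow> ?R")
proof
  assume R: ?R
  show ?L
  proof (intro allI impI)
    fix k assume "k < a + b"
    then show "Q k" using R spec[OF conjunct2[OF R], of "k - a"] by (cases "k < a") auto
  qed
qed auto

lemma chains_sorted_append:
  "chains_sorted V X m (cs @ ds) \<longleftrightarrow> chains_sorted V X m cs \<and> chains_sorted V X (m + length cs) ds"
  unfolding chains_sorted_def length_append all_less_add by (simp add: nth_append add.assoc)

lemma chains_sorted_Cons:
  "chains_sorted V X m (c # cs) \<longleftrightarrow>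
     sorted (V m # map V c @ [V m + X m]) \<and> chains_sorted V X (Suc m) cs"
  using chains_sorted_append[of V X m "[c]" cs] by (simp add: chains_sorted_def)

text \<open>
  For a subtree, the lower bound of the first chain is the height \<open>b\<close> of the parent of its root
  instead of the height of the preceding valley; this makes the characterization inductive.
\<close>

definition sorted_above :: "(nat \<Rightarrow> real) \<Rightarrow> (nat \<Rightarrow> real) \<Rightarrow> real \<Rightarrow> nat \<Rightarrow> 'a tree \<Rightarrow> bool" where
  "sorted_above V X b m T \<longleftrightarrow> sorted (b # map V (hd (left_chains m T)) @ [V m + X m]) \<and>
     chains_sorted V X (Suc m) (tl (left_chains m T))"

lemma chains_sorted_iff_above: "chains_sorted V X m (left_chains m T) \<longleftrightarrow> sorted_above V X (V m) m T"
  by (cases "left_chains m T") (auto simp: sorted_above_def chains_sorted_Cons)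

text \<open>The root heads the first chain. Below it this chain continues as the first chain of
  \<open>l\<close>, now bounded by the height of the root. The first chain of \<open>r\<close>
  follows the valley of the root, so its lower bound in \<open>chains_sorted\<close> is that height
  already.\<close>

lemma sorted_above_Node:
  "sorted_above V X b m (Node l a r) \<longleftrightarrow> b \<le> V (Suc (m + size l)) \<and>
     sorted_above V X (V (Suc (m + size l))) m l \<and>
     sorted_above V X (V (Suc (m + size l))) (Suc (m + size l)) r"
proof -
  let ?p = "Suc (m + size l)"
  have "sorted_above V X b m (Node l a r) \<longleftrightarrow>
      sorted (b # V ?p # map V (hd (left_chains m l)) @ [V m + X m]) \<and>
      chains_sorted V X (Suc m) (tl (left_chains m l) @ left_chains ?p r)"
    by (simp add: sorted_above_def)
  also have "\<dots> \<longleftrightarrow> (b \<le> V ?p \<and> sorted (V ?p # map V (hd (left_chains m l)) @ [V m + X m])) \<and>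
      chains_sorted V X (Suc m) (tl (left_chains m l)) \<and> chains_sorted V X ?p (left_chains ?p r)"
    unfolding sorted2 chains_sorted_append by simp
  also have "\<dots> \<longleftrightarrow> b \<le> V ?p \<and> sorted_above V X (V ?p) m l \<and> sorted_above V X (V ?p) ?p r"
    unfolding chains_sorted_iff_above sorted_above_def[of V X "V ?p" m l] by blast
  finally show ?thesis .
qed

text \<open>Along left edges the chains compare heights directly, along right edges through their
  lower bounds; together this is heap order. Their upper bounds say that no valley is higher than
  the peak before it, that is, that descents are nonnegative. The last conjunct is what remains for
  a leaf.\<close>

lemma sorted_above_iff_heap:
  assumes X: "\<And>k. 0 \<le> X k"
  shows "sorted_above V X b m T \<longleftrightarrow> iheap (Suc m) T V \<and> (\<forall>q\<in>{Suc m..m + size T}. b \<le> V q) \<and>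
    (\<forall>k\<in>{m..<m + size T}. V (Suc k) \<le> V k + X k) \<and> b \<le> V m + X m"
proof (induction T arbitrary: m b)
  case Leaf
  show ?case by (simp add: sorted_above_def chains_sorted_def)
next
  case (Node l a r)
  let ?p = "Suc (m + size l)"
  let ?T = "Node l a r"
  note IH = Node.IH(1)[of "V ?p" m] Node.IH(2)[of "V ?p" ?p]
  show ?case
  proof
    assume "sorted_above V X b m ?T"
    then have b: "b \<le> V ?p" and l: "iheap (Suc m) l V" "\<And>q. q \<in> {Suc m..m + size l} \<Longrightarrow> V ?p \<le> V q"
        "\<And>k. k \<in> {m..<m + size l} \<Longrightarrow> V (Suc k) \<le> V k + X k" "V ?p \<le> V m + X m"
      and r: "iheap (Suc ?p) r V" "\<And>q. q \<in> {Suc ?p..?p + size r} \<Longrightarrow> V ?p \<le> V q"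
        "\<And>k. k \<in> {?p..<?p + size r} \<Longrightarrow> V (Suc k) \<le> V k + X k"
      unfolding sorted_above_Node IH by blast+
    have min: "V ?p \<le> V q" if "q \<in> {Suc m..m + size ?T}" for q
      using l(2)[of q] r(2)[of q] that by (cases q ?p rule: linorder_cases) auto
    have "V (Suc k) \<le> V k + X k" if k: "k \<in> {m..<m + size ?T}" for k
    proof (cases "k = m + size l")
      \<comment> \<open>The move into the valley of the root: if \<open>l\<close> is nonempty,
        valley \<open>k\<close> belongs to it and is at least as high as the root; if not, the bound
        is the one attached to the leaf \<open>l\<close>.\<close>
      case True
      show ?thesis
      proof (cases "1 \<le> size l")
        case True
        then have "V ?p \<le> V k" using l(2)[of k] \<open>k = m + size l\<close> by simp
        then show ?thesis using X[of k] \<open>k = m + size l\<close> by simp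
      next
        case False
        then have "size l = 0" by linarith
        then show ?thesis using l(4) \<open>k = m + size l\<close> by simp
      qed
    next
      case False
      then show ?thesis using l(3)[of k] r(3)[of k] k by (cases "k < ?p") auto
    qed
    then show "iheap (Suc m) ?T V \<and> (\<forall>q\<in>{Suc m..m + size ?T}. b \<le> V q) \<and>
        (\<forall>k\<in>{m..<m + size ?T}. V (Suc k) \<le> V k + X k) \<and> b \<le> V m + X m"
      using b l r min by (auto intro: order_trans)
  next
    assume H: "iheap (Suc m) ?T V \<and> (\<forall>q\<in>{Suc m..m + size ?T}. b \<le> V q) \<and>
        (\<forall>k\<in>{m..<m + size ?T}. V (Suc k) \<le> V k + X k) \<and> b \<le> V m + X m"
    then have min: "V ?p \<le> V q" if "q \<in> {Suc m..m + size ?T}" for q using that by auto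
    have "V (Suc m) \<le> V m + X m" using H by auto
    then have "V ?p \<le> V m + X m" using min[of "Suc m"] by simp
    then show "sorted_above V X b m ?T"
      unfolding sorted_above_Node IH using H min X[of ?p] by auto
  qed
qed

lemma chamber_iff_chains:
  fixes x :: "real^'n::{finite,linorder}"
  assumes x: "\<And>i. 0 < x $ i" and T: "size T = CARD('n)"
  shows "y \<in> chamber x T \<longleftrightarrow> (\<forall>k<CARD('n).
    sorted (valley x y k # map (valley x y) (left_chains 0 T ! k) @ [valley x y k + x $ idx k]))"
proof -
  let ?V = "valley x y"
  \<comment> \<open>The padding by \<open>0\<close> makes the condition for the empty last chain,
    \<open>k = CARD('n)\<close>, true.\<close>
  define X where "X k = (if k < CARD('n) then x $ idx k else 0)" for k
  have X: "0 \<le> X k" for k using x[of "idx k"] by (simp add: X_def less_imp_le)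
  have "T \<noteq> Leaf" using T by auto
  then have last: "left_chains 0 T ! CARD('n) = []" using last_chains[of T 0] T by (simp add: last_conv_nth)
  have "y \<in> chamber x T \<longleftrightarrow> sorted_above ?V X (?V 0) 0 T"
    unfolding sorted_above_iff_heap[OF X] using X[of 0] T
    by (auto simp: chamber_def Pi_polytope_iff X_def valley_Suc Ball_def Suc_le_eq gr0_conv_Suc)
  also have "\<dots> \<longleftrightarrow> chains_sorted ?V X 0 (left_chains 0 T)" by (simp only: chains_sorted_iff_above)
  also have "\<dots> \<longleftrightarrow> (\<forall>k<CARD('n). sorted (?V k # map ?V (left_chains 0 T ! k) @ [?V k + x $ idx k]))"
    unfolding chains_sorted_def length_chains T All_less_Suc using last by (simp add: X_def)
  finally show ?thesis .
qed

section \<open>Integral equivalence with products of simplices\<close>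

definition vec_of :: "(nat \<Rightarrow> real) \<Rightarrow> real^'n::{finite,linorder}" where
  "vec_of g = (\<chi> i. g (the_inv_into {..<CARD('n)} idx i))"

lemma vec_of_idx [simp]:
  "k < CARD('n) \<Longrightarrow> (vec_of g :: real^'n::{finite,linorder}) $ idx k = g k"
  by (simp add: vec_of_def the_inv_into_f_f[OF bij_betw_imp_inj_on[OF bij_idx]])

lemma vec_eq_idx:
  "(u :: real^'n::{finite,linorder}) = v \<longleftrightarrow> (\<forall>k<CARD('n). u $ idx k = v $ idx k)"
  unfolding vec_eq_iff by (rule all_idx)

text \<open>
  In the difference of two valley heights the coordinates of \<open>y\<close> enter through a sum over an
  interval. If the right end points of the intervals are \<open>1, \<dots>, n\<close> in some order, these sums
  form a unimodular map.
\<close>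

definition interval_list :: "nat \<Rightarrow> (nat \<times> nat) list \<Rightarrow> bool" where
  "interval_list n P \<longleftrightarrow> length P = n \<and> set (map snd P) = {1..n} \<and> (\<forall>(i, j)\<in>set P. i < j)"

text \<open>Valleys \<open>i < j\<close> differ by the moves with zero based numbers
  \<open>i\<close> to \<open>j - 1\<close>, hence the half-open interval; descents enter with a
  minus sign.\<close>

definition interval_map ::
  "(nat \<times> nat) list \<Rightarrow> real^'n::{finite,linorder} \<Rightarrow> real^'n::{finite,linorder}" where
  "interval_map P y = vec_of (\<lambda>k. - (\<Sum>m\<in>{fst (P ! k)..<snd (P ! k)}. y $ idx m))"

lemma linear_interval_map: "linear (interval_map P)"
  by (rule linearI)
     (simp_all add: vec_eq_idx interval_map_def sum.distrib sum_distrib_left)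

text \<open>The system is solved in the order of the right end points: the sum with right end point
  \<open>Suc m\<close> contains \<open>y $ idx m\<close> once and otherwise only earlier
  coordinates. \<open>A = {0}\<close> gives injectivity, \<open>A = \<int>\<close> integrality of
  the inverse.\<close>

lemma interval_map_reflects_subgroup:
  fixes y :: "real^'n::{finite,linorder}"
  assumes P: "interval_list CARD('n) P"
    and A: "0 \<in> A" "\<And>a. a \<in> A \<Longrightarrow> - a \<in> A" "\<And>a b. a \<in> A \<Longrightarrow> b \<in> A \<Longrightarrow> a + b \<in> A"
    and y: "\<And>i. interval_map P y $ i \<in> A"
  shows "y $ i \<in> A"
proof -
  have sumA: "sum f S \<in> A" if "\<And>m. m \<in> S \<Longrightarrow> f m \<in> A" for f :: "nat \<Rightarrow> real" and S
    using that by (induction S rule: infinite_finite_induct) (auto simp: A)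
  have "y $ idx m \<in> A" if "m < CARD('n)" for m
    using that
  proof (induction m rule: less_induct)
    case (less m)
    have "Suc m \<in> set (map snd P)" using P less.prems by (auto simp: interval_list_def)
    then obtain k where "k < length (map snd P)" "map snd P ! k = Suc m"
      unfolding in_set_conv_nth by blast
    then have k: "k < CARD('n)" "snd (P ! k) = Suc m" using P by (auto simp: interval_list_def)
    have "P ! k \<in> set P" using P k by (auto simp: interval_list_def)
    moreover have "\<forall>p\<in>set P. fst p < snd p" using P by (auto simp: interval_list_def)
    ultimately have "fst (P ! k) < Suc m" unfolding k(2)[symmetric] by blast
    then have "fst (P ! k) \<le> m" by simp
    then have "(\<Sum>j\<in>{fst (P ! k)..<snd (P ! k)}. y $ idx j) =
        (\<Sum>j\<in>{fst (P ! k)..<m}. y $ idx j) + y $ idx m"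
      using k by simp
    then have eq: "y $ idx m = - (interval_map P y $ idx k + (\<Sum>j\<in>{fst (P ! k)..<m}. y $ idx j))"
      using k by (simp add: interval_map_def)
    show ?case unfolding eq by (intro A(2,3) y sumA less.IH) (use less.prems in auto)
  qed
  then have "\<forall>i. y $ i \<in> A" by (subst all_idx) simp
  then show ?thesis by blast
qed

lemma inj_interval_map:
  assumes "interval_list CARD('n) P"
  shows "inj (interval_map P :: real^'n::{finite,linorder} \<Rightarrow> _)"
  unfolding linear_injective_0[OF linear_interval_map]
  using interval_map_reflects_subgroup[OF assms, of "{0}"] by (auto simp: vec_eq_iff)

lemma bij_interval_map:
  assumes "interval_list CARD('n) P"
  shows "bij (interval_map P :: real^'n::{finite,linorder} \<Rightarrow> _)"
  using inj_interval_map[OF assms] linear_injective_imp_surjective[OF linear_interval_map]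
  by (auto simp: bij_def)

lemma interval_map_int_iff:
  fixes y :: "real^'n::{finite,linorder}"
  assumes P: "interval_list CARD('n) P"
  shows "interval_map P y \<in> int_points \<longleftrightarrow> y \<in> int_points"
proof
  assume "interval_map P y \<in> int_points"
  then show "y \<in> int_points"
    using interval_map_reflects_subgroup[OF P, of \<int> y] by (auto simp: int_points_def)
next
  assume y: "y \<in> int_points"
  show "interval_map P y \<in> int_points"
    unfolding int_points_def mem_Collect_eq
    by (subst all_idx) (use y in \<open>auto simp: interval_map_def int_points_def intro!: Ints_minus Ints_sum\<close>)
qed

definition chain_pairs :: "'a tree \<Rightarrow> (nat \<times> nat) list" where
  "chain_pairs T = concat (map (\<lambda>i. map (Pair i) (left_chains 0 T ! i)) [0..<size T])"

lemma concat_left_chains: "T \<noteq> Leaf \<Longrightarrow> concat (map ((!) (left_chains 0 T)) [0..<size T]) = concat (left_chains 0 T)"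
proof -
  assume "T \<noteq> Leaf"
  then have "left_chains 0 T ! size T = []" using last_chains[of T 0] by (simp add: last_conv_nth)
  moreover have "concat (left_chains 0 T) = concat (map ((!) (left_chains 0 T)) [0..<Suc (size T)])"
    using map_nth[of "left_chains 0 T"] by simp
  ultimately show ?thesis by simp
qed

lemma interval_list_chain_pairs:
  assumes "T \<noteq> Leaf"
  shows "interval_list (size T) (chain_pairs T)"
proof -
  have snd: "map snd (chain_pairs T) = concat (left_chains 0 T)"
    unfolding concat_left_chains[OF assms, symmetric] chain_pairs_def map_concat
    by (simp add: comp_def)
  have "length (chain_pairs T) = length (concat (left_chains 0 T))" using snd by (metis length_map)
  also have "\<dots> = size T"
    using distinct_card[OF distinct_concat_chains[of 0 T]] by (simp only: set_concat_chains) simp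
  finally have "length (chain_pairs T) = size T" .
  moreover have "i < j" if "(i, j) \<in> set (chain_pairs T)" for i j
    using that chain_greater[of i T j 0] by (auto simp: chain_pairs_def)
  ultimately show ?thesis
    unfolding interval_list_def snd set_concat_chains by auto
qed

text \<open>With this translation \<open>y\<close> is sent to the value of
  \<open>interval_map\<close> at \<open>y - x\<close>, whose entries are the valley differences
  along the chains.\<close>

definition chain_shift :: "real^'n::{finite,linorder} \<Rightarrow> 'a tree \<Rightarrow> real^'n::{finite,linorder}" where
  "chain_shift x T = - interval_map (chain_pairs T) x"

lemma valley_diff:
  assumes "i \<le> j"
  shows "valley x y j - valley x y i = (\<Sum>m\<in>{i..<j}. x $ idx m) - (\<Sum>m\<in>{i..<j}. y $ idx m)"
  using assms sum_diff_nat_ivl[of 0 i j "\<lambda>m. x $ idx m - y $ idx m"]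
  by (simp add: valley_def atLeast0LessThan sum_subtractf)

lemma coords_chain_map:
  fixes x y :: "real^'n::{finite,linorder}"
  assumes T: "size T = CARD('n)"
  shows "coords (interval_map (chain_pairs T) y + chain_shift x T) =
    concat (map (\<lambda>i. map (\<lambda>j. valley x y j - valley x y i) (left_chains 0 T ! i)) [0..<CARD('n)])"
proof -
  have "T \<noteq> Leaf" using T by auto
  then have P: "interval_list CARD('n) (chain_pairs T)" using interval_list_chain_pairs[of T] T by simp
  have "coords (interval_map (chain_pairs T) y + chain_shift x T) =
      map (\<lambda>(i, j). valley x y j - valley x y i) (chain_pairs T)"
  proof (rule nth_equalityI)
    show "length (coords (interval_map (chain_pairs T) y + chain_shift x T)) =
      length (map (\<lambda>(i, j). valley x y j - valley x y i) (chain_pairs T))"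
      using P by (simp add: interval_list_def)
  next
    fix k assume "k < length (coords (interval_map (chain_pairs T) y + chain_shift x T))"
    then have k: "k < CARD('n)" by simp
    obtain i j where ij: "chain_pairs T ! k = (i, j)" by force
    have "chain_pairs T ! k \<in> set (chain_pairs T)" using P k by (simp add: interval_list_def)
    then have "i < j" using P ij by (auto simp: interval_list_def)
    then show "coords (interval_map (chain_pairs T) y + chain_shift x T) ! k =
      map (\<lambda>(i, j). valley x y j - valley x y i) (chain_pairs T) ! k"
      using k P ij by (simp add: coords_nth interval_map_def chain_shift_def valley_diff interval_list_def)
  qed
  then show ?thesis by (simp add: chain_pairs_def map_concat comp_def T)
qed

text \<open>Lengths determine how a list splits into blocks, so the existential quantifier over
  blocks is settled by any one decomposition with the right lengths.\<close>

lemma simplex_product_iff: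
  fixes x v :: "real^'n::{finite,linorder}"
  assumes v: "coords v = concat tss" and len: "length tss = CARD('n)"
    and ks: "\<And>i. i < CARD('n) \<Longrightarrow> length (tss ! i) = ks ! i"
  shows "v \<in> simplex_product ks x \<longleftrightarrow> (\<forall>i<CARD('n). sorted (0 # tss ! i @ [x $ idx i]))"
proof
  assume "v \<in> simplex_product ks x"
  then obtain tss' where tss': "length tss' = CARD('n)" "coords v = concat tss'"
    "\<forall>i<CARD('n). tss' ! i \<in> order_simplex (ks ! i) (coords x ! i)"
    by (auto simp: simplex_product_def)
  have "\<forall>(a, b)\<in>set (zip tss' tss). length a = length b"
    using tss' ks len by (auto simp: set_zip order_simplex_def)
  then have "tss' = tss" using concat_eq_concat_iff[of tss' tss] tss' v len by simp
  then show "\<forall>i<CARD('n). sorted (0 # tss ! i @ [x $ idx i])"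
    using tss'(3) by (simp add: order_simplex_def coords_nth)
next
  assume "\<forall>i<CARD('n). sorted (0 # tss ! i @ [x $ idx i])"
  then show "v \<in> simplex_product ks x"
    unfolding simplex_product_def using v len ks
    by (intro CollectI exI[of _ tss]) (simp add: order_simplex_def coords_nth)
qed

lemma chain_map_mem_iff:
  fixes x y :: "real^'n::{finite,linorder}"
  assumes x: "\<And>i. 0 < x $ i" and T: "size T = CARD('n)"
  shows "interval_map (chain_pairs T) y + chain_shift x T \<in> simplex_product (k_seq T) x \<longleftrightarrow> y \<in> chamber x T"
proof -
  let ?V = "valley x y"
  let ?tss = "map (\<lambda>i. map (\<lambda>j. ?V j - ?V i) (left_chains 0 T ! i)) [0..<CARD('n)]"
  have shift: "sorted (0 # map (\<lambda>j. ?V j - ?V i) c @ [X]) \<longleftrightarrow> sorted (?V i # map ?V c @ [?V i + X])" for i c X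
  proof -
    have "0 # map (\<lambda>j. ?V j - ?V i) c @ [X] = map (\<lambda>z. z - ?V i) (?V i # map ?V c @ [?V i + X])"
      by simp
    then show ?thesis by (simp only: sorted_map) simp
  qed
  have "interval_map (chain_pairs T) y + chain_shift x T \<in> simplex_product (k_seq T) x \<longleftrightarrow>
      (\<forall>i<CARD('n). sorted (0 # ?tss ! i @ [x $ idx i]))"
    by (rule simplex_product_iff[OF coords_chain_map[OF T]]) (use T in \<open>simp_all add: k_seq_nth\<close>)
  also have "\<dots> \<longleftrightarrow> y \<in> chamber x T"
    unfolding chamber_iff_chains[OF x T] by (simp add: shift del: sorted_wrt.simps)
  finally show ?thesis .
qed

lemma bij_betw_chain_map:
  fixes x :: "real^'n::{finite,linorder}"
  assumes x: "\<And>i. 0 < x $ i" and T: "size T = CARD('n)"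
  shows "bij_betw (\<lambda>y. interval_map (chain_pairs T) y + chain_shift x T)
    (chamber x T) (simplex_product (k_seq T) x)"
proof (rule bij_betw_imageI)
  have "T \<noteq> Leaf" using T by auto
  then have P: "interval_list CARD('n) (chain_pairs T)" using interval_list_chain_pairs[of T] T by simp
  show "inj_on (\<lambda>y. interval_map (chain_pairs T) y + chain_shift x T) (chamber x T)"
    using inj_interval_map[OF P] by (auto simp: inj_on_def)
  show "(\<lambda>y. interval_map (chain_pairs T) y + chain_shift x T) ` chamber x T = simplex_product (k_seq T) x"
  proof
    show "(\<lambda>y. interval_map (chain_pairs T) y + chain_shift x T) ` chamber x T \<subseteq> simplex_product (k_seq T) x"
      using chain_map_mem_iff[OF x T] by blast
    show "simplex_product (k_seq T) x \<subseteq> (\<lambda>y. interval_map (chain_pairs T) y + chain_shift x T) ` chamber x T"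
    proof
      fix v assume v: "v \<in> simplex_product (k_seq T) x"
      obtain y where "interval_map (chain_pairs T) y = v - chain_shift x T"
        using bij_is_surj[OF bij_interval_map[OF P]] by (metis surjD)
      then have y: "v = interval_map (chain_pairs T) y + chain_shift x T" by simp
      then show "v \<in> (\<lambda>y. interval_map (chain_pairs T) y + chain_shift x T) ` chamber x T"
        using v chain_map_mem_iff[OF x T] by blast
    qed
  qed
qed

section \<open>Affine hulls and affine images\<close>

lemma open_strict_heap_points: "open {y. strict_heap m T (valley x y)}"
proof (induction T arbitrary: m)
  case (Node l a r)
  let ?p = "m + size l"
  have "{y. strict_heap m (Node l a r) (valley x y)} = {y. strict_heap m l (valley x y)} \<inter>
      ({y. strict_heap (Suc ?p) r (valley x y)} \<inter>
       (\<Inter>q\<in>{m..<m + size (Node l a r)} - {?p}. {y. valley x y ?p < valley x y q}))"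
    by auto
  moreover have "open (\<Inter>q\<in>{m..<m + size (Node l a r)} - {?p}. {y. valley x y ?p < valley x y q})"
    unfolding valley_def
    by (intro open_INT ballI open_Collect_less continuous_intros) auto
  ultimately show ?case using Node by (simp only: open_Int)
qed simp

text \<open>The strict, strictly heap ordered points form a nonempty open subset.\<close>

lemma affine_hull_chamber:
  fixes x :: "real^'n::{finite,linorder}"
  assumes x: "\<And>i. 0 < x $ i" and T: "size T = CARD('n)"
  shows "affine hull (chamber x T) = UNIV"
proof -
  let ?S = "{y. strict_point x y} \<inter> {y. strict_heap 1 T (valley x y)}"
  have "open ?S" by (intro open_Int open_strict_points open_strict_heap_points)
  moreover have "?S \<subseteq> chamber x T"
    by (auto simp: chamber_def strict_point_imp_Pi strict_heap_imp_heap)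
  ultimately have "?S \<subseteq> interior (chamber x T)" by (rule interior_maximal[rotated])
  then have "interior (chamber x T) \<noteq> {}" using ex_strict_heap_point[OF x T] by blast
  then show ?thesis by (rule affine_hull_nonempty_interior)
qed

lemma affine_hull_bij_affine_image:
  fixes f :: "'a::euclidean_space \<Rightarrow> 'a"
  assumes f: "linear f" "surj f" and S: "affine hull S = UNIV"
  shows "affine hull ((\<lambda>v. f v + b) ` S) = UNIV"
proof -
  have "(\<lambda>v. f v + b) ` S = (\<lambda>v. b + v) ` (f ` S)" by (auto simp: add.commute image_image)
  then have "affine hull ((\<lambda>v. f v + b) ` S) = (\<lambda>v. b + v) ` (f ` (affine hull S))"
    using affine_hull_translation affine_hull_linear_image[OF linear_conv_bounded_linear[THEN iffD1, OF f(1)]] by metis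
  then show ?thesis using S f(2) by simp
qed

lemma directions_eq_UNIV: "affine hull S = UNIV \<Longrightarrow> directions S = UNIV"
  by (auto simp: directions_def) (metis diff_zero)

lemma polytope_affine_image:
  fixes f :: "'a::euclidean_space \<Rightarrow> 'b::euclidean_space"
  assumes "linear f" "polytope S"
  shows "polytope ((\<lambda>v. f v + b) ` S)"
proof -
  have "(\<lambda>v. f v + b) ` S = (\<lambda>v. b + v) ` (f ` S)" by (auto simp: add.commute image_image)
  then show ?thesis using polytope_linear_image[OF assms] by (simp add: polytope_translation_eq)
qed

text \<open>Both facts are transported from the chamber along the affine bijection.\<close>

lemma simplex_product_facts:
  fixes x :: "real^'n::{finite,linorder}"
  assumes x: "\<And>i. 0 < x $ i" and T: "size T = CARD('n)"
  shows "polytope (simplex_product (k_seq T) x)" "affine hull (simplex_product (k_seq T) x) = UNIV"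
proof -
  have "T \<noteq> Leaf" using T by auto
  then have P: "interval_list CARD('n) (chain_pairs T)" using interval_list_chain_pairs[of T] T by simp
  have im: "simplex_product (k_seq T) x =
      (\<lambda>y. interval_map (chain_pairs T) y + chain_shift x T) ` chamber x T"
    using bij_betw_imp_surj_on[OF bij_betw_chain_map[OF x T]] by simp
  show "polytope (simplex_product (k_seq T) x)"
    unfolding im by (rule polytope_affine_image[OF linear_interval_map polytope_chamber])
  show "affine hull (simplex_product (k_seq T) x) = UNIV"
    unfolding im
    by (rule affine_hull_bij_affine_image[OF linear_interval_map bij_is_surj[OF bij_interval_map[OF P]]
          affine_hull_chamber[OF x T]])
qed

lemma bij_betw_int_points:
  fixes f :: "real^'k \<Rightarrow> real^'m"
  assumes "bij f" "\<And>v. f v \<in> int_points \<longleftrightarrow> v \<in> int_points"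
  shows "bij_betw f int_points int_points"
proof (rule bij_betw_imageI)
  show "inj_on f int_points" using bij_is_inj[OF assms(1)] inj_on_subset by blast
  show "f ` int_points = int_points"
  proof
    show "f ` int_points \<subseteq> int_points" using assms(2) by blast
    show "int_points \<subseteq> f ` int_points"
    proof
      fix w :: "real^'m" assume w: "w \<in> int_points"
      then show "w \<in> f ` int_points"
        using assms(2)[of "inv f w"] surj_f_inv_f[OF bij_is_surj[OF assms(1)], of w] by (metis imageI)
    qed
  qed
qed

lemma lattice_equivalent_chamber:
  fixes x :: "real^'n::{finite,linorder}"
  assumes x: "\<And>i. 0 < x $ i" and T: "size T = CARD('n)"
  shows "lattice_equivalent (chamber x T) (simplex_product (k_seq T) x)"
proof -
  have "T \<noteq> Leaf" using T by auto
  then have P: "interval_list CARD('n) (chain_pairs T)" using interval_list_chain_pairs[of T] T by simp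
  let ?f = "interval_map (chain_pairs T) :: real^'n::{finite,linorder} \<Rightarrow> _"
  have "bij_betw ?f int_points int_points"
    by (rule bij_betw_int_points[OF bij_interval_map[OF P] interval_map_int_iff[OF P]])
  then show ?thesis
    unfolding lattice_equivalent_def
      directions_eq_UNIV[OF affine_hull_chamber[OF x T]]
      directions_eq_UNIV[OF simplex_product_facts(2)[OF x T]] Int_UNIV_right
    using polytope_chamber simplex_product_facts(1)[OF x T] bij_betw_chain_map[OF x T] linear_interval_map
    by blast
qed

text \<open>
  If an extreme point had a non-integral coordinate \<open>a\<close>, all coordinates equal to \<open>a\<close> could be
  moved up or down together without violating any inequality.
\<close>

lemma simplex_product_mono_image:
  fixes x v :: "real^'n::{finite,linorder}"
  assumes v: "v \<in> simplex_product ks x"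
    and g: "mono_on (insert 0 (range (($) v) \<union> range (($) x))) g" "g 0 = 0" "\<And>i. g (x $ i) = x $ i"
  shows "(\<chi> i. g (v $ i)) \<in> simplex_product ks x"
proof -
  obtain tss where tss: "length tss = CARD('n)" "coords v = concat tss"
    "\<forall>i<CARD('n). tss ! i \<in> order_simplex (ks ! i) (coords x ! i)"
    using v by (auto simp: simplex_product_def)
  have set: "set (concat tss) \<subseteq> range (($) v)"
    unfolding tss(2)[symmetric] by (auto simp: coords_def)
  have "map g (tss ! i) \<in> order_simplex (ks ! i) (coords x ! i)" if i: "i < CARD('n)" for i
  proof -
    have "tss ! i \<in> set tss" using i tss(1) by simp
    then have sub: "set (0 # tss ! i @ [x $ idx i]) \<subseteq> insert 0 (range (($) v) \<union> range (($) x))"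
      using set by auto
    have "sorted (0 # tss ! i @ [x $ idx i])"
      using tss(3) i by (simp add: order_simplex_def coords_nth)
    then have "sorted (map g (0 # tss ! i @ [x $ idx i]))"
      by (rule sorted_map_mono) (rule monotone_on_subset[OF g(1) sub])
    then show ?thesis using tss(3) i g by (simp add: order_simplex_def coords_nth)
  qed
  moreover have "coords (\<chi> i. g (v $ i)) = concat (map (map g) tss)"
    unfolding map_concat[symmetric] tss(2)[symmetric] by (simp add: coords_def)
  ultimately show ?thesis
    unfolding simplex_product_def using tss(1) by (intro CollectI exI[of _ "map (map g) tss"]) simp
qed

lemma simplex_product_extreme_int:
  fixes x v :: "real^'n::{finite,linorder}"
  assumes x: "\<And>i. x $ i \<in> \<int>" and v: "v extreme_point_of simplex_product ks x"
  shows "v \<in> int_points"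
proof (rule ccontr)
  assume "v \<notin> int_points"
  then obtain i where i: "v $ i \<notin> \<int>" by (auto simp: int_points_def)
  define a where "a = v $ i"
  define S where "S = insert 0 (range (($) v) \<union> range (($) x))"
  \<comment> \<open>The distance from \<open>a\<close> to all other values in play, including
    \<open>0\<close> and the bounds; shifting \<open>a\<close> by at most \<open>d\<close> preserves
    the weak order.\<close>
  define d where "d = Min ((\<lambda>z. \<bar>z - a\<bar>) ` (S - {a}))"
  have finS: "finite S" by (simp add: S_def)
  have a: "a \<noteq> 0" "x $ j \<noteq> a" for j using i x[of j] by (auto simp: a_def)
  then have ne: "S - {a} \<noteq> {}" by (auto simp: S_def)
  have "d \<in> (\<lambda>z. \<bar>z - a\<bar>) ` (S - {a})" unfolding d_def by (rule Min_in) (use finS ne in auto)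
  then have d0: "0 < d" by auto
  have dle: "d \<le> \<bar>z - a\<bar>" if "z \<in> S" "z \<noteq> a" for z
    unfolding d_def by (rule Min_le) (use finS that in auto)
  define g where "g e z = (if z = a then a + e else z)" for e z :: real
  have mem: "(\<chi> j. g e (v $ j)) \<in> simplex_product ks x" if e: "\<bar>e\<bar> \<le> d" for e
  proof (rule simplex_product_mono_image)
    show "v \<in> simplex_product ks x" using v by (simp add: extreme_point_of_def)
    show "mono_on (insert 0 (range (($) v) \<union> range (($) x))) (g e)"
      unfolding S_def[symmetric]
    proof (rule mono_onI)
      fix r s assume "r \<in> S" "s \<in> S" "r \<le> s"
      then show "g e r \<le> g e s" using dle[of r] dle[of s] e by (auto simp: g_def)
    qed
  qed (use a in \<open>auto simp: g_def\<close>)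
  let ?u = "\<chi> j. g d (v $ j)" and ?w = "\<chi> j. g (- d) (v $ j)"
  have "?u \<noteq> ?w" using d0 by (auto simp: vec_eq_iff g_def a_def intro!: exI[of _ i])
  moreover have "v = (1 - 1 / 2) *\<^sub>R ?u + (1 / 2) *\<^sub>R ?w"
    by (simp add: vec_eq_iff g_def field_simps)
  ultimately have "v \<in> open_segment ?u ?w"
    unfolding in_segment by (intro conjI exI[of _ "1 / 2"]) auto
  moreover have "?u \<in> simplex_product ks x" "?w \<in> simplex_product ks x" using mem d0 by auto
  ultimately show False using v unfolding extreme_point_of_def by blast
qed

text \<open>For integral \<open>x\<close> the translation is integral too, so the affine map itself
  permutes the integer points. It sends vertices of the chamber to vertices of the product, whose
  integrality is pulled back.\<close>

lemma integrally_equivalent_chamber: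
  fixes x :: "real^'n::{finite,linorder}"
  assumes x: "\<And>i. 0 < x $ i" and T: "size T = CARD('n)" and int: "\<And>i. x $ i \<in> \<int>"
  shows "integrally_equivalent (chamber x T) (simplex_product (k_seq T) x)"
proof -
  have "T \<noteq> Leaf" using T by auto
  then have P: "interval_list CARD('n) (chain_pairs T)" using interval_list_chain_pairs[of T] T by simp
  let ?f = "interval_map (chain_pairs T) :: real^'n::{finite,linorder} \<Rightarrow> _"
  let ?b = "chain_shift x T"
  let ?Q = "simplex_product (k_seq T) x"
  have bint: "?b \<in> int_points"
  proof -
    have "?f x \<in> int_points" using interval_map_int_iff[OF P] int by (simp add: int_points_def)
    then show ?thesis by (auto simp: int_points_def chain_shift_def)
  qed
  have int_iff: "?f v + ?b \<in> int_points \<longleftrightarrow> v \<in> int_points" for v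
  proof -
    have "?f v + ?b \<in> int_points \<longleftrightarrow> ?f v \<in> int_points"
      using bint unfolding int_points_def
      by (auto simp: vector_add_component)
    then show ?thesis using interval_map_int_iff[OF P] by simp
  qed
  have "bij (\<lambda>v. ?f v + ?b)"
  proof (rule bijI)
    show "inj (\<lambda>v. ?f v + ?b)" using inj_interval_map[OF P] by (auto simp: inj_on_def)
    show "surj (\<lambda>v. ?f v + ?b)"
    proof (rule surjI)
      show "?f (inv ?f (w - ?b)) + ?b = w" for w
        using surj_f_inv_f[OF bij_is_surj[OF bij_interval_map[OF P]], of "w - ?b"] by simp
    qed
  qed
  then have bij: "bij_betw (\<lambda>v. ?f v + ?b) int_points int_points"
    by (rule bij_betw_int_points[OF _ int_iff])
  have Q: "integer_polytope ?Q"
    unfolding integer_polytope_def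
    using simplex_product_facts(1)[OF x T] simplex_product_extreme_int[OF int] by blast
  have C: "integer_polytope (chamber x T)"
    unfolding integer_polytope_def
  proof (intro conjI allI impI polytope_chamber)
    fix v assume v: "v extreme_point_of chamber x T"
    have "?f v + ?b extreme_point_of ?Q"
      unfolding extreme_point_of_def
    proof (intro conjI ballI notI)
      show "?f v + ?b \<in> ?Q" using v chain_map_mem_iff[OF x T] by (simp add: extreme_point_of_def)
      fix p q assume p: "p \<in> ?Q" and q: "q \<in> ?Q" and seg: "?f v + ?b \<in> open_segment p q"
      have "?Q = (\<lambda>y. ?f y + ?b) ` chamber x T"
        using bij_betw_imp_surj_on[OF bij_betw_chain_map[OF x T]] by simp
      then obtain p' q' where p': "p = ?f p' + ?b" "p' \<in> chamber x T"
        and q': "q = ?f q' + ?b" "q' \<in> chamber x T" using p q by blast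
      obtain u where u: "0 < u" "u < 1" "?f v + ?b = (1 - u) *\<^sub>R p + u *\<^sub>R q" "p \<noteq> q"
        using seg by (auto simp: in_segment)
      have "?f v = ?f ((1 - u) *\<^sub>R p' + u *\<^sub>R q')"
        using u(3) unfolding p'(1) q'(1) linear_add[OF linear_interval_map] linear_scale[OF linear_interval_map]
        by (simp add: algebra_simps)
      then have "v = (1 - u) *\<^sub>R p' + u *\<^sub>R q'" using inj_interval_map[OF P] by (auto dest: injD)
      then have "v \<in> open_segment p' q'" using u p' q' by (auto simp: in_segment)
      then show False using v p' q' by (auto simp: extreme_point_of_def)
    qed
    then show "v \<in> int_points" using simplex_product_extreme_int[OF int] int_iff by blast
  qed
  show ?thesis
    unfolding integrally_equivalent_def affine_hull_chamber[OF x T] simplex_product_facts(2)[OF x T] Int_UNIV_right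
    using C Q bij bij_betw_chain_map[OF x T] linear_interval_map by blast
qed

section \<open>Lebesgue measure under relabelling and unimodular maps\<close>

text \<open>
  The linear change of variables formula of the library needs a well-ordered index type. The
  following copy of a finite type, ordered through some injection into the natural numbers,
  makes it available for arbitrary finite index types.
\<close>

datatype 'a ordered_copy = Copy (original: 'a)

definition nat_code :: "'a::finite \<Rightarrow> nat" where
  "nat_code = (SOME f. inj f)"

lemma inj_nat_code: "inj (nat_code :: 'a::finite \<Rightarrow> nat)"
proof -
  have "\<exists>f :: 'a \<Rightarrow> nat. inj f"
    using finite_imp_inj_to_nat_seg[of "UNIV :: 'a set"] by auto
  then show ?thesis unfolding nat_code_def by (rule someI_ex)
qed

instantiation ordered_copy :: (finite) "{finite, wellorder}"
begin

definition less_eq_ordered_copy :: "'a ordered_copy \<Rightarrow> 'a ordered_copy \<Rightarrow> bool" where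
  "a \<le> b \<longleftrightarrow> nat_code (original a) \<le> nat_code (original b)"

definition less_ordered_copy :: "'a ordered_copy \<Rightarrow> 'a ordered_copy \<Rightarrow> bool" where
  "a < b \<longleftrightarrow> nat_code (original a) < nat_code (original b)"

instance
proof
  have "(UNIV :: 'a ordered_copy set) \<subseteq> range Copy" by (metis ordered_copy.exhaust rangeI subsetI)
  moreover have "finite (range (Copy :: 'a \<Rightarrow> _))" by (rule finite_imageI, rule finite)
  ultimately show "finite (UNIV :: 'a ordered_copy set)" by (rule finite_subset)
next
  fix a b :: "'a ordered_copy"
  assume "a \<le> b" "b \<le> a"
  then have "nat_code (original a) = nat_code (original b)" by (simp add: less_eq_ordered_copy_def)
  then have "original a = original b" by (rule injD[OF inj_nat_code])
  then show "a = b" by (cases a; cases b) simp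
next
  fix Q :: "'a ordered_copy \<Rightarrow> bool" and a
  assume step: "\<And>b. (\<And>c. c < b \<Longrightarrow> Q c) \<Longrightarrow> Q b"
  show "Q a"
  proof (induction a rule: measure_induct_rule[where f = "\<lambda>a. nat_code (original a)"])
    case (less a)
    show ?case
    proof (rule step)
      fix c assume "c < a"
      then show "Q c" by (intro less) (simp only: less_ordered_copy_def)
    qed
  qed
qed (auto simp: less_eq_ordered_copy_def less_ordered_copy_def)

end

section \<open>Permuting coordinates\<close>

definition relabel :: "('m \<Rightarrow> 'n) \<Rightarrow> real^'n \<Rightarrow> real^'m" where
  "relabel \<pi> v = (\<chi> j. v $ \<pi> j)"

lemma nth_relabel: "($) (relabel \<pi> v) = ($) v \<circ> \<pi>"
  by (simp add: relabel_def fun_eq_iff)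

lemma linear_relabel: "linear (relabel \<pi>)"
  by (rule linearI) (simp_all add: relabel_def vec_eq_iff)

lemma relabel_relabel: "relabel \<pi> (relabel \<rho> v) = relabel (\<rho> \<circ> \<pi>) v"
  by (simp add: relabel_def vec_eq_iff)

lemma relabel_id [simp]: "relabel id v = v"
  by (simp add: relabel_def vec_eq_iff)

lemma prod_Basis_cart: "(\<Prod>b\<in>Basis. (v :: real^'m) \<bullet> b) = (\<Prod>j\<in>UNIV. v $ j)"
proof -
  have "(Basis :: (real^'m) set) = (\<lambda>j. axis j 1) ` UNIV" by (auto simp: Basis_vec_def)
  then have "(\<Prod>b\<in>Basis. v \<bullet> b) = (\<Prod>b\<in>range (\<lambda>j. axis j 1). v \<bullet> b)" by (rule arg_cong)
  also have "\<dots> = (\<Prod>j\<in>UNIV. v \<bullet> axis j 1)"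
    by (subst prod.reindex) (auto simp: inj_on_def axis_eq_axis)
  finally show ?thesis by (simp add: inner_axis)
qed

lemma emeasure_lborel_box_cart:
  fixes l u :: "real^'m"
  assumes "\<And>j. l $ j \<le> u $ j"
  shows "emeasure lborel (box l u) = (\<Prod>j\<in>UNIV. u $ j - l $ j)"
proof -
  have "emeasure lborel (box l u) = (\<Prod>b\<in>Basis. (u - l) \<bullet> b)"
    by (rule emeasure_lborel_box) (use assms in \<open>auto simp: Basis_vec_def inner_axis\<close>)
  then show ?thesis by (simp add: prod_Basis_cart)
qed

lemma borel_measurable_relabel: "relabel \<pi> \<in> borel_measurable borel"
  by (intro borel_measurable_continuous_onI linear_continuous_on
      linear_conv_bounded_linear[THEN iffD1] linear_relabel)

text \<open>Lebesgue measure is determined by boxes, and the preimage of a box is a box with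
  permuted sides.\<close>

lemma lborel_distr_relabel:
  fixes \<rho> :: "'n::finite \<Rightarrow> 'm::finite"
  assumes "bij \<rho>"
  shows "distr lborel lborel (relabel \<rho>) = (lborel :: (real^'n) measure)"
proof (rule lborel_eqI[symmetric])
  fix l u :: "real^'n" assume lu: "\<And>b. b \<in> Basis \<Longrightarrow> l \<bullet> b \<le> u \<bullet> b"
  have le: "l $ i \<le> u $ i" for i using lu[of "axis i 1"] by (simp add: inner_axis)
  have inv: "inv \<rho> (\<rho> i) = i" "\<rho> (inv \<rho> j) = j" for i j
    using assms by (auto simp: bij_is_inj bij_is_surj surj_f_inv_f)
  have vim: "relabel \<rho> -` box l u = box (relabel (inv \<rho>) l) (relabel (inv \<rho>) u)"
    using inv by (auto simp: mem_box_cart relabel_def) (metis inv(1))+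
  have "relabel \<rho> \<in> borel_measurable lborel"
    using borel_measurable_relabel by simp
  then have "emeasure (distr lborel lborel (relabel \<rho>)) (box l u) = emeasure lborel (relabel \<rho> -` box l u)"
    by (subst emeasure_distr) auto
  also have "\<dots> = (\<Prod>j\<in>UNIV. u $ inv \<rho> j - l $ inv \<rho> j)"
    unfolding vim by (subst emeasure_lborel_box_cart) (auto simp: relabel_def le)
  also have "(\<Prod>j\<in>UNIV. u $ inv \<rho> j - l $ inv \<rho> j) = (\<Prod>i\<in>UNIV. u $ i - l $ i)"
    by (rule prod.reindex_bij_betw[OF bij_imp_bij_inv[OF assms]])
  also have "\<dots> = (\<Prod>b\<in>Basis. (u - l) \<bullet> b)" by (simp add: prod_Basis_cart)
  finally show "emeasure (distr lborel lborel (relabel \<rho>)) (box l u) = (\<Prod>b\<in>Basis. (u - l) \<bullet> b)" .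
qed simp

lemma measure_relabel:
  fixes \<pi> :: "'m::finite \<Rightarrow> 'n::finite"
  assumes \<pi>: "bij \<pi>" and S: "compact S"
  shows "measure lebesgue (relabel \<pi> ` S) = measure lebesgue S"
proof -
  have comp: "\<pi> \<circ> inv \<pi> = id" "inv \<pi> \<circ> \<pi> = id"
    using surj_iff[THEN iffD1, OF bij_is_surj[OF \<pi>]] inv_o_cancel[OF bij_is_inj[OF \<pi>]] .
  have im: "relabel \<pi> ` S = relabel (inv \<pi>) -` S"
  proof (rule set_eqI, rule iffI)
    fix w assume "w \<in> relabel \<pi> ` S"
    then show "w \<in> relabel (inv \<pi>) -` S" by (auto simp: relabel_relabel comp)
  next
    fix w assume "w \<in> relabel (inv \<pi>) -` S"
    moreover have "w = relabel \<pi> (relabel (inv \<pi>) w)" by (simp add: relabel_relabel comp)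
    ultimately show "w \<in> relabel \<pi> ` S" by blast
  qed
  have meas: "relabel (inv \<pi>) \<in> borel_measurable lborel"
    using borel_measurable_relabel by simp
  have SB: "S \<in> sets borel" using S by (simp add: borel_compact)
  have "measure lborel S = measure (distr lborel lborel (relabel (inv \<pi>))) S"
    using lborel_distr_relabel[OF bij_imp_bij_inv[OF \<pi>]] by simp
  also have "\<dots> = measure lborel (relabel (inv \<pi>) -` S)"
    using meas SB by (subst measure_distr) auto
  finally have "measure lborel S = measure lborel (relabel (inv \<pi>) -` S)" .
  moreover have "relabel (inv \<pi>) -` S \<in> sets borel"
    using measurable_sets[OF meas, of S] SB by simp
  ultimately show ?thesis unfolding im using SB by (simp add: measure_completion)
qed

section \<open>Unimodular linear maps\<close>

lemma det_int:
  fixes A :: "real^'n^'n"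
  assumes "\<And>i j. A $ i $ j \<in> \<int>"
  shows "det A \<in> \<int>"
  unfolding det_def using assms by (intro Ints_sum Ints_mult Ints_prod) auto

text \<open>\<open>f\<close> and its inverse map unit vectors to integer points, so their
  determinants are integers with product \<open>1\<close>.\<close>

lemma abs_det_unimodular:
  fixes f :: "real^'n \<Rightarrow> real^'n"
  assumes f: "linear f" "bij f" and int: "\<And>v. f v \<in> int_points \<longleftrightarrow> v \<in> int_points"
  shows "\<bar>det (matrix f)\<bar> = 1"
proof -
  have g: "linear (inv f)" using f inj_linear_imp_inv_linear bij_is_inj by blast
  have axis: "axis j 1 \<in> int_points" for j :: 'n by (simp add: int_points_def axis_def)
  have "inv f (axis j 1) \<in> int_points" for j
    using int[of "inv f (axis j 1)"] axis surj_f_inv_f[OF bij_is_surj[OF f(2)]] by simp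
  then have dg: "det (matrix (inv f)) \<in> \<int>"
    by (intro det_int) (simp add: matrix_def int_points_def)
  have "f (axis j 1) \<in> int_points" for j using int[of "axis j 1"] axis by simp
  then have df: "det (matrix f) \<in> \<int>"
    by (intro det_int) (simp add: matrix_def int_points_def)
  have "f \<circ> inv f = id" using f(2) by (simp add: bij_is_surj surj_iff[symmetric])
  then have "matrix f ** matrix (inv f) = mat 1"
    using matrix_compose[OF g f(1)] by (simp add: matrix_id_mat_1)
  then have "det (matrix f) * det (matrix (inv f)) = 1" by (metis det_I det_mul)
  moreover obtain a b where "det (matrix f) = of_int a" "det (matrix (inv f)) = of_int b"
    using df dg by (auto elim!: Ints_cases)
  ultimately have ab: "det (matrix f) = of_int a" "a * b = 1"
    by (auto simp flip: of_int_mult)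
  then have "\<bar>a\<bar> = 1" using abs_zmult_eq_1[of a b] by simp
  then show ?thesis using ab(1) by (metis of_int_1 of_int_abs)
qed

text \<open>Conjugation with the relabelling along the ordered copy preserves measures and
  integrality, and the determinant formula applies to the conjugate.\<close>

lemma measure_unimodular_image:
  fixes f :: "real^'n \<Rightarrow> real^'n"
  assumes f: "linear f" "bij f" and int: "\<And>v. f v \<in> int_points \<longleftrightarrow> v \<in> int_points"
    and S: "compact S"
  shows "measure lebesgue (f ` S) = measure lebesgue S"
proof -
  let ?h = "relabel (original :: 'n ordered_copy \<Rightarrow> 'n)"
  let ?g = "relabel (Copy :: 'n \<Rightarrow> 'n ordered_copy)"
  let ?f = "?h \<circ> f \<circ> ?g"
  have bij_orig: "bij (original :: 'n ordered_copy \<Rightarrow> 'n)"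
  proof (rule bijI)
    show "inj (original :: 'n ordered_copy \<Rightarrow> 'n)" by (metis ordered_copy.collapse injI)
    show "surj (original :: 'n ordered_copy \<Rightarrow> 'n)" by (rule surjI[of _ Copy]) simp
  qed
  have gh: "?g (?h v) = v" and hg: "?h (?g w) = w" for v w
    by (simp_all add: relabel_def vec_eq_iff)
  have lin: "linear ?f" by (intro linear_compose linear_relabel f)
  have bij: "bij ?f"
  proof (intro bij_comp f(2))
    show "bij ?h" by (rule bijI) (metis gh injI, metis hg surjI)
    show "bij ?g" by (rule bijI) (metis hg injI, metis gh surjI)
  qed
  have h_int: "?h v \<in> int_points \<longleftrightarrow> v \<in> int_points" for v
    using bij_is_surj[OF bij_orig] by (auto simp: int_points_def relabel_def) (metis surjD)
  have "?f w \<in> int_points \<longleftrightarrow> w \<in> int_points" for w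
    using h_int[of "f (?g w)"] h_int[of "?g w"] int hg by simp
  then have det: "\<bar>det (matrix ?f)\<bar> = 1" by (rule abs_det_unimodular[OF lin bij])
  have cf: "compact (f ` S)"
    using S compact_continuous_image f(1) linear_continuous_on linear_conv_bounded_linear by blast
  have ch: "compact (?h ` S)"
    using S compact_continuous_image linear_relabel linear_continuous_on linear_conv_bounded_linear by blast
  have "measure lebesgue (f ` S) = measure lebesgue (?h ` (f ` S))"
    by (rule measure_relabel[OF bij_orig cf, symmetric])
  also have "?h ` (f ` S) = ?f ` (?h ` S)" by (simp add: image_image gh)
  also have "measure lebesgue \<dots> = \<bar>det (matrix ?f)\<bar> * measure lebesgue (?h ` S)"
    by (rule measure_linear_image[OF lin lmeasurable_compact[OF ch]])
  also have "\<dots> = measure lebesgue S" using det measure_relabel[OF bij_orig S] by simp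
  finally show ?thesis .
qed

section \<open>The volume of a product of order simplices\<close>

text \<open>Interpolates between a box (\<open>m = 0\<close>) and a product of order simplices
  (\<open>m = length cs\<close>), so that the volume is found one block at a time.\<close>

definition sorted_blocks :: "('n::finite) list list \<Rightarrow> (nat \<Rightarrow> real) \<Rightarrow> nat \<Rightarrow> (real^'n) set" where
  "sorted_blocks cs X m = {v. (\<forall>i<length cs. \<forall>a\<in>set (cs ! i). 0 \<le> v $ a \<and> v $ a \<le> X i) \<and>
     (\<forall>i<m. sorted (map (($) v) (cs ! i)))}"

lemma closed_sorted_coords: "closed {v :: real^'n. sorted (map (($) v) c)}"
proof (induction c)
  case (Cons a c)
  have "{v :: real^'n. sorted (map (($) v) (a # c))} =
      (\<Inter>b\<in>set c. {v. v $ a \<le> v $ b}) \<inter> {v. sorted (map (($) v) c)}" by auto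
  moreover have "closed (\<Inter>b\<in>set c. {v :: real^'n. v $ a \<le> v $ b})"
    by (intro closed_INT ballI closed_Collect_le continuous_intros)
  ultimately show ?case using Cons by (simp only: closed_Int)
qed simp

lemma permutes_map_eq:
  assumes "distinct c" "distinct d" "set c = set d"
  shows "\<exists>p. p permutes set c \<and> map p c = d"
proof -
  have len: "length c = length d" using assms by (metis distinct_card)
  define p where "p a = (case map_of (zip c d) a of Some b \<Rightarrow> b | None \<Rightarrow> a)" for a
  have map: "map p c = d"
    by (rule nth_equalityI) (use assms len in \<open>auto simp: p_def map_of_zip_nth\<close>)
  then have "p ` set c = set c" using assms(3) by (metis set_map)
  then have "bij_betw p (set c) (set c)"
    by (metis List.finite_set bij_betw_def finite_surj_inj order_refl)
  moreover have "p a = a" if "a \<notin> set c" for a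
  proof -
    have "map_of (zip c d) a = None" using that len by simp
    then show ?thesis by (simp add: p_def)
  qed
  ultimately have "p permutes set c" by (rule bij_imp_permutes)
  then show ?thesis using map by blast
qed

lemma distinct_concat_disjoint:
  assumes "distinct (concat cs)" "i < length cs" "j < length cs" "i \<noteq> j"
  shows "set (cs ! i) \<inter> set (cs ! j) = {}"
  using assms
proof (induction cs arbitrary: i j)
  case (Cons c cs)
  have c: "set c \<inter> set (cs ! k) = {}" if "k < length cs" for k
  proof -
    have "set (cs ! k) \<subseteq> set (concat cs)" using nth_mem[OF that] by auto
    moreover have "set c \<inter> set (concat cs) = {}" using Cons.prems(1) by simp
    ultimately show ?thesis by blast
  qed
  show ?case
  proof (cases i; cases j)
    fix j' assume "i = 0" "j = Suc j'"
    then show ?thesis using c[of j'] Cons.prems by simp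
  next
    fix i' assume "i = Suc i'" "j = 0"
    then show ?thesis using c[of i'] Cons.prems by (simp add: Int_commute)
  next
    fix i' j' assume "i = Suc i'" "j = Suc j'"
    then show ?thesis using Cons.IH[of i' j'] Cons.prems by simp
  qed (use Cons.prems in simp)
qed simp

text \<open>The region is covered by the pieces on which block \<open>m\<close> is sorted after a
  permutation of its indices. Relabelling carries these pieces into each other, and two of them meet
  only where two coordinates agree.\<close>

lemma measure_sorted_blocks_Suc:
  fixes cs :: "('n::finite) list list"
  assumes cs: "distinct (concat cs)" and m: "m < length cs" and cpt: "compact (sorted_blocks cs X m)"
  shows "measure lebesgue (sorted_blocks cs X m) =
    fact (length (cs ! m)) * measure lebesgue (sorted_blocks cs X (Suc m))"
proof -
  let ?A = "sorted_blocks cs X m"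
  let ?c = "cs ! m"
  define B where "B p = {v\<in>?A. sorted (map (($) v) (map p ?c))}" for p
  have dist: "distinct ?c" using cs m by (simp add: distinct_concat_iff)
  have other: "p a = a" if p: "p permutes set ?c" and i: "i < length cs" "i \<noteq> m" "a \<in> set (cs ! i)" for p i a
  proof -
    have "set (cs ! i) \<inter> set ?c = {}"
      by (rule distinct_concat_disjoint[OF cs i(1) m i(2)])
    then have "a \<notin> set ?c" using i(3) by blast
    then show ?thesis by (rule permutes_not_in[OF p])
  qed
  \<comment> \<open>A permutation of block \<open>m\<close> exchanges coordinates with the same
    bound and leaves the blocks sorted before alone.\<close>
  have inv: "relabel p v \<in> ?A" if p: "p permutes set ?c" and v: "v \<in> ?A" for p v
  proof -
    have "0 \<le> v $ p a \<and> v $ p a \<le> X i" if i: "i < length cs" "a \<in> set (cs ! i)" for i a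
    proof (cases "i = m")
      case True
      then have "p a \<in> set ?c" using p i by (simp add: permutes_in_image)
      then show ?thesis using v True m by (auto simp: sorted_blocks_def)
    next
      case False
      then show ?thesis using other[OF p i(1) False i(2)] v i by (auto simp: sorted_blocks_def)
    qed
    moreover have "sorted (map (($) (relabel p v)) (cs ! i))" if i: "i < m" for i
    proof -
      have "map (($) (relabel p v)) (cs ! i) = map (($) v) (cs ! i)"
        using other[OF p, of i] i m by (auto simp: relabel_def)
      moreover have "sorted (map (($) v) (cs ! i))" using v i by (simp add: sorted_blocks_def)
      ultimately show ?thesis by (simp only:)
    qed
    ultimately show ?thesis by (auto simp: sorted_blocks_def relabel_def)
  qed
  have B_id: "B id = sorted_blocks cs X (Suc m)"
    by (auto simp: B_def sorted_blocks_def less_Suc_eq)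
  have compactB: "compact (B p)" for p
  proof -
    have eq: "B p = ?A \<inter> {v. sorted (map (($) v) (map p ?c))}" by (auto simp: B_def)
    show ?thesis unfolding eq by (rule compact_Int_closed[OF cpt closed_sorted_coords])
  qed
  have eqB: "measure lebesgue (B p) = measure lebesgue (B id)" if p: "p permutes set ?c" for p
  proof -
    have "relabel p ` B p = B id"
    proof
      show "relabel p ` B p \<subseteq> B id"
        using inv[OF p] by (auto simp: B_def nth_relabel)
      show "B id \<subseteq> relabel p ` B p"
      proof
        fix w assume w: "w \<in> B id"
        have "relabel p (relabel (Hilbert_Choice.inv p) w) = w"
          using permutes_inv_o(2)[OF p] by (simp add: relabel_relabel)
        moreover have "relabel (Hilbert_Choice.inv p) w \<in> B p"
          using w inv[OF permutes_inv[OF p]] permutes_inv_o(2)[OF p]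
          by (auto simp: B_def nth_relabel comp_assoc)
        ultimately show "w \<in> relabel p ` B p" by (metis imageI)
      qed
    qed
    then show ?thesis using measure_relabel[OF permutes_bij[OF p] compactB[of p]] by simp
  qed
  have cover: "?A = (\<Union>p\<in>{p. p permutes set ?c}. B p)"
  proof
    show "?A \<subseteq> (\<Union>p\<in>{p. p permutes set ?c}. B p)"
    proof
      fix v assume v: "v \<in> ?A"
      obtain p where "p permutes set ?c" "map p ?c = sort_key (($) v) ?c"
        using permutes_map_eq[of ?c "sort_key (($) v) ?c"] dist by auto
      then show "v \<in> (\<Union>p\<in>{p. p permutes set ?c}. B p)"
        using v by (intro UN_I[of p]) (simp_all add: B_def del: map_map)
    qed
  qed (auto simp: B_def)
  have negl: "negligible (B p \<inter> B q)" if p: "p permutes set ?c" and q: "q permutes set ?c" and pq: "p \<noteq> q" for p q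
  proof (rule negligible_subset)
    let ?H = "\<Union>(a, b)\<in>{(a, b). a \<noteq> b}. {v :: real^'n. (axis a 1 - axis b 1) \<bullet> v = 0}"
    show "negligible ?H"
    proof (rule negligible_Union, simp, clarify)
      fix a b :: 'n assume "a \<noteq> b"
      then have "axis a (1 :: real) - axis b 1 \<noteq> 0" by (simp add: axis_eq_axis)
      then show "negligible {v :: real^'n. (axis a 1 - axis b 1) \<bullet> v = 0}"
        by (intro negligible_hyperplane) simp
    qed
    show "B p \<inter> B q \<subseteq> ?H"
    proof
      fix v assume v: "v \<in> B p \<inter> B q"
      have "\<exists>a b. a \<noteq> b \<and> v $ a = v $ b"
      proof (rule ccontr)
        assume "\<not> ?thesis"
        then have inj: "inj (($) v)" by (auto simp: inj_def)
        have set_eq: "set (map p ?c) = set ?c" "set (map q ?c) = set ?c"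
          using permutes_image[OF p] permutes_image[OF q] by simp_all
        have d: "distinct (map p ?c)" "distinct (map q ?c)"
          using dist permutes_inj_on[OF p] permutes_inj_on[OF q] by (simp_all add: distinct_map)
        \<comment> \<open>Both lists enumerate the same set of distinct values in increasing
          order.\<close>
        have "map (($) v) (map p ?c) = map (($) v) (map q ?c)"
        proof (rule sorted_distinct_set_unique)
          show "distinct (map (($) v) (map p ?c))" "distinct (map (($) v) (map q ?c))"
            using d inj by (simp_all add: distinct_map inj_on_subset[OF inj] del: map_map)
          show "set (map (($) v) (map p ?c)) = set (map (($) v) (map q ?c))"
            using set_eq by (metis set_map)
        qed (use v in \<open>simp_all add: B_def del: map_map\<close>)
        then have "map p ?c = map q ?c" using inj by (metis inj_map_eq_map)
        then have "p a = q a" for a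
          using permutes_not_in[OF p, of a] permutes_not_in[OF q, of a] by (cases "a \<in> set ?c") auto
        then show False using pq by blast
      qed
      then show "v \<in> ?H" by (auto simp: inner_diff_left inner_axis')
    qed
  qed
  have "measure lebesgue ?A = (\<Sum>p\<in>{p. p permutes set ?c}. measure lebesgue (B p))"
    unfolding cover
    by (rule measure_negligible_finite_Union_image)
       (use negl compactB finite_permutations in \<open>auto simp: pairwise_def lmeasurable_compact\<close>)
  also have "\<dots> = (\<Sum>p\<in>{p. p permutes set ?c}. measure lebesgue (B id))"
    by (rule sum.cong[OF refl], rule eqB) simp
  also have "\<dots> = fact (length ?c) * measure lebesgue (B id)"
    using card_permutations[of "set ?c" "length ?c"] dist by (simp add: distinct_card)
  finally show ?thesis by (simp add: B_id)
qed

lemma sorted_blocks_0: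
  fixes cs :: "('n::finite) list list"
  assumes cs: "distinct (concat cs)" "set (concat cs) = UNIV" and X: "\<And>i. 0 \<le> X i"
  shows "compact (sorted_blocks cs X 0)"
    "measure lebesgue (sorted_blocks cs X 0) = (\<Prod>i<length cs. X i ^ length (cs ! i))"
proof -
  note disj = distinct_concat_disjoint[OF cs(1)]
  have UN: "(\<Union>i\<in>{..<length cs}. set (cs ! i)) = UNIV"
    unfolding cs(2)[symmetric] set_concat set_conv_nth[of cs] by blast
  define blk where "blk a = (THE i. i < length cs \<and> a \<in> set (cs ! i))" for a
  have blk: "blk a = i" if "i < length cs" "a \<in> set (cs ! i)" for a i
    unfolding blk_def by (rule the_equality) (use that disj in blast)+
  have box: "sorted_blocks cs X 0 = cbox 0 (\<chi> a. X (blk a))"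
  proof (rule set_eqI)
    fix v
    have "v \<in> cbox 0 (\<chi> a. X (blk a)) \<longleftrightarrow>
        (\<forall>a\<in>(\<Union>i\<in>{..<length cs}. set (cs ! i)). 0 \<le> v $ a \<and> v $ a \<le> X (blk a))"
      unfolding UN by (simp add: mem_box_cart)
    also have "\<dots> \<longleftrightarrow> v \<in> sorted_blocks cs X 0" using blk by (auto simp: sorted_blocks_def)
    finally show "v \<in> sorted_blocks cs X 0 \<longleftrightarrow> v \<in> cbox 0 (\<chi> a. X (blk a))" by simp
  qed
  show "compact (sorted_blocks cs X 0)" unfolding box by simp
  have "0 \<in> cbox 0 (\<chi> a :: 'n. X (blk a))" using X by (simp add: mem_box_cart)
  then have "cbox 0 (\<chi> a :: 'n. X (blk a)) \<noteq> {}" by blast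
  then have "measure lebesgue (sorted_blocks cs X 0) = (\<Prod>a\<in>UNIV. X (blk a))"
    unfolding box using content_cbox_cart[of 0 "\<chi> a. X (blk a)"] by simp
  also have "\<dots> = (\<Prod>a\<in>(\<Union>i\<in>{..<length cs}. set (cs ! i)). X (blk a))" unfolding UN ..
  also have "\<dots> = (\<Prod>i<length cs. \<Prod>a\<in>set (cs ! i). X (blk a))"
    by (rule prod.UNION_disjoint) (use disj in auto)
  also have "\<dots> = (\<Prod>i<length cs. X i ^ length (cs ! i))"
  proof (rule prod.cong)
    fix i assume "i \<in> {..<length cs}"
    then have i: "i < length cs" by simp
    have "distinct (cs ! i)" using cs(1) i by (simp add: distinct_concat_iff)
    then show "(\<Prod>a\<in>set (cs ! i). X (blk a)) = X i ^ length (cs ! i)"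
      using blk[OF i] by (simp add: distinct_card)
  qed simp
  finally show "measure lebesgue (sorted_blocks cs X 0) = (\<Prod>i<length cs. X i ^ length (cs ! i))" .
qed

lemma measure_sorted_blocks:
  fixes cs :: "('n::finite) list list"
  assumes cs: "distinct (concat cs)" "set (concat cs) = UNIV" and X: "\<And>i. 0 \<le> X i"
  shows "measure lebesgue (sorted_blocks cs X (length cs)) =
    (\<Prod>i<length cs. X i ^ length (cs ! i) / fact (length (cs ! i)))"
proof -
  have cpt: "compact (sorted_blocks cs X m)" for m
  proof (induction m)
    case 0
    show ?case by (rule sorted_blocks_0(1)[OF cs X])
  next
    case (Suc m)
    have "sorted_blocks cs X (Suc m) = sorted_blocks cs X m \<inter> {v. sorted (map (($) v) (cs ! m))}"
      by (auto simp: sorted_blocks_def less_Suc_eq)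
    then show ?case using compact_Int_closed[OF Suc closed_sorted_coords] by simp
  qed
  have "measure lebesgue (sorted_blocks cs X 0) =
      (\<Prod>i<m. fact (length (cs ! i))) * measure lebesgue (sorted_blocks cs X m)" if "m \<le> length cs" for m
    using that
  proof (induction m)
    case (Suc m)
    then show ?case using measure_sorted_blocks_Suc[OF cs(1) _ cpt, of m] by simp
  qed simp
  from this[OF order_refl] show ?thesis
    unfolding sorted_blocks_0(2)[OF cs X] by (simp add: prod_dividef field_simps)
qed

lemma ex_concat_lengths: "sum_list ks = length xs \<Longrightarrow> \<exists>cs. concat cs = xs \<and> map length cs = ks"
proof (induction ks arbitrary: xs)
  case (Cons k ks)
  have "length xs = k + sum_list ks" using Cons.prems by simp
  then have "sum_list ks = length (drop k xs)" by simp
  from Cons.IH[OF this] obtain cs where "concat cs = drop k xs" "map length cs = ks" by blast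
  then show ?case using Cons.prems by (intro exI[of _ "take k xs # cs"]) auto
qed simp

lemma measure_simplex_product:
  fixes x :: "real^'n::{finite,linorder}"
  assumes x: "\<And>i. 0 < x $ i" and ks: "length ks = CARD('n)" "sum_list ks = CARD('n)"
  shows "measure lebesgue (simplex_product ks x) = (\<Prod>i<CARD('n). (coords x ! i) ^ (ks ! i) / fact (ks ! i))"
proof -
  let ?es = "sorted_list_of_set (UNIV :: 'n set)"
  \<comment> \<open>The indices in increasing order are cut into consecutive blocks of lengths
    \<open>ks\<close>, matching the concatenation in \<open>simplex_product\<close>.\<close>
  obtain cs where cs: "concat cs = ?es" "map length cs = ks"
    using ex_concat_lengths[of ks ?es] ks by auto
  have len: "length cs = CARD('n)" "i < CARD('n) \<Longrightarrow> length (cs ! i) = ks ! i" for i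
    using cs(2) ks(1) by (metis length_map, metis length_map nth_map)
  have dc: "distinct (concat cs)" "set (concat cs) = UNIV" by (simp_all add: cs(1))
  define X where "X i = (if i < CARD('n) then x $ idx i else 0)" for i
  have X: "0 \<le> X i" for i using x[of "idx i"] by (simp add: X_def less_imp_le)
  have "simplex_product ks x = sorted_blocks cs X (length cs)"
  proof (rule set_eqI)
    fix v :: "real^'n::{finite,linorder}"
    have "coords v = concat (map (map (($) v)) cs)"
      unfolding map_concat[symmetric] cs(1) by (simp add: coords_def)
    then have "v \<in> simplex_product ks x \<longleftrightarrow>
        (\<forall>i<CARD('n). sorted (0 # map (map (($) v)) cs ! i @ [x $ idx i]))"
      by (rule simplex_product_iff) (use len in auto)
    also have "\<dots> \<longleftrightarrow> v \<in> sorted_blocks cs X (length cs)"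
      using less_imp_le[OF x] by (auto simp: len X_def sorted_blocks_def sorted_append)
    finally show "v \<in> simplex_product ks x \<longleftrightarrow> v \<in> sorted_blocks cs X (length cs)" .
  qed
  then have "measure lebesgue (simplex_product ks x) =
      (\<Prod>i<length cs. X i ^ length (cs ! i) / fact (length (cs ! i)))"
    using measure_sorted_blocks[OF dc X] by simp
  also have "\<dots> = (\<Prod>i<CARD('n). (coords x ! i) ^ (ks ! i) / fact (ks ! i))"
    by (rule prod.cong) (auto simp: len X_def coords_nth)
  finally show ?thesis .
qed

text \<open>The chains partition the vertices, and the last chain, which \<open>k_seq\<close> leaves
  out, is empty.\<close>

lemma sum_list_k_seq:
  assumes "T \<noteq> Leaf"
  shows "sum_list (k_seq T) = size T"
proof -
  have "k_seq T = map length (map ((!) (left_chains 0 T)) [0..<size T])"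
    by (rule nth_equalityI) (auto simp: k_seq_nth)
  then have "sum_list (k_seq T) = length (concat (left_chains 0 T))"
    by (simp only: length_concat[symmetric] concat_left_chains[OF assms])
  also have "\<dots> = size T"
    using distinct_card[OF distinct_concat_chains[of 0 T]] by (simp only: set_concat_chains) simp
  finally show ?thesis .
qed

lemma measure_chamber:
  fixes x :: "real^'n::{finite,linorder}"
  assumes x: "\<And>i. 0 < x $ i" and T: "size T = CARD('n)"
  shows "measure lebesgue (chamber x T) =
    (\<Prod>i<CARD('n). (coords x ! i) ^ (k_seq T ! i) / fact (k_seq T ! i))"
proof -
  have TL: "T \<noteq> Leaf" using T by auto
  then have P: "interval_list CARD('n) (chain_pairs T)" using interval_list_chain_pairs[of T] T by simp
  have "simplex_product (k_seq T) x =
      (\<lambda>v. chain_shift x T + v) ` (interval_map (chain_pairs T) ` chamber x T)"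
    unfolding bij_betw_imp_surj_on[OF bij_betw_chain_map[OF x T], symmetric]
    by (simp add: image_image add.commute)
  then have "measure lebesgue (simplex_product (k_seq T) x) =
      measure lebesgue (interval_map (chain_pairs T) ` chamber x T)"
    by (simp only: measure_translation)
  also have "\<dots> = measure lebesgue (chamber x T)"
    by (rule measure_unimodular_image[OF linear_interval_map bij_interval_map[OF P] interval_map_int_iff[OF P]
          polytope_imp_compact[OF polytope_chamber]])
  finally show ?thesis
    using measure_simplex_product[OF x, of "k_seq T"] sum_list_k_seq[OF TL] T by simp
qed

theorem theorem17:
  fixes x :: "real^'n::{finite,linorder}" and s :: real
  assumes "s > 0" and "\<And>i. x $ i > 0" and "(\<Sum>i\<in>UNIV. x $ i) < s"
  shows
    "(polyhedral_decomposition (Gamma_decomp s x) (Pi_polytope x) \<and>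
      bij_betw (Delta s x) (plane_binary_trees CARD('n)) (maximal_faces (Gamma_decomp s x)))
   \<and> (\<forall>T\<in>plane_binary_trees CARD('n).
        lattice_equivalent (Delta s x T) (simplex_product (k_seq T) x) \<and>
        ((\<forall>i. x $ i \<in> \<int>) \<longrightarrow>
           integrally_equivalent (Delta s x T) (simplex_product (k_seq T) x)) \<and>
        measure lebesgue (Delta s x T) =
          (\<Prod>i<CARD('n). (coords x ! i) ^ (k_seq T ! i) / fact (k_seq T ! i)))
   \<and> (\<forall>p. convex_polygon (CARD('n) + 2) p \<longrightarrow>
        poset_iso
          (adjoin_top (interior_faces (Gamma_decomp s x) (Pi_polytope x))) (dual_le incl_le)
          (dec (CARD('n) + 2) p) (dual_le incl_le))"
proof -
  have x: "\<And>i. 0 < x $ i" and s: "(\<Sum>i\<in>UNIV. x $ i) < s" using assms(2,3) by blast+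
  have Delta: "Delta s x T = chamber x T" if "T \<in> plane_binary_trees CARD('n)" for T :: "unit tree"
    using Delta_eq_chamber[OF x s] that by (simp add: plane_binary_trees_def)
  then have Gamma: "Gamma_decomp s x = chamber_faces x"
    by (auto simp: Gamma_decomp_def chamber_faces_def)
  show ?thesis
    unfolding Gamma
  proof (intro conjI ballI allI impI)
    show "polyhedral_decomposition (chamber_faces x) (Pi_polytope x)"
      by (rule polyhedral_decomposition_chamber_faces)
    show "bij_betw (Delta s x) (plane_binary_trees CARD('n)) (maximal_faces (chamber_faces x))"
      using bij_betw_chamber[OF x] by (subst bij_betw_cong[OF Delta])
  next
    fix T :: "unit tree" assume "T \<in> plane_binary_trees CARD('n)"
    then have T: "size T = CARD('n)" and DT: "Delta s x T = chamber x T"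
      using Delta by (simp_all add: plane_binary_trees_def)
    show "lattice_equivalent (Delta s x T) (simplex_product (k_seq T) x)"
      unfolding DT by (rule lattice_equivalent_chamber[OF x T])
    show "integrally_equivalent (Delta s x T) (simplex_product (k_seq T) x)" if "\<forall>i. x $ i \<in> \<int>"
      unfolding DT by (rule integrally_equivalent_chamber[OF x T]) (use that in blast)
    show "measure lebesgue (Delta s x T) =
        (\<Prod>i<CARD('n). (coords x ! i) ^ (k_seq T ! i) / fact (k_seq T ! i))"
      unfolding DT by (rule measure_chamber[OF x T])
  next
    fix p assume "convex_polygon (CARD('n) + 2) p"
    then show "poset_iso (adjoin_top (interior_faces (chamber_faces x) (Pi_polytope x))) (dual_le incl_le)
        (dec (CARD('n) + 2) p) (dual_le incl_le)"
      by (rule poset_iso_interior_faces[OF x])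
  qed
qed

end
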